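(* Let $\pi \in I^{\mathsf{fpf}}_\mathbb{Z}$. Then $\mathfrak{fb}_\pi$ is an isomorphism of $\mathfrak{q}_n$-crystals $\displaystyle\bigsqcup_{\sigma\in I^{\mathsf{fpf}}_\mathbb{Z}} \mathcal{R}^{\mathsf{Sp}}_n(\sigma) \to \bigsqcup_{\sigma\in I^{\mathsf{fpf}}_\mathbb{Z}} \mathcal{R}^{\mathsf{Sp}}_n(\sigma)$.
   Context: Fix a positive integer $n$. Let $S_\mathbb{Z}$ be the permutations of $\mathbb{Z}$ fixing all but finitely many integers, $s_i=(i,i+1)$, and $1_{\mathsf{fpf}}$ the permutation $i\mapsto i-(-1)^i$ of $\mathbb{Z}$. $I^{\mathsf{fpf}}_\mathbb{Z}$ is the $S_\mathbb{Z}$-conjugacy class of $1_{\mathsf{fpf}}$. An fpf-involution word for $\pi\in I^{\mathsf{fpf}}_\mathbb{Z}$ is a minimal-length word $i_1\cdots i_l$ with $\pi=s_{i_l}\cdots s_{i_1}1_{\mathsf{fpf}}s_{i_1}\cdots s_{i_l}$; $\mathcal{R}^{\mathsf{Sp}}(\pi)$ is the set of these, and $\mathcal{R}^{\mathsf{Sp}}_n(\pi)$ is the set of $n$-tuples $(w^1,\dots,w^n)$ of strictly increasing words whose concatenation lies in $\mathcal{R}^{\mathsf{Sp}}(\pi)$. It carries Hiroshima's $\mathfrak{q}_n$-crystal structure: weight = factor lengths; $e_i,f_i$ ($i\in[n-1]$) are the Morse–Schilling operators (pair letters of $w^{i+1}$, from largest to smallest, with the smallest unpaired larger letter of $w^i$;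 $f_i$ removes the largest unpaired letter $x$ of $w^i$ and adds to $w^{i+1}$ the smallest $y\ge x$ not present, or gives $0$; $e_i$ removes the smallest unpaired letter $y$ of $w^{i+1}$ and adds to $w^i$ the largest $x\le y$ not present, or gives $0$); $f_{\overline1}(w)=0$ if $w^1=\emptyset$ or $\min w^2\le\min w^1$, otherwise with $x=\min w^1$ it moves $x$ from $w^1$ to $w^2$ if $x+1\notin w^1$, and if $x+1\in w^1$ it removes $x+1$ from $w^1$ and adds $x-1$ to the start of $w^2$; $e_{\overline1}(w)=0$ if $w^2=\emptyset$ or $\min w^1\le\min w^2$, otherwise with $x=\min w^2$ it moves $x$ to $w^1$ if $x$ is even, and if $x$ is odd it removes $x$ from $w^2$ and adds $x+2$ to $w^1$. Fpf-involution Little bumps: for $\pi\in I^{\mathsf{fpf}}_\mathbb{Z}$, a $\pi$-marked fpf-involution word is a pair $(w,i)$ such that deleting the $i$th letter of $w$ gives an element of $\mathcal{R}^{\mathsf{Sp}}(\pi)$; it is fpf-reduced if $w$ is an fpf-involution word, and semi-reduced if it is not fpf-reduced but $w$ is a reduced word for some $\sigma\in S_\mathbb{Z}$ with $\sigma^{-1}1_{\mathsf{fpf}}\sigma=\pi$. If $(w,i)$ is neither, there is a unique $j\ne i$ such that $(w,j)$ is also a $\pi$-marked fpf-involution word; if $(w,i)$ is semi- or fpf-reduced set $j=i$. Define $\textsf{fpush}(w,i)=(v,j)$, where $v$ is $w$ with its $j$th letter increased by one. For an fpf-involution word $w$, if $(w,i)$ is a $\pi$-marked fpf-involution word for some $i$,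 let $N>0$ be minimal with $\textsf{fpush}^N(w,i)=(v,j)$ fpf-reduced and set $\mathfrak{fb}_\pi(w)=v$; otherwise $\mathfrak{fb}_\pi(w)=w$. Since $\mathfrak{fb}_\pi$ preserves descent sets of words, it is extended to factorizations: $\mathfrak{fb}_\pi(w^1,\dots,w^n)=(v^1,\dots,v^n)$ where $v^1\cdots v^n=\mathfrak{fb}_\pi(w^1\cdots w^n)$ and $\ell(v^i)=\ell(w^i)$. *)

theory Defs
  imports Main
begin

definition sZ :: "int \<Rightarrow> int \<Rightarrow> int" where
  "sZ i = (\<lambda>k. if k = i then i + 1 else if k = i + 1 then i else k)"

definition fpf1 :: "int \<Rightarrow> int" where
  "fpf1 = (\<lambda>k. if even k then k - 1 else k + 1)"

definition SZ :: "(int \<Rightarrow> int) set" where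
  "SZ = {\<sigma>. bij \<sigma> \<and> finite {i. \<sigma> i \<noteq> i}}"

definition IfpfZ :: "(int \<Rightarrow> int) set" where
  "IfpfZ = {inv \<sigma> \<circ> fpf1 \<circ> \<sigma> | \<sigma>. \<sigma> \<in> SZ}"

definition conj_word :: "int list \<Rightarrow> int \<Rightarrow> int" where
  "conj_word w = fold (\<lambda>i p. sZ i \<circ> p \<circ> sZ i) w fpf1"

definition RSp :: "(int \<Rightarrow> int) \<Rightarrow> int list set" where
  "RSp \<pi> = {w. conj_word w = \<pi> \<and> (\<forall>v. conj_word v = \<pi> \<longrightarrow> length w \<le> length v)}"

definition RSp_n :: "nat \<Rightarrow> (int \<Rightarrow> int) \<Rightarrow> int list list set" where
  "RSp_n n \<pi> = {ws. length ws = n \<and> (\<forall>w\<in>set ws. sorted_wrt (<) w) \<and> concat ws \<in> RSp \<pi>}"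

definition RSp_union :: "nat \<Rightarrow> int list list set" where
  "RSp_union n = (\<Union>\<sigma>\<in>IfpfZ. RSp_n n \<sigma>)"

section \<open>Crystal operators (factors w^1..w^n are ws!0 .. ws!(n-1))\<close>

definition pair_step :: "int list \<Rightarrow> int set \<times> int set \<Rightarrow> int \<Rightarrow> int set \<times> int set" where
  "pair_step A P b = (let C = {a \<in> set A. b < a \<and> a \<notin> fst P} in
     if C = {} then P else (insert (Min C) (fst P), insert b (snd P)))"

definition pairing :: "int list \<Rightarrow> int list \<Rightarrow> int set \<times> int set" where
  "pairing A B = foldl (pair_step A) ({}, {}) (rev (sort B))"

definition f_op :: "nat \<Rightarrow> int list list \<Rightarrow> int list list option" where
  "f_op i ws = (let A = ws ! (i - 1); B = ws ! i; U = set A - fst (pairing A B) in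
     if U = {} then None else
       (let x = Max U; y = (LEAST y. x \<le> y \<and> y \<notin> set B) in
         Some (ws[i - 1 := remove1 x A, i := insort y B])))"

definition e_op :: "nat \<Rightarrow> int list list \<Rightarrow> int list list option" where
  "e_op i ws = (let A = ws ! (i - 1); B = ws ! i; U = set B - snd (pairing A B) in
     if U = {} then None else
       (let y = Min U; x = (GREATEST x. x \<le> y \<and> x \<notin> set A) in
         Some (ws[i - 1 := insort x A, i := remove1 y B])))"

definition fbar_op :: "int list list \<Rightarrow> int list list option" where
  "fbar_op ws = (let A = ws ! 0; B = ws ! 1 in
     if A = [] \<or> (B \<noteq> [] \<and> Min (set B) \<le> Min (set A)) then None else
       (let x = Min (set A) in
         if x + 1 \<notin> set A then Some (ws[0 := remove1 x A, 1 := x # B])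
         else Some (ws[0 := remove1 (x + 1) A, 1 := (x - 1) # B])))"

definition ebar_op :: "int list list \<Rightarrow> int list list option" where
  "ebar_op ws = (let A = ws ! 0; B = ws ! 1 in
     if B = [] \<or> (A \<noteq> [] \<and> Min (set A) \<le> Min (set B)) then None else
       (let x = Min (set B) in
         if even x then Some (ws[0 := insort x A, 1 := remove1 x B])
         else Some (ws[0 := insort (x + 2) A, 1 := remove1 x B])))"

definition wt :: "int list list \<Rightarrow> nat list" where
  "wt ws = map length ws"

definition perm_word :: "int list \<Rightarrow> int \<Rightarrow> int" where
  "perm_word w = fold (\<lambda>i p. p \<circ> sZ i) w id"

definition reduced_word_for :: "int list \<Rightarrow> (int \<Rightarrow> int) \<Rightarrow> bool" where
  "reduced_word_for w \<sigma> \<longleftrightarrow> perm_word w = \<sigma> \<and> (\<forall>v. perm_word v = \<sigma> \<longrightarrow> length w \<le> length v)"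

definition del_at :: "nat \<Rightarrow> 'a list \<Rightarrow> 'a list" where
  "del_at i w = take i w @ drop (Suc i) w"

text \<open>positions are 0-based\<close>
definition marked :: "(int \<Rightarrow> int) \<Rightarrow> int list \<Rightarrow> nat \<Rightarrow> bool" where
  "marked \<pi> w i \<longleftrightarrow> i < length w \<and> del_at i w \<in> RSp \<pi>"

definition fpf_reduced :: "int list \<Rightarrow> bool" where
  "fpf_reduced w \<longleftrightarrow> w \<in> RSp (conj_word w)"

definition semi_reduced :: "(int \<Rightarrow> int) \<Rightarrow> int list \<Rightarrow> bool" where
  "semi_reduced \<pi> w \<longleftrightarrow> \<not> fpf_reduced w \<and>
     (\<exists>\<sigma>\<in>SZ. reduced_word_for w \<sigma> \<and> inv \<sigma> \<circ> fpf1 \<circ> \<sigma> = \<pi>)"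

definition fpush :: "(int \<Rightarrow> int) \<Rightarrow> int list \<times> nat \<Rightarrow> int list \<times> nat" where
  "fpush \<pi> wi = (let w = fst wi; i = snd wi;
      j = (if fpf_reduced w \<or> semi_reduced \<pi> w then i
           else (THE j. j \<noteq> i \<and> marked \<pi> w j))
    in (w[j := w ! j + 1], j))"

definition fb :: "(int \<Rightarrow> int) \<Rightarrow> int list \<Rightarrow> int list" where
  "fb \<pi> w = (if \<exists>i. marked \<pi> w i then
      (let i = (LEAST i. marked \<pi> w i);
           N = (LEAST N. 0 < N \<and> fpf_reduced (fst ((fpush \<pi> ^^ N) (w, i))))
       in fst ((fpush \<pi> ^^ N) (w, i)))
    else w)"

fun split_lens :: "nat list \<Rightarrow> 'a list \<Rightarrow> 'a list list" where
  "split_lens [] xs = []"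
| "split_lens (l # ls) xs = take l xs # split_lens ls (drop l xs)"

definition fb_fact :: "(int \<Rightarrow> int) \<Rightarrow> int list list \<Rightarrow> int list list" where
  "fb_fact \<pi> ws = split_lens (map length ws) (fb \<pi> (concat ws))"

definition qn_crystal_iso :: "nat \<Rightarrow> int list list set \<Rightarrow> (int list list \<Rightarrow> int list list) \<Rightarrow> bool" where
  "qn_crystal_iso n B \<psi> \<longleftrightarrow> bij_betw \<psi> B B
     \<and> (\<forall>b\<in>B. wt (\<psi> b) = wt b)
     \<and> (\<forall>b\<in>B. \<forall>i\<in>{1..<n}. f_op i (\<psi> b) = map_option \<psi> (f_op i b)
                          \<and> e_op i (\<psi> b) = map_option \<psi> (e_op i b))
     \<and> (2 \<le> n \<longrightarrow> (\<forall>b\<in>B. fbar_op (\<psi> b) = map_option \<psi> (fbar_op b)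
                          \<and> ebar_op (\<psi> b) = map_option \<psi> (ebar_op b)))"

end

theory Submission
  imports Defs "HOL-Combinatorics.Permutations"
begin

text \<open>
  Deleting a letter from a word conjugates the associated involution by a transposition, and a
  strong exchange property holds for arbitrary words. From it follow the length theory of
  fpf-involution words and the fact that a marked word which is neither fpf-reduced nor
  semi-reduced has exactly one other mark. Hence \<open>fpush\<close> permutes the marked words, the letters
  stay in a bounded window until a far away even letter makes the word reduced, and a bump is the
  first return map of this permutation to the reduced words; in particular it is bijective.

  A bump preserves descents, since two equal adjacent letters are both marked and the next push
  separates them again. By a bisimulation of the two bumps it also commutes with the Coxeter--Knuth
  moves on three consecutive letters and with the fpf-specific moves on the first two letters.
  The queer operators are compositions of such moves at fixed positions. For \<open>f_i\<close> and \<open>e_i\<close>, insert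
  the second factor into the first by row insertion, again a composition of Coxeter--Knuth moves.
  The result is a normal form which does not change under \<open>f_i\<close> and \<open>e_i\<close>, and from which the two
  factors are recovered once their lengths are known.
\<close>

text \<open>How many elementary moves realise \<open>f_i\<close> depends on the word, so it is not
  enough that a bump commutes with single moves. The insertion makes this number harmless: a letter
  is inserted exactly when there is a descent between the end of the row and the next letter, and
  bumps keep descents, so a factorization and its image run through the same sequence of moves. The
  number of bumped letters also decides whether \<open>f_i\<close> and \<open>e_i\<close> are
  defined, which is why definedness carries over.

  Two bumps that are compared do not run in step: one push on one side may match three on the other.
  The bisimulation therefore allows detours on both sides, as long as they avoid fpf-reduced words.

  What is used of a bump is collected in a locale, because the inverse of such a map belongs to the
  same locale. Values of an operator then only have to be transported where the operator is defined;
  the undefined case follows by applying the inverse.\<close>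

lemma sZ_transpose: "sZ i = transpose i (i + 1)"
  by (auto simp: sZ_def transpose_def fun_eq_iff)

lemma sZ_sZ [simp]: "sZ i (sZ i k) = k"
  by (auto simp: sZ_def)

lemma sZ_eq_iff [simp]: "sZ i a = sZ i b \<longleftrightarrow> a = b"
  by (metis sZ_sZ)

lemma sZ_less: "a < b \<Longrightarrow> \<not> (a = s \<and> b = s + 1) \<Longrightarrow> sZ s a < sZ s b"
  by (auto simp: sZ_def)

lemma bij_sZ [simp]: "bij (sZ i)"
  by (simp add: sZ_transpose)

abbreviation incr :: "int list \<Rightarrow> bool" where
  "incr \<equiv> sorted_wrt (<)"

section \<open>Words acting by conjugation\<close>

lemma perm_word_Nil [simp]: "perm_word [] = id"
  by (simp add: perm_word_def)

lemma fold_comp_sZ: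
  fixes q :: "int \<Rightarrow> int"
  shows "fold (\<lambda>i p. p \<circ> sZ i) w q = q \<circ> fold (\<lambda>i p. p \<circ> sZ i) w id"
proof (induction w arbitrary: q)
  case (Cons a w)
  show ?case using Cons.IH[of "q \<circ> sZ a"] Cons.IH[of "sZ a"] by (simp add: comp_assoc)
qed simp

lemma perm_word_append: "perm_word (u @ v) = perm_word u \<circ> perm_word v"
  by (simp add: perm_word_def) (rule fold_comp_sZ)

lemma perm_word_Cons [simp]: "perm_word (a # w) = sZ a \<circ> perm_word w"
  by (simp add: perm_word_def fold_comp_sZ[of _ "sZ a"])

lemma bij_perm_word [simp]: "bij (perm_word w)"
  by (induction w) (simp_all only: perm_word_Nil perm_word_Cons bij_id bij_comp bij_sZ)

lemma perm_word_append_apply: "perm_word (u @ v) k = perm_word u (perm_word v k)"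
  by (simp add: perm_word_append)

lemma perm_word_rev_apply [simp]: "perm_word w (perm_word (rev w) k) = k"
  by (induction w arbitrary: k) (simp_all add: perm_word_append_apply)

lemma perm_word_rev_apply' [simp]: "perm_word (rev w) (perm_word w k) = k"
  using perm_word_rev_apply[of "rev w"] by simp

lemma perm_word_rev: "perm_word w \<circ> perm_word (rev w) = id" "perm_word (rev w) \<circ> perm_word w = id"
  by (simp_all add: fun_eq_iff)

lemma inv_perm_word: "inv (perm_word w) = perm_word (rev w)"
  by (rule inv_unique_comp) (simp_all add: perm_word_rev)

lemma finite_support_perm_word: "finite {k. perm_word w k \<noteq> k}"
proof (induction w)
  case (Cons a w)
  have "{k. perm_word (a # w) k \<noteq> k} \<subseteq> {k. perm_word w k \<noteq> k} \<union> {a, a + 1}"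
    by (auto simp: sZ_def split: if_splits)
  then show ?case using Cons finite_subset by blast
qed simp

lemma perm_word_in_SZ: "perm_word w \<in> SZ"
  by (simp add: SZ_def finite_support_perm_word)

text \<open>Conjugation by the permutation of a word. \<open>perm_word (rev w)\<close> stands for
  the inverse, so that calculations avoid \<open>inv\<close>; \<open>conj_word\<close> is the case
  \<open>z = fpf1\<close>.\<close>

definition act :: "(int \<Rightarrow> int) \<Rightarrow> int list \<Rightarrow> int \<Rightarrow> int" where
  "act z w = perm_word (rev w) \<circ> z \<circ> perm_word w"

lemma act_Nil [simp]: "act z [] = z"
  by (simp add: act_def)

lemma act_append: "act z (u @ v) = act (act z u) v"
  by (simp add: act_def perm_word_append comp_assoc)

lemma act_single: "act z [s] = sZ s \<circ> z \<circ> sZ s"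
  by (simp add: act_def)

lemma conj_word_act: "conj_word w = act fpf1 w"
proof -
  have "fold (\<lambda>i p. sZ i \<circ> p \<circ> sZ i) w z = act z w" for z
  proof (induction w arbitrary: z)
    case (Cons a w)
    have "fold (\<lambda>i p. sZ i \<circ> p \<circ> sZ i) (a # w) z = act (act z [a]) w"
      unfolding fold_simps Cons.IH act_single ..
    also have "\<dots> = act z (a # w)" using act_append[of z "[a]" w] by simp
    finally show ?case .
  qed simp
  then show ?thesis by (simp add: conj_word_def)
qed

lemma conj_word_append: "conj_word (u @ v) = act (conj_word u) v"
  by (simp add: conj_word_act act_append)

lemma conj_word_snoc: "conj_word (u @ [s]) = sZ s \<circ> conj_word u \<circ> sZ s"
  by (simp add: conj_word_append act_single)

lemma conj_word_Nil [simp]: "conj_word [] = fpf1"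
  by (simp add: conj_word_act)

lemma act_rev_cancel: "act (act z v) (rev v) = z"
proof -
  have "act (act z v) (rev v) = (perm_word v \<circ> perm_word (rev v)) \<circ> z \<circ> (perm_word v \<circ> perm_word (rev v))"
    by (simp add: act_def comp_assoc)
  then show ?thesis by (simp add: perm_word_rev)
qed

lemma act_inject [simp]: "act z v = act z' v \<longleftrightarrow> z = z'"
  by (metis act_rev_cancel)

lemma act_cong_perm_word: "perm_word u = perm_word v \<Longrightarrow> act z u = act z v"
  by (simp only: act_def inv_perm_word[symmetric])

lemma conj_word_cong_perm_word: "perm_word u = perm_word v \<Longrightarrow> conj_word u = conj_word v"
  by (simp only: conj_word_act) (rule act_cong_perm_word)

lemma conj_word_block:
  assumes "perm_word T = perm_word T'"
  shows "conj_word (x @ T @ y) = conj_word (x @ T' @ y)"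
  by (rule conj_word_cong_perm_word) (simp only: perm_word_append assms)

lemma conj_word_perm_word: "conj_word w = inv (perm_word w) \<circ> fpf1 \<circ> perm_word w"
  by (simp add: conj_word_act act_def inv_perm_word)

lemma conj_word_in_IfpfZ: "conj_word w \<in> IfpfZ"
  unfolding IfpfZ_def using conj_word_perm_word perm_word_in_SZ by blast

lemma perm_word_commute: "a + 1 < c \<or> c + 1 < a \<Longrightarrow> perm_word [a, c] = perm_word [c, a]"
  by (auto simp: fun_eq_iff sZ_def)

lemma perm_word_braid: "perm_word [a, a + 1, a] = perm_word [a + 1, a, a + 1]"
  by (auto simp: fun_eq_iff sZ_def)

lemma perm_word_square: "perm_word [a, a] = perm_word []"
  by (simp add: fun_eq_iff)

section \<open>Fixed-point-free involutions and their conjugates by transpositions\<close>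

lemma fpf1_invol [simp]: "fpf1 (fpf1 k) = k"
  by (auto simp: fpf1_def)

lemma fpf1_neq [simp]: "fpf1 k \<noteq> k"
  by (auto simp: fpf1_def)

definition fpf_inv :: "(int \<Rightarrow> int) \<Rightarrow> bool" where
  "fpf_inv z \<longleftrightarrow> (\<forall>k. z (z k) = k \<and> z k \<noteq> k)"

lemma fpf_inv_conj: "fpf_inv z \<Longrightarrow> fpf_inv (sZ s \<circ> z \<circ> sZ s)"
  by (simp add: fpf_inv_def) (metis sZ_sZ)

lemma fpf_inv_conj_word: "fpf_inv (conj_word w)"
proof (induction w rule: rev_induct)
  case Nil
  then show ?case by (simp add: fpf_inv_def)
next
  case (snoc s w)
  then show ?case unfolding conj_word_snoc by (rule fpf_inv_conj)
qed

lemma conj_word_invol [simp]: "conj_word w (conj_word w k) = k"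
  and conj_word_neq [simp]: "conj_word w k \<noteq> k"
  using fpf_inv_conj_word[of w] by (auto simp: fpf_inv_def)

lemma conj_word_eq_iff [simp]: "conj_word w a = conj_word w b \<longleftrightarrow> a = b"
  by (metis conj_word_invol)

definition tconj :: "int \<Rightarrow> int \<Rightarrow> (int \<Rightarrow> int) \<Rightarrow> int \<Rightarrow> int" where
  "tconj a b z = transpose a b \<circ> z \<circ> transpose a b"

lemma tconj_sZ: "tconj s (s + 1) z = sZ s \<circ> z \<circ> sZ s"
  by (simp add: tconj_def sZ_transpose)

lemma tconj_commute: "tconj a b z = tconj b a z"
  by (simp add: tconj_def transpose_commute)

lemma tconj_tconj [simp]: "tconj a b (tconj a b z) = z"
  by (simp add: tconj_def fun_eq_iff)

text \<open>Exchanging \<open>a\<close> with \<open>b\<close>, or their partners with each other,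
  turns the cycles \<open>(a, z a)\<close> and \<open>(b, z b)\<close> into the same cycles
  \<open>(a, z b)\<close> and \<open>(b, z a)\<close>. In exchange arguments the pair of values is
  therefore as good as the pair of arguments.\<close>

lemma tconj_eq_partner:
  assumes "fpf_inv z" "z a \<noteq> b"
  shows "tconj a b z = tconj (z a) (z b) z"
proof
  fix k
  have z: "z (z k) = k" "z k \<noteq> k" for k using assms(1) by (auto simp: fpf_inv_def)
  have zb: "z b \<noteq> a" using assms(2) z by metis
  show "tconj a b z k = tconj (z a) (z b) z k"
  proof -
    consider "k = a" | "k = b" | "k = z a" | "k = z b" | "k \<notin> {a, b, z a, z b}" by blast
    then show ?thesis
    proof cases
      case 5
      then have "z k \<notin> {a, b, z a, z b}" using z by (metis insert_iff empty_iff)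
      then show ?thesis using 5 by (simp add: tconj_def transpose_def)
    qed (use z(2)[of a] z(2)[of b] z(2)[of a, symmetric] z(2)[of b, symmetric] assms(2) assms(2)[symmetric] zb zb[symmetric] in
          \<open>simp_all add: tconj_def transpose_def z(1)\<close>)
  qed
qed

lemma tconj_apply:
  assumes "fpf_inv z" "z a \<noteq> b"
  shows "tconj a b z a = z b" "tconj a b z b = z a"
proof -
  have z: "z (z k) = k" "z k \<noteq> k" for k using assms(1) by (auto simp: fpf_inv_def)
  have "z b \<noteq> a" using assms(2) z by metis
  then show "tconj a b z a = z b" "tconj a b z b = z a"
    using z assms(2) by (auto simp: tconj_def transpose_def)
qed

lemma tconj_conj_sZ:
  "sZ s \<circ> tconj a b z \<circ> sZ s = tconj (sZ s a) (sZ s b) (sZ s \<circ> z \<circ> sZ s)"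
proof -
  have t: "transpose (sZ s a) (sZ s b) = sZ s \<circ> transpose a b \<circ> sZ s"
    by (auto simp: fun_eq_iff transpose_def)
  show ?thesis unfolding tconj_def t by (simp add: fun_eq_iff)
qed

section \<open>Deletion of letters and the strong exchange property\<close>

lemma del_at_simps [simp]:
  "del_at 0 (a # w) = w" "del_at (Suc n) (a # w) = a # del_at n w"
  by (simp_all add: del_at_def)

lemma del_at_append [simp]: "del_at (length x + n) (x @ y) = x @ del_at n y"
  by (simp add: del_at_def)

lemma del_at_append_length [simp]: "del_at (length x) (x @ y) = x @ del_at 0 y"
  using del_at_append[of x 0 y] by simp

lemma del_at_append_left: "n < length x \<Longrightarrow> del_at n (x @ y) = del_at n x @ y"
  by (simp add: del_at_def)

lemma length_del_at [simp]: "n < length w \<Longrightarrow> length (del_at n w) = length w - 1"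
  by (simp add: del_at_def)

text \<open>Strip off the last letter \<open>r\<close>. Conjugation by \<open>sZ r\<close> keeps the
  inequality between the arguments and the one between the values, unless one of these pairs is
  \<open>r, r + 1\<close>. In those two cases conjugation by \<open>transpose a b\<close> cancels
  \<open>r\<close>, so \<open>r\<close> is the letter to delete. The base case is vacuous, since
  every inversion of \<open>fpf1\<close> is one of its cycles.\<close>

lemma strong_exchange:
  assumes "a < b" "conj_word u a > conj_word u b" "conj_word u a \<noteq> b"
  shows "\<exists>j<length u. conj_word (del_at j u) = tconj a b (conj_word u)"
  using assms
proof (induction u arbitrary: a b rule: rev_induct)
  case Nil
  then show ?case by (auto simp: fpf1_def split: if_splits)
next
  case (snoc r u)
  let ?y = "conj_word (u @ [r])"
  have y: "?y = sZ r \<circ> conj_word u \<circ> sZ r" by (rule conj_word_snoc)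
  have y': "conj_word u = sZ r \<circ> ?y \<circ> sZ r" by (simp add: y fun_eq_iff)
  have last: "conj_word (del_at (length u) (u @ [r])) = conj_word u" by simp
  show ?case
  proof (cases "a = r \<and> b = r + 1")
    case True
    then have "tconj a b ?y = conj_word u" using y' tconj_sZ by simp
    then show ?thesis using last by (metis length_append_singleton lessI)
  next
    case False
    then have ab: "sZ r a < sZ r b" using snoc.prems(1) sZ_less by blast
    have val: "conj_word u (sZ r a) = sZ r (?y a)" "conj_word u (sZ r b) = sZ r (?y b)"
      by (simp_all add: y)
    show ?thesis
    proof (cases "?y b = r \<and> ?y a = r + 1")
      case True
      have "tconj a b ?y = tconj (?y a) (?y b) ?y"
        using tconj_eq_partner fpf_inv_conj_word snoc.prems(3) by blast
      also have "\<dots> = conj_word u" using True y' tconj_sZ tconj_commute by metis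
      finally show ?thesis using last by (metis length_append_singleton lessI)
    next
      case F2: False
      have "conj_word u (sZ r b) < conj_word u (sZ r a)"
        unfolding val using F2 snoc.prems(2) sZ_less by blast
      moreover have "conj_word u (sZ r a) \<noteq> sZ r b" unfolding val using snoc.prems(3) by simp
      ultimately obtain j where j: "j < length u"
        "conj_word (del_at j u) = tconj (sZ r a) (sZ r b) (conj_word u)"
        using snoc.IH[OF ab] by blast
      have "conj_word (del_at j (u @ [r])) = sZ r \<circ> conj_word (del_at j u) \<circ> sZ r"
        using j(1) by (simp add: del_at_append_left conj_word_snoc)
      also have "\<dots> = tconj (sZ r (sZ r a)) (sZ r (sZ r b)) (sZ r \<circ> conj_word u \<circ> sZ r)"
        unfolding j(2) by (rule tconj_conj_sZ)
      also have "\<dots> = tconj a b ?y" by (simp add: y)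
      finally show ?thesis using j(1) by (metis length_append_singleton less_SucI)
    qed
  qed
qed

text \<open>The deleted letter is carried past the letters behind it, each of which conjugates its
  transposition into another one.\<close>

lemma deletion_reflection:
  assumes "i < length u"
  shows "\<exists>a b. a < b \<and> conj_word u = tconj a b (conj_word (del_at i u))"
  using assms
proof (induction u rule: rev_induct)
  case (snoc r u)
  show ?case
  proof (cases "i = length u")
    case True
    then have "conj_word (u @ [r]) = tconj r (r + 1) (conj_word (del_at i (u @ [r])))"
      by (simp add: tconj_sZ conj_word_snoc)
    then show ?thesis by (intro exI[of _ r] exI[of _ "r + 1"]) simp
  next
    case False
    then have i: "i < length u" using snoc.prems by simp
    then obtain a b where ab: "a < b" "conj_word u = tconj a b (conj_word (del_at i u))"
      using snoc.IH by blast
    have "conj_word (u @ [r]) = tconj (sZ r a) (sZ r b) (sZ r \<circ> conj_word (del_at i u) \<circ> sZ r)"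
      unfolding conj_word_snoc ab(2) by (rule tconj_conj_sZ)
    also have "sZ r \<circ> conj_word (del_at i u) \<circ> sZ r = conj_word (del_at i (u @ [r]))"
      using i by (simp add: del_at_append_left conj_word_snoc)
    finally have *: "conj_word (u @ [r]) = tconj (sZ r a) (sZ r b) (conj_word (del_at i (u @ [r])))" .
    have "sZ r a \<noteq> sZ r b" using ab(1) by simp
    then show ?thesis using * tconj_commute by (metis linorder_neqE)
  qed
qed simp

section \<open>Reduced words\<close>

lemma RSp_iff: "w \<in> RSp \<pi> \<longleftrightarrow> conj_word w = \<pi> \<and> fpf_reduced w"
  by (auto simp: RSp_def fpf_reduced_def)

lemma fpf_reduced_min: "fpf_reduced w \<Longrightarrow> conj_word v = conj_word w \<Longrightarrow> length w \<le> length v"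
  by (auto simp: RSp_def fpf_reduced_def)

lemma fpf_reduced_cong:
  "fpf_reduced w \<Longrightarrow> conj_word v = conj_word w \<Longrightarrow> length v \<le> length w \<Longrightarrow> fpf_reduced v"
  by (auto simp: RSp_def fpf_reduced_def intro: order_trans)

lemma ex_fpf_reduced: "\<exists>v. conj_word v = conj_word w \<and> fpf_reduced v \<and> length v \<le> length w"
proof -
  obtain v where v: "conj_word v = conj_word w" "\<forall>u. conj_word u = conj_word w \<longrightarrow> length v \<le> length u"
    using ex_has_least_nat[of "\<lambda>v. conj_word v = conj_word w" w length] by blast
  then have "fpf_reduced v" by (simp add: fpf_reduced_def RSp_def)
  then show ?thesis using v by auto
qed

lemma fpf_reduced_appendD: 
  assumes "fpf_reduced (u @ v)" shows "fpf_reduced u"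
proof -
  obtain u' where u': "conj_word u' = conj_word u" "fpf_reduced u'" "length u' \<le> length u"
    using ex_fpf_reduced by blast
  have "conj_word (u' @ v) = conj_word (u @ v)" by (simp add: conj_word_append u'(1))
  then have "length u \<le> length u'" using fpf_reduced_min[OF assms] by fastforce
  then show ?thesis using u' fpf_reduced_cong by metis
qed

lemma sZ_conj_values:
  assumes "fpf_inv z" "z s \<noteq> s + 1"
  shows "(sZ s \<circ> z \<circ> sZ s) s = z (s + 1)" "(sZ s \<circ> z \<circ> sZ s) (s + 1) = z s"
  using tconj_apply[OF assms] by (simp_all add: tconj_sZ)

lemma sZ_conj_fixed:
  assumes "fpf_inv z" "z s = s + 1" shows "sZ s \<circ> z \<circ> sZ s = z"
proof
  fix k
  have z: "z (z k) = k" "z k \<noteq> k" for k using assms(1) by (auto simp: fpf_inv_def)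
  show "(sZ s \<circ> z \<circ> sZ s) k = z k"
    using z(1)[of k] z(1)[of s] assms(2) unfolding sZ_def comp_def by (cases "k = s"; cases "k = s + 1"; cases "z k = s"; cases "z k = s + 1"; auto)
qed

lemma exchange_descent:
  assumes "conj_word u s > conj_word u (s + 1)" "conj_word u s \<noteq> s + 1"
  shows "\<exists>j<length u. conj_word (del_at j u) = conj_word (u @ [s])"
  using strong_exchange[of s "s + 1" u] assms by (simp add: tconj_sZ conj_word_snoc)

text \<open>At a descent \<open>s\<close> either \<open>s, s + 1\<close> is a cycle and conjugation
  does nothing, or exchange shortens the word. At an ascent every reduced word of the new involution
  has a descent at \<open>s\<close>, and exchange turns it into a shorter word of the old
  involution.\<close>

lemma fpf_reduced_snoc:
  "fpf_reduced (w @ [s]) \<longleftrightarrow> fpf_reduced w \<and> conj_word w s < conj_word w (s + 1)"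
proof
  assume red: "fpf_reduced (w @ [s])"
  have "conj_word w s \<noteq> s + 1"
  proof
    assume "conj_word w s = s + 1"
    then have "conj_word w = conj_word (w @ [s])"
      using sZ_conj_fixed[OF fpf_inv_conj_word] by (simp add: conj_word_snoc)
    then show False using fpf_reduced_min[OF red] by fastforce
  qed
  moreover have "\<not> conj_word w s > conj_word w (s + 1)"
  proof
    assume "conj_word w s > conj_word w (s + 1)"
    then obtain j where "j < length w" "conj_word (del_at j w) = conj_word (w @ [s])"
      using exchange_descent calculation by blast
    then show False using fpf_reduced_min[OF red] by fastforce
  qed
  moreover have "conj_word w s \<noteq> conj_word w (s + 1)" by simp
  ultimately show "fpf_reduced w \<and> conj_word w s < conj_word w (s + 1)"
    using fpf_reduced_appendD[OF red] by linarith
next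
  assume asm: "fpf_reduced w \<and> conj_word w s < conj_word w (s + 1)"
  let ?z = "conj_word (w @ [s])"
  have ne: "conj_word w s \<noteq> s + 1" using asm conj_word_invol by (metis less_add_one order.asym)
  have zs: "?z s = conj_word w (s + 1)" "?z (s + 1) = conj_word w s"
    using sZ_conj_values[OF fpf_inv_conj_word ne] by (simp_all add: conj_word_snoc)
  obtain v where v: "conj_word v = ?z" "fpf_reduced v" "length v \<le> length (w @ [s])"
    using ex_fpf_reduced by blast
  have "conj_word v s \<noteq> s + 1" using v zs conj_word_neq by metis
  then obtain j where j: "j < length v" "conj_word (del_at j v) = conj_word (v @ [s])"
    using exchange_descent[of v s] asm v zs by auto
  have "conj_word (v @ [s]) = conj_word w"
    unfolding conj_word_snoc v(1) by (simp add: fun_eq_iff)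
  then have "length w \<le> length v - 1" using fpf_reduced_min[of w "del_at j v"] asm j by simp
  then have "length (w @ [s]) \<le> length v" using j(1) by simp
  then show "fpf_reduced (w @ [s])" using v fpf_reduced_cong by metis
qed

lemma fpf_reduced_Nil [simp]: "fpf_reduced []"
  by (simp add: fpf_reduced_def RSp_def)

lemma fpf_reduced_hd_even: "fpf_reduced (a # w) \<Longrightarrow> even a"
  using fpf_reduced_appendD[of "[a]" w] fpf_reduced_snoc[of "[]" a]
  by (auto simp: fpf1_def split: if_splits)

text \<open>A lifting property as in Bruhat order. \<open>u\<close> arises from
  \<open>del_at i u\<close> by conjugation with some \<open>transpose a b\<close>, which creates an
  inversion. If this is the conjugation by \<open>sZ s\<close>, in arguments or in values, the claim
  holds. Otherwise \<open>sZ s\<close> keeps both inequalities, and exchange produces a word of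
  \<open>conj_word (del_at i u @ [s])\<close> that is too short.\<close>

lemma lifting:
  assumes u: "fpf_reduced u" and i: "i < length u"
    and asc: "fpf_reduced (del_at i u @ [s])" and non: "\<not> fpf_reduced (u @ [s])"
  shows "conj_word u = conj_word (del_at i u @ [s])"
proof -
  let ?d = "del_at i u" 
  let ?y = "conj_word ?d" and ?z = "conj_word u" and ?y' = "conj_word (?d @ [s])"
  have len: "length ?d = length u - 1" using i by simp
  obtain a b where ab: "a < b" and z: "?z = tconj a b ?y" using deletion_reflection[OF i] by blast
  have "?z \<noteq> ?y" using fpf_reduced_min[OF u, of ?d] len i by fastforce
  then have yab: "?y a \<noteq> b"
  proof -
    { assume e: "?y a = b"
      then have e': "?y b = a" by (metis conj_word_invol)
      have "tconj a b ?y k = ?y k" for k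
        using e e' conj_word_invol[of ?d k] unfolding tconj_def transpose_def comp_def
        by (cases "k = a"; cases "k = b"; cases "?y k = a"; cases "?y k = b"; auto)
      then have "?z = ?y" using z by auto }
    then show ?thesis using \<open>?z \<noteq> ?y\<close> by blast
  qed
  have "\<not> ?y a > ?y b"
  proof
    assume "?y a > ?y b"
    then obtain j where "j < length ?d" "conj_word (del_at j ?d) = ?z"
      using strong_exchange[OF ab _ yab] z by auto
    then show False using fpf_reduced_min[OF u, of "del_at j ?d"] len i by fastforce
  qed
  then have yless: "?y a < ?y b" using ab by (simp add: linorder_not_less order_le_less)
  show ?thesis
  proof (cases "a = s \<and> b = s + 1")
    case True
    then show ?thesis using z by (simp add: tconj_sZ conj_word_snoc)
  next
    case F1: False
    show ?thesis
    proof (cases "?y a = s \<and> ?y b = s + 1")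
      case True
      have "?z = tconj (?y a) (?y b) ?y" using z tconj_eq_partner[OF fpf_inv_conj_word yab] by simp
      then show ?thesis using True by (simp add: tconj_sZ conj_word_snoc)
    next
      case F2: False
      let ?a = "sZ s a" and ?b = "sZ s b"
      have ab': "?a < ?b" using ab F1 sZ_less by blast
      have vals: "?y' ?a = sZ s (?y a)" "?y' ?b = sZ s (?y b)" by (simp_all add: conj_word_snoc)
      have y'less: "?y' ?a < ?y' ?b" unfolding vals using yless F2 sZ_less by blast
      have y'ne: "?y' ?a \<noteq> ?b" unfolding vals using yab by simp
      have z': "conj_word (u @ [s]) = tconj ?a ?b ?y'"
        unfolding conj_word_snoc z by (rule tconj_conj_sZ)
      \<comment> \<open>As \<open>u @ [s]\<close> is not reduced, its involution has a word with at
        most \<open>length u\<close> letters: \<open>u\<close> itself if \<open>s, s + 1\<close> is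
        a cycle, and \<open>u\<close> with one letter deleted otherwise.\<close>
      obtain v where v: "conj_word v = conj_word (u @ [s])" "length v \<le> length u"
      proof (cases "?z s = s + 1")
        case True
        then have "conj_word (u @ [s]) = ?z"
          using sZ_conj_fixed[OF fpf_inv_conj_word] by (simp add: conj_word_snoc)
        then show ?thesis using that by auto
      next
        case False
        have "?z s \<noteq> ?z (s + 1)" by simp
        then have "?z s > ?z (s + 1)" using non u fpf_reduced_snoc by (meson linorder_neqE)
        then obtain j where "j < length u" "conj_word (del_at j u) = conj_word (u @ [s])"
          using exchange_descent False by blast
        then show ?thesis using that by (metis length_del_at diff_le_self)
      qed
      have v': "conj_word v ?a = ?y' ?b" "conj_word v ?b = ?y' ?a"
        using tconj_apply[OF fpf_inv_conj_word y'ne] v(1) z' by auto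
      have "conj_word v ?a \<noteq> ?b" using v' conj_word_neq by metis
      then obtain j where j: "j < length v" "conj_word (del_at j v) = tconj ?a ?b (conj_word v)"
        using strong_exchange[OF ab'] v' y'less by metis
      then have "conj_word (del_at j v) = ?y'" using v(1) z' by simp
      then show ?thesis using fpf_reduced_min[OF asc, of "del_at j v"] j(1) v(2) len i by simp
    qed
  qed
qed

section \<open>Marked words\<close>

text \<open>Only the consequence matters that words with the same permutation have lengths of the
  same parity.\<close>

lemma evenperm_perm_word: "permutation (perm_word w) \<and> (evenperm (perm_word w) \<longleftrightarrow> even (length w))"
proof (induction w)
  case Nil
  show ?case unfolding perm_word_Nil by simp
next
  case (Cons a w)
  have s: "permutation (sZ a)" "\<not> evenperm (sZ a)"
    by (simp_all add: sZ_transpose permutation_swap_id evenperm_swap)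
  have "permutation (sZ a \<circ> perm_word w)" "evenperm (sZ a \<circ> perm_word w) \<longleftrightarrow> odd (length w)"
    using s Cons permutation_compose[of "sZ a" "perm_word w"] evenperm_comp[of "sZ a" "perm_word w"] by blast+
  then show ?case by (metis perm_word_Cons length_Cons even_Suc)
qed

lemma marked_iff: "marked \<pi> w i \<longleftrightarrow> i < length w \<and> conj_word (del_at i w) = \<pi> \<and> fpf_reduced (del_at i w)"
  by (auto simp: marked_def RSp_iff)

lemma marked_transfer:
  assumes "marked \<pi> w i" "j < length w'" "length w' = length w" "conj_word (del_at j w') = conj_word (del_at i w)"
  shows "marked \<pi> w' j"
  using assms fpf_reduced_cong[of "del_at i w" "del_at j w'"] by (auto simp: marked_iff)

text \<open>For marked words semi-reducedness collapses to an equation: a word with the permutation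
  of \<open>w\<close> represents \<open>\<pi>\<close> as well, hence has at least
  \<open>length w - 1\<close> letters, and parity excludes exactly this number.\<close>

lemma marked_semi_reduced_iff:
  assumes "marked \<pi> w i"
  shows "semi_reduced \<pi> w \<longleftrightarrow> conj_word w = \<pi>"
proof
  assume "semi_reduced \<pi> w"
  then show "conj_word w = \<pi>"
    by (auto simp: semi_reduced_def reduced_word_for_def conj_word_perm_word)
next
  assume c: "conj_word w = \<pi>"
  have i: "i < length w" "conj_word (del_at i w) = \<pi>" "fpf_reduced (del_at i w)"
    using assms by (auto simp: marked_iff)
  have "\<not> fpf_reduced w"
    using fpf_reduced_min[of w "del_at i w"] i c by auto
  moreover have "reduced_word_for w (perm_word w)"
    unfolding reduced_word_for_def
  proof (intro conjI refl allI impI)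
    fix v assume v: "perm_word v = perm_word w"
    then have "conj_word v = \<pi>" using c conj_word_cong_perm_word by metis
    then have "length w - 1 \<le> length v" using fpf_reduced_min[OF i(3), of v] i by simp
    moreover have "even (length v) \<longleftrightarrow> even (length w)" using evenperm_perm_word v by metis
    ultimately show "length w \<le> length v" using i(1) by presburger
  qed
  ultimately show "semi_reduced \<pi> w"
    unfolding semi_reduced_def using perm_word_in_SZ[of w] conj_word_perm_word[of w] c by metis
qed

lemma split_two:
  assumes "i < j" "j < length w"
  obtains x a u b v where "w = x @ a # u @ b # v" "i = length x" "j = Suc (length x + length u)"
proof
  show "w = take i w @ w ! i # take (j - Suc i) (drop (Suc i) w) @ w ! j # drop (Suc j) w"
  proof -
    have "drop (Suc i) w = take (j - Suc i) (drop (Suc i) w) @ drop j w"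
      using assms by (metis add_diff_inverse_nat append_take_drop_id drop_drop less_Suc_eq_le not_less_eq add.commute)
    then show ?thesis using assms
      by (metis Cons_nth_drop_Suc dual_order.strict_trans id_take_nth_drop)
  qed
qed (use assms in auto)

text \<open>Both deletions give the same involution, so inserting \<open>a\<close> in front of
  \<open>u\<close> acts like appending \<open>b\<close> behind it, and the two together
  cancel.\<close>

lemma two_marks:
  assumes "marked \<pi> (x @ a # u @ b # v) (length x)"
    and "marked \<pi> (x @ a # u @ b # v) (Suc (length x + length u))"
  shows "conj_word (x @ a # u @ [b]) = conj_word (x @ u)"
proof -
  have d1: "del_at (length x) (x @ a # u @ b # v) = (x @ u @ [b]) @ v" by simp
  have d2: "del_at (Suc (length x + length u)) (x @ a # u @ b # v) = (x @ a # u) @ v"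
    using del_at_append[of "x @ a # u" 0 "b # v"] by simp
  have "conj_word ((x @ u @ [b]) @ v) = conj_word ((x @ a # u) @ v)"
    using assms d1 d2 by (simp add: marked_iff)
  then have e: "conj_word ((x @ u) @ [b]) = conj_word (x @ a # u)"
    unfolding conj_word_append[of "x @ u @ [b]" v] conj_word_append[of "x @ a # u" v] by simp
  have "conj_word ((x @ a # u) @ [b]) = sZ b \<circ> conj_word ((x @ u) @ [b]) \<circ> sZ b"
    by (simp only: conj_word_snoc[of "x @ a # u"] e)
  also have "\<dots> = conj_word (x @ u)" by (simp add: conj_word_snoc fun_eq_iff del: append_assoc)
  finally show ?thesis by simp
qed

text \<open>Both marked letters can be deleted together without changing \<open>conj_word w\<close>.
  This removes two letters, whereas the minimal length for \<open>\<pi>\<close> is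
  \<open>length w - 1\<close>.\<close>

lemma two_marks_not_reduced:
  assumes "marked \<pi> w i" "marked \<pi> w j" "i \<noteq> j"
  shows "\<not> fpf_reduced w" "conj_word w \<noteq> \<pi>"
proof -
  have "\<not> fpf_reduced w \<and> conj_word w \<noteq> \<pi>" if "i < j" "marked \<pi> w i" "marked \<pi> w j" for i j
  proof -
    have "j < length w" using that by (simp add: marked_iff)
    then obtain x a u b v where w: "w = x @ a # u @ b # v" "i = length x" "j = Suc (length x + length u)"
      using split_two \<open>i < j\<close> by blast
    have e: "conj_word (x @ a # u @ [b]) = conj_word (x @ u)" using two_marks that w by blast
    have c: "conj_word w = conj_word (x @ u @ v)"
      using conj_word_append[of "x @ a # u @ [b]" v] conj_word_append[of "x @ u" v] e w(1) by simp
    then have "\<not> fpf_reduced w" using fpf_reduced_min[of w "x @ u @ v"] w by auto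
    moreover have "conj_word w \<noteq> \<pi>"
    proof
      assume "conj_word w = \<pi>"
      then have "length (del_at i w) \<le> length (x @ u @ v)"
        using fpf_reduced_min[of "del_at i w" "x @ u @ v"] that(2) c by (auto simp: marked_iff)
      then show False using w by simp
    qed
    ultimately show ?thesis by simp
  qed
  then show "\<not> fpf_reduced w" "conj_word w \<noteq> \<pi>" using assms by (metis linorder_neqE_nat)+
qed

text \<open>Deleting the last of three marked letters keeps the part up to the second one as a
  prefix of a reduced word, but in that part the first two marked letters cancel.\<close>

lemma not_three_marks:
  assumes "marked \<pi> w i" "marked \<pi> w j" "marked \<pi> w k" "i < j" "j < k"
  shows False
proof -
  have "j < length w" using assms by (simp add: marked_iff)
  then obtain x a u b v where w: "w = x @ a # u @ b # v" "i = length x" "j = Suc (length x + length u)"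
    using split_two \<open>i < j\<close> by blast
  have e: "conj_word (x @ a # u @ [b]) = conj_word (x @ u)" using two_marks assms w by blast
  define n where "n = k - Suc j"
  have k: "k = length (x @ a # u @ [b]) + n" using w assms(5) by (simp add: n_def)
  have "del_at k w = (x @ a # u @ [b]) @ del_at n v"
    unfolding k w(1) using del_at_append[of "x @ a # u @ [b]" n v] by simp
  then have "fpf_reduced (x @ a # u @ [b])"
    using assms(3) fpf_reduced_appendD by (metis marked_iff)
  then show False using fpf_reduced_min[of "x @ a # u @ [b]" "x @ u"] e by simp
qed

lemma unique_other_mark:
  assumes "marked \<pi> w i" "marked \<pi> w j" "marked \<pi> w k" "j \<noteq> i" "k \<noteq> i"
  shows "j = k"
proof (rule ccontr)
  assume "j \<noteq> k"
  then consider "i < j" "j < k" | "i < k" "k < j" | "j < i" "i < k" | "k < i" "i < j" | "j < k" "k < i" | "k < j" "j < i"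
    using assms(4,5) by linarith
  then show False by cases (use assms(1-3) not_three_marks in blast)+
qed

text \<open>Let \<open>p\<close> be the last position of the shortest prefix that is not reduced. It
  cannot lie before \<open>i\<close>, because deleting \<open>i\<close> leaves a reduced word. If it
  lies behind \<open>i\<close>, the lifting property shows that \<open>p\<close> is marked. If it
  equals \<open>i\<close>, the exchange property yields an earlier mark.\<close>

lemma ex_other_mark:
  assumes m: "marked \<pi> w i" and nr: "\<not> fpf_reduced w" and ne: "conj_word w \<noteq> \<pi>"
  shows "\<exists>j. j \<noteq> i \<and> marked \<pi> w j"
proof -
  have i: "i < length w" and ci: "conj_word (del_at i w) = \<pi>" and ri: "fpf_reduced (del_at i w)"
    using m by (auto simp: marked_iff)
  define p where "p = (LEAST n. \<not> fpf_reduced (take (Suc n) w))"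
  have ex: "\<not> fpf_reduced (take (Suc (length w - 1)) w)" using nr i by simp
  have p: "\<not> fpf_reduced (take (Suc p) w)" unfolding p_def by (rule LeastI, rule ex)
  have "p \<le> length w - 1" unfolding p_def by (rule Least_le, rule ex)
  then have pl: "p < length w" using i by linarith
  have rp: "fpf_reduced (take p w)"
  proof (cases p)
    case (Suc q)
    then have "q < p" by simp
    then show ?thesis using not_less_Least[of q] unfolding p_def Suc by (metis Suc p_def)
  qed simp
  have tp: "take (Suc p) w = take p w @ [w ! p]" using pl by (rule take_Suc_conv_app_nth)
  have wp: "w = take p w @ w ! p # drop (Suc p) w" using pl by (rule id_take_nth_drop)
  consider "p < i" | "p = i" | "i < p" by linarith
  then show ?thesis
  proof cases
    case 1
    have "take (Suc p) (del_at i w) = take (Suc p) w"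
      using 1 i by (simp add: del_at_def min_def)
    then have "fpf_reduced (take (Suc p) w)"
      using ri fpf_reduced_appendD[of "take (Suc p) (del_at i w)" "drop (Suc p) (del_at i w)"] by (metis append_take_drop_id)
    then show ?thesis using p by simp
  next
    case 2
    let ?u = "take i w" and ?s = "w ! i" and ?v = "drop (Suc i) w"
    have "conj_word ?u ?s \<noteq> ?s + 1"
    proof
      assume "conj_word ?u ?s = ?s + 1"
      then have "conj_word (?u @ [?s]) = conj_word ?u"
        using sZ_conj_fixed[OF fpf_inv_conj_word] by (simp add: conj_word_snoc)
      then have "conj_word ((?u @ [?s]) @ ?v) = conj_word (?u @ ?v)" by (simp only: conj_word_append)
      then show False using ne ci wp 2 by (simp add: del_at_def)
    qed
    moreover have "\<not> conj_word ?u ?s < conj_word ?u (?s + 1)"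
      using p rp tp 2 fpf_reduced_snoc by auto
    moreover have "conj_word ?u ?s \<noteq> conj_word ?u (?s + 1)" by simp
    ultimately obtain j where j: "j < length ?u" "conj_word (del_at j ?u) = conj_word (?u @ [?s])"
      using exchange_descent[of ?u ?s] by (meson linorder_neqE)
    have "conj_word (del_at j ?u @ [?s]) = conj_word ?u"
      unfolding conj_word_snoc j(2) by (simp add: fun_eq_iff)
    then have "conj_word ((del_at j ?u @ [?s]) @ ?v) = conj_word (?u @ ?v)" by (simp only: conj_word_append)
    moreover have "del_at j w = (del_at j ?u @ [?s]) @ ?v"
      using wp 2 del_at_append_left[OF j(1), of "?s # ?v"] by simp
    ultimately have "conj_word (del_at j w) = conj_word (del_at i w)" by (simp add: del_at_def)
    moreover have "j < i" using j(1) i by simp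
    ultimately show ?thesis using marked_transfer[OF m, of j w] i by auto
  next
    case 3
    let ?u = "take p w" and ?s = "w ! p" and ?v = "drop (Suc p) w"
    have iu: "i < length ?u" using 3 pl by simp
    have di: "del_at i w = (del_at i ?u @ [?s]) @ ?v"
      using wp del_at_append_left[OF iu, of "?s # ?v"] by simp
    have "fpf_reduced (del_at i ?u @ [?s])" using ri di fpf_reduced_appendD by metis
    then have "conj_word ?u = conj_word (del_at i ?u @ [?s])"
      using lifting[OF rp iu] p tp by simp
    then have "conj_word (?u @ ?v) = conj_word (del_at i w)" by (simp only: di conj_word_append)
    then have "conj_word (del_at p w) = conj_word (del_at i w)" by (simp add: del_at_def)
    then show ?thesis using marked_transfer[OF m, of p w] pl 3 by auto
  qed
qed

section \<open>The push map\<close>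

text \<open>The mark that \<open>fpush\<close> selects, with semi-reducedness replaced by the
  equation \<open>conj_word w = \<pi>\<close>. The relation is symmetric and single-valued, so
  \<open>fpush\<close> is an involution on marks followed by an invertible change of one
  letter.\<close>

definition flip :: "(int \<Rightarrow> int) \<Rightarrow> int list \<Rightarrow> nat \<Rightarrow> nat \<Rightarrow> bool" where
  "flip \<pi> w i j \<longleftrightarrow> marked \<pi> w i \<and> marked \<pi> w j \<and> (i = j \<longleftrightarrow> fpf_reduced w \<or> conj_word w = \<pi>)"

lemma flip_sym: "flip \<pi> w i j \<Longrightarrow> flip \<pi> w j i"
  by (auto simp: flip_def)

lemma flip_unique: "flip \<pi> w i j \<Longrightarrow> flip \<pi> w i k \<Longrightarrow> j = k"
  using unique_other_mark unfolding flip_def by metis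

lemma ex_flip: "marked \<pi> w i \<Longrightarrow> \<exists>j. flip \<pi> w i j"
  using ex_other_mark unfolding flip_def by metis

lemma flip_two_marks: "marked \<pi> w i \<Longrightarrow> marked \<pi> w j \<Longrightarrow> i \<noteq> j \<Longrightarrow> flip \<pi> w i j"
  using two_marks_not_reduced by (simp add: flip_def)

definition push :: "int list \<Rightarrow> nat \<Rightarrow> int list \<times> nat" where
  "push w j = (w[j := w ! j + 1], j)"

lemma fpush_flip: "flip \<pi> w i j \<Longrightarrow> fpush \<pi> (w, i) = push w j"
proof -
  assume f: "flip \<pi> w i j"
  then have semi: "semi_reduced \<pi> w \<longleftrightarrow> conj_word w = \<pi>"
    using marked_semi_reduced_iff flip_def by blast
  show ?thesis
  proof (cases "fpf_reduced w \<or> conj_word w = \<pi>")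
    case True
    then show ?thesis using f semi by (simp add: fpush_def push_def flip_def)
  next
    case False
    then have "(THE j. j \<noteq> i \<and> marked \<pi> w j) = j"
      using f unique_other_mark unfolding flip_def by (intro the_equality) metis+
    then show ?thesis using False semi by (simp add: fpush_def push_def)
  qed
qed

lemma del_at_update [simp]: "del_at j (w[j := c]) = del_at j w"
  by (simp add: del_at_def)

lemma marked_update [simp]: "marked \<pi> (w[j := c]) j \<longleftrightarrow> marked \<pi> w j"
  by (simp add: marked_iff)

definition states :: "(int \<Rightarrow> int) \<Rightarrow> (int list \<times> nat) set" where
  "states \<pi> = {(w, i). marked \<pi> w i}"

lemma fpush_cases:
  assumes "(w, i) \<in> states \<pi>"
  obtains j where "flip \<pi> w i j" "fpush \<pi> (w, i) = push w j" "push w j \<in> states \<pi>"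
proof -
  obtain j where j: "flip \<pi> w i j" using assms ex_flip[of \<pi> w i] by (auto simp: states_def)
  moreover have "push w j \<in> states \<pi>" using j by (auto simp: states_def push_def flip_def)
  ultimately show ?thesis using that fpush_flip by blast
qed

lemma fpush_states: "s \<in> states \<pi> \<Longrightarrow> fpush \<pi> s \<in> states \<pi>"
  by (metis fpush_cases surj_pair)

lemma fpush_pow_states: "s \<in> states \<pi> \<Longrightarrow> (fpush \<pi> ^^ N) s \<in> states \<pi>"
  by (induction N) (auto simp: fpush_states)

lemma inj_on_fpush: "inj_on (fpush \<pi>) (states \<pi>)"
proof (rule inj_onI)
  fix s t assume st: "s \<in> states \<pi>" "t \<in> states \<pi>" "fpush \<pi> s = fpush \<pi> t"
  obtain w i v k where s: "s = (w, i)" and t: "t = (v, k)" by (metis surj_pair)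
  obtain j where j: "flip \<pi> w i j" "fpush \<pi> s = push w j" using st(1) s fpush_cases by metis
  obtain l where l: "flip \<pi> v k l" "fpush \<pi> t = push v l" using st(2) t fpush_cases by metis
  have e: "push w j = push v l" using st j l by simp
  then have jl: "j = l" and up: "w[j := w ! j + 1] = v[j := v ! j + 1]" by (auto simp: push_def)
  have "j < length w" "j < length v" using j l jl by (auto simp: flip_def marked_iff)
  then have "w ! j = v ! j" using up by (metis add_right_cancel nth_list_update_eq)
  then have "w = v" using up by (metis list_update_id list_update_overwrite)
  moreover have "i = k" using j(1) l(1) jl \<open>w = v\<close> flip_sym flip_unique by metis
  ultimately show "s = t" using s t by simp
qed

text \<open>First the marked letter is lowered, then the mark is flipped. A mark survives any change
  of its own letter, since that letter is deleted in the definition.\<close>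

lemma fpush_preimage:
  assumes "(v, j) \<in> states \<pi>"
  obtains i where "(v[j := v ! j - 1], i) \<in> states \<pi>" "flip \<pi> (v[j := v ! j - 1]) i j"
    "fpush \<pi> (v[j := v ! j - 1], i) = (v, j)"
proof -
  let ?w = "v[j := v ! j - 1]"
  have j: "marked \<pi> v j" "j < length v" using assms by (auto simp: states_def marked_iff)
  then obtain i where i: "flip \<pi> ?w j i" using ex_flip marked_update by blast
  have "push ?w j = (v, j)" using j by (simp add: push_def)
  moreover have "(?w, i) \<in> states \<pi>" using i by (simp add: states_def flip_def)
  ultimately show ?thesis using that[of i] flip_sym[OF i] fpush_flip[OF flip_sym[OF i]] by simp
qed

section \<open>Letters of reduced words are bounded\<close>

text \<open>For odd \<open>p\<close> and \<open>m\<close> the interval \<open>{p..m + 1}\<close> is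
  a union of cycles of \<open>fpf1\<close>, and the letters in \<open>{p..m}\<close> permute
  it.\<close>

lemma conj_word_window:
  assumes "set v \<subseteq> {p..m}" "odd p" "odd m"
  shows "(x \<in> {p..m + 1} \<longrightarrow> conj_word v x \<in> {p..m + 1}) \<and> (x \<notin> {p..m + 1} \<longrightarrow> conj_word v x = fpf1 x)"
  using assms(1)
proof (induction v arbitrary: x rule: rev_induct)
  case Nil
  have "x = p \<or> x = m + 1 \<Longrightarrow> odd x \<longleftrightarrow> x = p" using assms(2,3) by auto
  then show ?case using assms(2,3) by (auto simp: fpf1_def) (presburger+)?
next
  case (snoc s v)
  have s: "p \<le> s" "s \<le> m" using snoc.prems by auto
  have win: "sZ s k \<in> {p..m + 1} \<longleftrightarrow> k \<in> {p..m + 1}" for k using s by (auto simp: sZ_def)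
  have out: "k \<notin> {p..m + 1} \<Longrightarrow> sZ s k = k" for k using s by (auto simp: sZ_def)
  have IH: "k \<in> {p..m + 1} \<Longrightarrow> conj_word v k \<in> {p..m + 1}" "k \<notin> {p..m + 1} \<Longrightarrow> conj_word v k = fpf1 k" for k
    using snoc by auto
  have "fpf1 x \<notin> {p..m + 1}" if "x \<notin> {p..m + 1}"
    using that assms(2,3) by (auto simp: fpf1_def) (presburger+)?
  then show ?case using IH win out by (auto simp: conj_word_snoc simp del: atLeastAtMost_iff)
qed

lemma descent_window:
  assumes "set v \<subseteq> {p..m}" "odd p" "odd m"
    and "conj_word v s > conj_word v (s + 1)" "conj_word v s \<noteq> s + 1"
  shows "s \<in> {p..m}"
proof (rule ccontr)
  assume "s \<notin> {p..m}"
  then consider "s = m + 1" | "s > m + 1" | "s = p - 1" | "s < p - 1" by force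
  then show False
  proof cases
    case 1
    have "conj_word v (s + 1) = s + 2"
      using conj_word_window[OF assms(1-3), of "s + 1"] 1 assms(3) by (auto simp: fpf1_def)
    moreover have "conj_word v s \<le> s \<or> conj_word v s = fpf1 s"
      using conj_word_window[OF assms(1-3), of s] 1 by auto
    ultimately show ?thesis using assms(4) 1 assms(3) by (auto simp: fpf1_def)
  next
    case 3
    have "conj_word v s = s - 1"
      using conj_word_window[OF assms(1-3), of s] 3 assms(2) by (auto simp: fpf1_def)
    moreover have "conj_word v (s + 1) \<ge> s + 1 \<or> conj_word v (s + 1) = fpf1 (s + 1)"
      using conj_word_window[OF assms(1-3), of "s + 1"] 3 by auto
    ultimately show ?thesis using assms(4) 3 assms(2) by (auto simp: fpf1_def)
  qed (use conj_word_window[OF assms(1-3), of s] conj_word_window[OF assms(1-3), of "s + 1"] assms(4,5)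
        in \<open>auto simp: fpf1_def split: if_splits\<close>)
qed

lemma set_del_at: "set (del_at j w) \<subseteq> set w"
  by (auto simp: del_at_def dest: in_set_takeD in_set_dropD)

text \<open>The last letter of \<open>w\<close> is a descent of the common involution, hence lies in
  the window. Exchange then removes a letter from \<open>v\<close> and leaves a reduced word for
  \<open>w\<close> without its last letter.\<close>

lemma letters_window:
  assumes "odd p" "odd m" "fpf_reduced w" "fpf_reduced v" "conj_word v = conj_word w" "set v \<subseteq> {p..m}"
  shows "set w \<subseteq> {p..m}"
  using assms(3-)
proof (induction w arbitrary: v rule: rev_induct)
  case (snoc s w)
  have w: "fpf_reduced w" "conj_word w s < conj_word w (s + 1)" using snoc.prems fpf_reduced_snoc by auto
  have ne: "conj_word w s \<noteq> s + 1" using w conj_word_invol by (metis less_add_one order.asym)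
  have vs: "conj_word v s = conj_word w (s + 1)" "conj_word v (s + 1) = conj_word w s"
    unfolding snoc.prems(3) conj_word_snoc using sZ_conj_values[OF fpf_inv_conj_word ne] by blast+
  have vn: "conj_word v s \<noteq> s + 1" using vs conj_word_neq by metis
  have s: "s \<in> {p..m}" using descent_window[OF snoc.prems(4) assms(1,2) _ vn] vs w by simp
  obtain j where j: "j < length v" "conj_word (del_at j v) = conj_word (v @ [s])"
    using exchange_descent[OF _ vn] vs w by auto
  have "conj_word (v @ [s]) = conj_word w"
    unfolding conj_word_snoc[of v] snoc.prems(3) by (simp add: conj_word_snoc fun_eq_iff)
  then have e: "conj_word (del_at j v) = conj_word w" using j by simp
  have "length v \<le> length (w @ [s])" using fpf_reduced_min[OF snoc.prems(2), of "w @ [s]"] snoc.prems(3) by simp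
  then have r: "fpf_reduced (del_at j v)" using j by (intro fpf_reduced_cong[OF w(1) e]) simp
  have "set (del_at j v) \<subseteq> {p..m}" using set_del_at snoc.prems(4) by (rule order_trans)
  then have "set w \<subseteq> {p..m}" by (rule snoc.IH[OF w(1) r e])
  then show ?case using s by simp
qed simp

lemma ex_letter_window:
  shows "\<exists>p m. odd p \<and> odd m \<and> (\<forall>w\<in>RSp \<pi>. set w \<subseteq> {p..m})"
proof (cases "RSp \<pi> = {}")
  case True
  then show ?thesis by (intro exI[of _ 1]) simp
next
  case False
  then obtain v where v: "v \<in> RSp \<pi>" by blast
  \<comment> \<open>Twice the sum of absolute values plus one is an odd bound for all letters of
    \<open>v\<close>, and \<open>- M\<close> is an odd lower bound.\<close>
  define M where "M = 2 * (\<Sum>x\<leftarrow>v. \<bar>x\<bar>) + 1"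
  have "\<bar>x\<bar> \<le> (\<Sum>x\<leftarrow>v. \<bar>x\<bar>)" if "x \<in> set v" for x
    using that by (intro member_le_sum_list) auto
  moreover have "0 \<le> (\<Sum>x\<leftarrow>v. \<bar>x\<bar>)" by (intro sum_list_nonneg) auto
  ultimately have "set v \<subseteq> {- M..M}" unfolding M_def by fastforce
  moreover have "odd (- M)" "odd M" by (simp_all add: M_def)
  ultimately have "set w \<subseteq> {- M..M}" if "w \<in> RSp \<pi>" for w
    using that v letters_window[of "- M" M w v] by (auto simp: RSp_iff)
  then show ?thesis using \<open>odd (- M)\<close> \<open>odd M\<close> by (intro exI conjI ballI) assumption+
qed

lemma perm_word_commute_list:
  assumes "\<forall>b\<in>set y. b + 1 < c \<or> c + 1 < b"
  shows "perm_word (c # y) = perm_word (y @ [c])"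
  using assms
proof (induction y)
  case (Cons b y)
  have "perm_word (c # b # y) = perm_word [c, b] \<circ> perm_word y" by (simp add: fun_eq_iff)
  also have "perm_word [c, b] = perm_word [b, c]" using Cons.prems perm_word_commute[of c b] by auto
  also have "perm_word [b, c] \<circ> perm_word y = sZ b \<circ> perm_word (c # y)" by (simp add: fun_eq_iff)
  also have "perm_word (c # y) = perm_word (y @ [c])" using Cons by (metis list.set_intros(2))
  finally show ?case by simp
qed simp

text \<open>Such a letter \<open>c\<close> commutes with all others and can be moved to the end,
  where it is an ascent from \<open>c - 1\<close> to \<open>c + 2\<close>. As \<open>p\<close> and
  \<open>m\<close> are odd, \<open>m + 3\<close> and \<open>p - 3\<close> are the first even letters
  not adjacent to the window.\<close>

lemma far_letter_reduced:
  assumes m: "marked \<pi> w i" and win: "set (del_at i w) \<subseteq> {p..m}" "odd p" "odd m"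
    and far: "even (w ! i)" "w ! i \<ge> m + 3 \<or> w ! i \<le> p - 3"
  shows "fpf_reduced w"
proof -
  let ?c = "w ! i"
  let ?x = "take i w" and ?y = "drop (Suc i) w"
  have i: "i < length w" "fpf_reduced (?x @ ?y)" using m by (auto simp: marked_iff del_at_def)
  have w: "w = ?x @ ?c # ?y" using i(1) by (rule id_take_nth_drop)
  have win': "set (?x @ ?y) \<subseteq> {p..m}" using win(1) by (simp add: del_at_def)
  have "conj_word (?x @ ?y) ?c = ?c - 1" "conj_word (?x @ ?y) (?c + 1) = ?c + 2"
    using conj_word_window[OF win' win(2,3), of ?c] conj_word_window[OF win' win(2,3), of "?c + 1"] far
    by (auto simp: fpf1_def)
  then have r: "fpf_reduced ((?x @ ?y) @ [?c])" using i(2) fpf_reduced_snoc[of "?x @ ?y" ?c] by simp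
  have "perm_word (?c # ?y) = perm_word (?y @ [?c])"
    using win' far by (intro perm_word_commute_list) fastforce
  then have "conj_word (?x @ (?c # ?y) @ []) = conj_word (?x @ (?y @ [?c]) @ [])" by (rule conj_word_block)
  then have "conj_word (?x @ ?c # ?y) = conj_word ((?x @ ?y) @ [?c])" by simp
  then have "conj_word w = conj_word ((?x @ ?y) @ [?c])" using w by metis
  moreover have "length w = length ((?x @ ?y) @ [?c])" using i(1) by simp
  ultimately show ?thesis using fpf_reduced_cong[OF r] by (metis order_refl)
qed

lemma sum_list_del_at: "i < length w \<Longrightarrow> sum_list w = w ! i + sum_list (del_at i w)" for w :: "int list"
  using arg_cong[OF id_take_nth_drop[of i w], of sum_list] by (simp add: del_at_def)

lemma sum_list_push: "j < length w \<Longrightarrow> sum_list (fst (push w j)) = sum_list w + 1"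
  using sum_list_del_at[of j w] sum_list_del_at[of j "w[j := w ! j + 1]"] by (simp add: push_def)

lemma sum_list_window:
  fixes w :: "int list"
  assumes "set w \<subseteq> {p..m}"
  shows "\<bar>sum_list w\<bar> \<le> int (length w) * max \<bar>p\<bar> \<bar>m\<bar>"
  using assms
proof (induction w)
  case (Cons a w)
  have "\<bar>a\<bar> \<le> max \<bar>p\<bar> \<bar>m\<bar>" using Cons.prems by auto
  moreover have "\<bar>sum_list w\<bar> \<le> int (length w) * max \<bar>p\<bar> \<bar>m\<bar>" using Cons by simp
  ultimately have "\<bar>a + sum_list w\<bar> \<le> max \<bar>p\<bar> \<bar>m\<bar> + int (length w) * max \<bar>p\<bar> \<bar>m\<bar>"
    using abs_triangle_ineq[of a "sum_list w"] by (rule_tac order_trans) (assumption, rule add_mono)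
  then show ?case by (simp add: distrib_right)
qed simp

lemma length_fpush:
  assumes "s \<in> states \<pi>" shows "length (fst (fpush \<pi> s)) = length (fst s)"
    "sum_list (fst (fpush \<pi> s)) = sum_list (fst s) + 1"
proof -
  obtain w i where s: "s = (w, i)" by (metis surj_pair)
  obtain j where j: "flip \<pi> w i j" "fpush \<pi> s = push w j" using assms s fpush_cases by metis
  then show "length (fst (fpush \<pi> s)) = length (fst s)" 
    "sum_list (fst (fpush \<pi> s)) = sum_list (fst s) + 1"
    using s sum_list_push[of j w] by (auto simp: push_def flip_def marked_iff)
qed

text \<open>The other letters stay in the window, so any drift of the sum is a drift of the marked
  letter.\<close>

lemma marked_letter_bound:
  assumes "marked \<pi> w i" "\<forall>w\<in>RSp \<pi>. set w \<subseteq> {p..m}"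
  shows "\<bar>sum_list w - w ! i\<bar> \<le> int (length w) * max \<bar>p\<bar> \<bar>m\<bar>"
proof -
  have i: "i < length w" "del_at i w \<in> RSp \<pi>" using assms(1) by (auto simp: marked_def)
  then have "\<bar>sum_list (del_at i w)\<bar> \<le> int (length (del_at i w)) * max \<bar>p\<bar> \<bar>m\<bar>"
    using assms(2) sum_list_window by blast
  also have "\<dots> \<le> int (length w) * max \<bar>p\<bar> \<bar>m\<bar>" using i(1) by (intro mult_right_mono) auto
  finally show ?thesis using sum_list_del_at[OF i(1)] by simp
qed

text \<open>A mark elsewhere would leave the far letter in a reduced word of
  \<open>\<pi>\<close>.\<close>

lemma flip_far_letter:
  assumes "flip \<pi> w i j" "\<forall>w\<in>RSp \<pi>. set w \<subseteq> {p..m}" "w ! i \<notin> {p..m}"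
  shows "j = i"
proof (rule ccontr)
  assume "j \<noteq> i"
  have i: "i < length w" and "del_at j w \<in> RSp \<pi>" using assms(1) by (auto simp: flip_def marked_def)
  moreover have "w ! i \<in> set (del_at j w)"
  proof (cases "i < j")
    case True
    then have "del_at j w ! i = w ! i" "i < length (del_at j w)"
      using i assms(1) by (auto simp: del_at_def nth_append flip_def marked_iff)
    then show ?thesis using nth_mem by metis
  next
    case False
    then have "w ! i = drop (Suc j) w ! (i - Suc j)" "i - Suc j < length (drop (Suc j) w)"
      using i \<open>j \<noteq> i\<close> by auto
    then show ?thesis unfolding del_at_def using nth_mem by (metis UnCI set_append)
  qed
  ultimately show False using assms(2,3) by blast
qed

text \<open>Each push raises the sum by one and the other letters contribute at most
  \<open>K\<close>, so after \<open>N\<close> pushes the marked letter is at least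
  \<open>m + 3\<close>. If it is odd, its mark cannot move and the next push makes it even.\<close>

lemma ex_forward_return:
  assumes s: "s \<in> states \<pi>"
  shows "\<exists>N>0. fpf_reduced (fst ((fpush \<pi> ^^ N) s))"
proof -
  obtain p m where win: "odd p" "odd m" "\<forall>w\<in>RSp \<pi>. set w \<subseteq> {p..m}" using ex_letter_window by blast
  define K where "K = int (length (fst s)) * max \<bar>p\<bar> \<bar>m\<bar>"
  define N where "N = nat (\<bar>sum_list (fst s)\<bar> + K + \<bar>m\<bar> + 4)"
  have "0 \<le> K" by (simp add: K_def)
  then have N: "int N = \<bar>sum_list (fst s)\<bar> + K + \<bar>m\<bar> + 4" "0 < N" unfolding N_def by linarith+
  have sums: "sum_list (fst ((fpush \<pi> ^^ n) s)) = sum_list (fst s) + int n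
      \<and> length (fst ((fpush \<pi> ^^ n) s)) = length (fst s)" for n
    by (induction n) (auto simp: length_fpush fpush_pow_states s)
  obtain w i where wi: "(fpush \<pi> ^^ N) s = (w, i)" by (metis surj_pair)
  have m: "marked \<pi> w i" using fpush_pow_states[OF s, of N] wi by (simp add: states_def)
  have "\<bar>sum_list w - w ! i\<bar> \<le> K" using marked_letter_bound[OF m win(3)] sums[of N] wi by (simp add: K_def)
  moreover have "sum_list w = sum_list (fst s) + int N" using sums[of N] wi by simp
  ultimately have big: "w ! i \<ge> m + 3" using N by linarith
  have dw: "set (del_at i w) \<subseteq> {p..m}" using m win(3) by (simp add: marked_def)
  show ?thesis
  proof (cases "even (w ! i)")
    case True
    then have "fpf_reduced w" using far_letter_reduced[OF m dw win(1,2)] big by simp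
    then show ?thesis using N(2) wi by (metis fst_conv)
  next
    case False
    obtain j where j: "flip \<pi> w i j" using m ex_flip by blast
    then have "j = i" using flip_far_letter[OF j win(3)] big by simp
    then have *: "(fpush \<pi> ^^ Suc N) s = push w i" using fpush_flip j wi by simp
    have il: "i < length w" using m by (simp add: marked_iff)
    have "fpf_reduced (w[i := w ! i + 1])"
      using far_letter_reduced[of \<pi> "w[i := w ! i + 1]" i p m] m dw win il big False by simp
    then show ?thesis using * by (intro exI[of _ "Suc N"]) (simp add: push_def)
  qed
qed

lemma ex_backward_return:
  assumes s: "s \<in> states \<pi>"
  shows "\<exists>N>0. \<exists>t\<in>states \<pi>. fpf_reduced (fst t) \<and> (fpush \<pi> ^^ N) t = s"
proof -
  obtain p m where win: "odd p" "odd m" "\<forall>w\<in>RSp \<pi>. set w \<subseteq> {p..m}" using ex_letter_window by blast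
  define K where "K = int (length (fst s)) * max \<bar>p\<bar> \<bar>m\<bar>"
  define N where "N = nat (\<bar>sum_list (fst s)\<bar> + K + \<bar>p\<bar> + 4)"
  have "0 \<le> K" by (simp add: K_def)
  then have N: "int N = \<bar>sum_list (fst s)\<bar> + K + \<bar>p\<bar> + 4" "0 < N" unfolding N_def by linarith+
  \<comment> \<open>Preimages can be iterated, so the same estimate works backwards, with the marked
    letter falling below the window.\<close>
  have bk: "\<exists>t\<in>states \<pi>. (fpush \<pi> ^^ n) t = s" for n
  proof (induction n)
    case (Suc n)
    then obtain t where t: "t \<in> states \<pi>" "(fpush \<pi> ^^ n) t = s" by blast
    obtain t' where "t' \<in> states \<pi>" "fpush \<pi> t' = t" using t(1) fpush_preimage by (metis surj_pair)
    then show ?case using t by (intro bexI[of _ t']) (simp_all add: funpow_swap1)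
  qed (use s in simp)
  obtain t where t: "t \<in> states \<pi>" "(fpush \<pi> ^^ N) t = s" using bk by blast
  obtain w i where wi: "t = (w, i)" by (metis surj_pair)
  have "sum_list (fst ((fpush \<pi> ^^ n) t)) = sum_list (fst t) + int n
      \<and> length (fst ((fpush \<pi> ^^ n) t)) = length (fst t)" for n
    by (induction n) (auto simp: length_fpush fpush_pow_states t(1))
  then have sums: "sum_list (fst s) = sum_list w + int N" "length (fst s) = length w"
    using t(2) wi by (metis fst_conv)+
  have m: "marked \<pi> w i" using t(1) wi by (simp add: states_def)
  have "\<bar>sum_list w - w ! i\<bar> \<le> K" using marked_letter_bound[OF m win(3)] sums by (simp add: K_def)
  then have big: "w ! i \<le> p - 3" using sums(1) N by linarith
  have dw: "set (del_at i w) \<subseteq> {p..m}" using m win(3) by (simp add: marked_def)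
  show ?thesis
  proof (cases "even (w ! i)")
    case True
    then have "fpf_reduced w" using far_letter_reduced[OF m dw win(1,2)] big by simp
    then show ?thesis using N(2) wi t by (metis fst_conv)
  next
    case False
    let ?v = "w[i := w ! i - 1]"
    obtain j where j: "(?v, j) \<in> states \<pi>" "flip \<pi> ?v j i" "fpush \<pi> (?v, j) = (w, i)"
      using t(1) wi fpush_preimage by metis
    have il: "i < length w" using m by (simp add: marked_iff)
    have "fpf_reduced ?v"
      using far_letter_reduced[of \<pi> ?v i p m] m dw win il big False by simp
    moreover have "(fpush \<pi> ^^ Suc N) (?v, j) = s" using j(3) t(2) wi by (simp add: funpow_swap1)
    ultimately show ?thesis using j(1) by (metis fst_conv zero_less_Suc)
  qed
qed

section \<open>The bump as a first return map\<close>

text \<open>The first return as a relation between states. Keeping the final mark is what allows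
  runs to be reversed and to be compared.\<close>

definition bump :: "(int \<Rightarrow> int) \<Rightarrow> int list \<times> nat \<Rightarrow> int list \<times> nat \<Rightarrow> bool" where
  "bump \<pi> s t \<longleftrightarrow> (\<exists>N>0. (fpush \<pi> ^^ N) s = t \<and> fpf_reduced (fst t) \<and>
     (\<forall>M. 0 < M \<and> M < N \<longrightarrow> \<not> fpf_reduced (fst ((fpush \<pi> ^^ M) s))))"

lemma ex_bump_Least:
  assumes "s \<in> states \<pi>"
  shows "bump \<pi> s ((fpush \<pi> ^^ (LEAST N. 0 < N \<and> fpf_reduced (fst ((fpush \<pi> ^^ N) s)))) s)"
proof -
  let ?P = "\<lambda>N. 0 < N \<and> fpf_reduced (fst ((fpush \<pi> ^^ N) s))"
  have ex: "\<exists>N. ?P N" using ex_forward_return[OF assms] by blast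
  have "?P (LEAST N. ?P N)" using ex by (rule LeastI_ex)
  moreover have "\<not> ?P M" if "M < (LEAST N. ?P N)" for M using that by (rule not_less_Least)
  ultimately show ?thesis unfolding bump_def by blast
qed

lemma bump_unique:
  assumes "bump \<pi> s t" "bump \<pi> s t'" shows "t = t'"
proof -
  obtain N where N: "0 < N" "(fpush \<pi> ^^ N) s = t" "fpf_reduced (fst t)"
    "\<And>M. 0 < M \<Longrightarrow> M < N \<Longrightarrow> \<not> fpf_reduced (fst ((fpush \<pi> ^^ M) s))"
    using assms(1) unfolding bump_def by blast
  obtain N' where N': "0 < N'" "(fpush \<pi> ^^ N') s = t'" "fpf_reduced (fst t')"
    "\<And>M. 0 < M \<Longrightarrow> M < N' \<Longrightarrow> \<not> fpf_reduced (fst ((fpush \<pi> ^^ M) s))"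
    using assms(2) unfolding bump_def by blast
  have "\<not> N < N'" using N N'(4)[of N] by auto
  moreover have "\<not> N' < N" using N' N(4)[of N'] by auto
  ultimately show ?thesis using N N' by (metis linorder_neqE_nat)
qed

lemma bump_states: "s \<in> states \<pi> \<Longrightarrow> bump \<pi> s t \<Longrightarrow> t \<in> states \<pi>"
  unfolding bump_def using fpush_pow_states by blast

lemma bump_reduced: "bump \<pi> s t \<Longrightarrow> fpf_reduced (fst t)"
  unfolding bump_def by blast

lemma fpush_pow_inject:
  assumes "s \<in> states \<pi>" "t \<in> states \<pi>" "(fpush \<pi> ^^ N) s = (fpush \<pi> ^^ N) t"
  shows "s = t"
  using assms(3)
proof (induction N)
  case (Suc N)
  then have "fpush \<pi> ((fpush \<pi> ^^ N) s) = fpush \<pi> ((fpush \<pi> ^^ N) t)" by simp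
  then show ?case using Suc.IH inj_onD[OF inj_on_fpush] fpush_pow_states assms(1,2) by blast
qed simp

text \<open>Cancelling the pushes of the shorter run places its start on the longer run. That start
  is reduced, and no reduced word lies strictly inside a run.\<close>

lemma bump_inject:
  assumes "s \<in> states \<pi>" "s' \<in> states \<pi>" "fpf_reduced (fst s)" "fpf_reduced (fst s')"
    "bump \<pi> s t" "bump \<pi> s' t"
  shows "s = s'"
proof -
  have wlog: "s = s'" if s: "s \<in> states \<pi>" "s' \<in> states \<pi>" "fpf_reduced (fst s)"
    and N: "(fpush \<pi> ^^ N) s = t" "0 < N"
    and N': "(fpush \<pi> ^^ N') s' = t" "\<forall>M. 0 < M \<and> M < N' \<longrightarrow> \<not> fpf_reduced (fst ((fpush \<pi> ^^ M) s'))"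
    and le: "N \<le> N'" for s s' N N'
  proof -
    have "(fpush \<pi> ^^ N') s' = (fpush \<pi> ^^ N) ((fpush \<pi> ^^ (N' - N)) s')"
      using le by (metis comp_apply funpow_add le_add_diff_inverse)
    then have e: "s = (fpush \<pi> ^^ (N' - N)) s'"
      using fpush_pow_inject[of s \<pi> "(fpush \<pi> ^^ (N' - N)) s'" N] fpush_pow_states s N N' by simp
    then have "\<not> 0 < N' - N" using N'(2) s(3) N(2) le by (metis diff_less dual_order.strict_trans1)
    then show ?thesis using e by simp
  qed
  obtain N where N: "0 < N" "(fpush \<pi> ^^ N) s = t"
    "\<forall>M. 0 < M \<and> M < N \<longrightarrow> \<not> fpf_reduced (fst ((fpush \<pi> ^^ M) s))"
    using assms(5) unfolding bump_def by blast
  obtain N' where N': "0 < N'" "(fpush \<pi> ^^ N') s' = t"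
    "\<forall>M. 0 < M \<and> M < N' \<longrightarrow> \<not> fpf_reduced (fst ((fpush \<pi> ^^ M) s'))"
    using assms(6) unfolding bump_def by blast
  show ?thesis
  proof (cases "N \<le> N'")
    case True
    then show ?thesis using wlog[OF assms(1,2,3) N(2,1) N'(2,3)] by simp
  next
    case False
    then show ?thesis using wlog[OF assms(2,1,4) N'(2,1) N(2,3)] by simp
  qed
qed

text \<open>Go backwards by the least positive number of steps that reaches a reduced word; by
  minimality none is passed on the way.\<close>

lemma bump_surj:
  assumes "t \<in> states \<pi>" "fpf_reduced (fst t)"
  obtains s where "s \<in> states \<pi>" "fpf_reduced (fst s)" "bump \<pi> s t"
proof -
  let ?P = "\<lambda>N. 0 < N \<and> (\<exists>s\<in>states \<pi>. fpf_reduced (fst s) \<and> (fpush \<pi> ^^ N) s = t)"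
  have ex: "\<exists>N. ?P N" using ex_backward_return[OF assms(1)] by blast
  define N where "N = (LEAST N. ?P N)"
  have "?P N" unfolding N_def using ex by (rule LeastI_ex)
  then obtain s where s: "0 < N" "s \<in> states \<pi>" "fpf_reduced (fst s)" "(fpush \<pi> ^^ N) s = t" by blast
  have "\<not> fpf_reduced (fst ((fpush \<pi> ^^ M) s))" if "0 < M" "M < N" for M
  proof
    assume r: "fpf_reduced (fst ((fpush \<pi> ^^ M) s))"
    have "(fpush \<pi> ^^ (N - M)) ((fpush \<pi> ^^ M) s) = t"
      using s(4) that by (metis comp_apply funpow_add le_add_diff_inverse2 less_imp_le_nat)
    then have "?P (N - M)" using r that fpush_pow_states[OF s(2)] by auto
    moreover have "N - M < N" using that by simp
    ultimately show False using not_less_Least[of "N - M" ?P] unfolding N_def by blast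
  qed
  then have "bump \<pi> s t" unfolding bump_def using s assms(2) by blast
  then show ?thesis using that s by blast
qed

text \<open>A reduced word has at most one mark, so the \<open>LEAST\<close> in \<open>fb\<close>
  picks the given one.\<close>

lemma fb_bump:
  assumes r: "fpf_reduced w" and m: "marked \<pi> w i"
  shows "\<exists>j. bump \<pi> (w, i) (fb \<pi> w, j)"
proof -
  have "(LEAST i. marked \<pi> w i) = i"
    using m r two_marks_not_reduced(1) by (intro Least_equality) (metis order_refl)+
  then have "fb \<pi> w = fst ((fpush \<pi> ^^ (LEAST N. 0 < N \<and> fpf_reduced (fst ((fpush \<pi> ^^ N) (w, i))))) (w, i))"
    using m by (auto simp: fb_def Let_def)
  then show ?thesis using ex_bump_Least[of "(w, i)" \<pi>] m by (metis (no_types, lifting) case_prodI mem_Collect_eq prod.collapse states_def)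
qed

lemma fb_unmarked: "\<not> (\<exists>i. marked \<pi> w i) \<Longrightarrow> fb \<pi> w = w"
  by (simp add: fb_def)

lemma fb_cases:
  assumes "fpf_reduced w"
  obtains (marked) i j where "marked \<pi> w i" "marked \<pi> (fb \<pi> w) j" "bump \<pi> (w, i) (fb \<pi> w, j)" "fpf_reduced (fb \<pi> w)"
  | (unmarked) "\<not> (\<exists>i. marked \<pi> w i)" "fb \<pi> w = w"
proof (cases "\<exists>i. marked \<pi> w i")
  case True
  then obtain i where i: "marked \<pi> w i" by blast
  obtain j where j: "bump \<pi> (w, i) (fb \<pi> w, j)" using fb_bump[OF assms i] by blast
  have "(fb \<pi> w, j) \<in> states \<pi>" using bump_states[OF _ j] i by (simp add: states_def)
  then show ?thesis using marked[OF i _ j] bump_reduced[OF j] by (simp add: states_def)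
next
  case False
  then show ?thesis using unmarked fb_unmarked by blast
qed

lemma fpf_reduced_fb: "fpf_reduced w \<Longrightarrow> fpf_reduced (fb \<pi> w)"
  by (cases rule: fb_cases[of w \<pi>]) auto

text \<open>The result of a bump is marked and words without a mark are fixed, so the two kinds do
  not mix; on marked words the first return map is bijective.\<close>

lemma bij_betw_fb: "bij_betw (fb \<pi>) {w. fpf_reduced w} {w. fpf_reduced w}"
proof (rule bij_betwI')
  fix w v assume "w \<in> {w. fpf_reduced w}" "v \<in> {w. fpf_reduced w}"
  then have w: "fpf_reduced w" and v: "fpf_reduced v" by auto
  show "(fb \<pi> w = fb \<pi> v) = (w = v)"
  proof
    assume e: "fb \<pi> w = fb \<pi> v"
    show "w = v"
    proof (cases rule: fb_cases[OF w, of \<pi>])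
      case (1 i j)
      show ?thesis
      proof (cases rule: fb_cases[OF v, of \<pi>])
        case 11: (1 i' j')
        have "j = j'" using 1 11 e two_marks_not_reduced(1) by metis
        then have "(w, i) = (v, i')" using 1 11 e w v by (intro bump_inject[of "(w, i)" \<pi> "(v, i')"]) (auto simp: states_def)
        then show ?thesis by simp
      next
        case 2
        then show ?thesis using 1 e by metis
      qed
    next
      case 2
      show ?thesis
      proof (cases rule: fb_cases[OF v, of \<pi>])
        case 1
        then show ?thesis using 2 e by metis
      next
        case 22: 2
        then show ?thesis using 2 e by simp
      qed
    qed
  qed simp
next
  fix w assume "w \<in> {w. fpf_reduced w}"
  then show "fb \<pi> w \<in> {w. fpf_reduced w}" using fpf_reduced_fb by blast
next
  fix v assume "v \<in> {w. fpf_reduced w}"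
  then have v: "fpf_reduced v" by simp
  show "\<exists>w\<in>{w. fpf_reduced w}. v = fb \<pi> w"
  proof (cases "\<exists>j. marked \<pi> v j")
    case True
    then obtain j where j: "marked \<pi> v j" by blast
    then obtain s where s: "s \<in> states \<pi>" "fpf_reduced (fst s)" "bump \<pi> s (v, j)"
      using bump_surj[of "(v, j)" \<pi>] v by (auto simp: states_def)
    obtain w i where wi: "s = (w, i)" by (metis surj_pair)
    have m: "marked \<pi> w i" and w: "fpf_reduced w" using s wi by (auto simp: states_def)
    obtain j' where "bump \<pi> (w, i) (fb \<pi> w, j')" using fb_bump[OF w m] by blast
    then have "(fb \<pi> w, j') = (v, j)" using s(3) wi bump_unique by metis
    then show ?thesis using w by auto
  next
    case False
    then show ?thesis using v fb_unmarked by force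
  qed
qed

section \<open>Descents\<close>

lemma fpf_reduced_adjacent:
  assumes "fpf_reduced w" "Suc k < length w" shows "w ! k \<noteq> w ! Suc k"
proof
  assume e: "w ! k = w ! Suc k"
  let ?x = "take k w" and ?y = "drop (Suc (Suc k)) w"
  have w: "w = ?x @ [w ! k, w ! k] @ ?y"
    using assms(2) e by (metis Cons_nth_drop_Suc Suc_lessD append_Cons append_Nil id_take_nth_drop)
  have "conj_word (?x @ [w ! k, w ! k] @ ?y) = conj_word (?x @ [] @ ?y)"
    by (rule conj_word_block) (rule perm_word_square)
  then have "conj_word (?x @ ?y) = conj_word w" using w by (metis append_Nil)
  then show False using fpf_reduced_min[OF assms(1)] assms(2) by fastforce
qed

lemma del_at_adjacent:
  assumes "Suc k < length w" "w ! k = w ! Suc k" shows "del_at k w = del_at (Suc k) w"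
  using assms by (simp add: del_at_def take_Suc_conv_app_nth Cons_nth_drop_Suc)

lemma marked_adjacent:
  assumes "Suc k < length w" "w ! k = w ! Suc k"
  shows "marked \<pi> w k \<longleftrightarrow> marked \<pi> w (Suc k)"
  using assms del_at_adjacent[OF assms] by (auto simp: marked_def)

definition same_desc :: "int list \<Rightarrow> int list \<Rightarrow> bool" where
  "same_desc w v \<longleftrightarrow> length v = length w \<and>
     (\<forall>k. Suc k < length w \<longrightarrow> (w ! k < w ! Suc k \<longleftrightarrow> v ! k < v ! Suc k))"

text \<open>The descent pattern of \<open>u\<close>, relaxed just enough to survive a push: two
  neighbours may have become equal, provided that the mark sits on the one that was smaller.\<close>

definition desc_inv :: "int list \<Rightarrow> int list \<times> nat \<Rightarrow> bool" where
  "desc_inv u s \<longleftrightarrow> length (fst s) = length u \<and> (\<forall>k. Suc k < length u \<longrightarrow>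
     (if u ! k < u ! Suc k then fst s ! k < fst s ! Suc k \<or> fst s ! k = fst s ! Suc k \<and> snd s = k
      else fst s ! Suc k < fst s ! k \<or> fst s ! k = fst s ! Suc k \<and> snd s = Suc k))"

lemma desc_inv_fpush:
  assumes s: "s \<in> states \<pi>" and inv: "desc_inv u s"
  shows "desc_inv u (fpush \<pi> s)"
proof -
  obtain w i where wi: "s = (w, i)" by (metis surj_pair)
  obtain j where j: "flip \<pi> w i j" "fpush \<pi> s = push w j" using s wi fpush_cases by metis
  have len: "length w = length u" using inv wi by (simp add: desc_inv_def)
  have jl: "j < length w" "marked \<pi> w i" using j(1) by (auto simp: flip_def marked_iff)
  \<comment> \<open>Equal neighbours are both marked, so the push goes to the other one and the
    strict inequality returns. \<open>eq2\<close> is the same for a descent.\<close>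
  have eq1: "j = Suc k" if "Suc k < length u" "w ! k = w ! Suc k" "i = k" for k
  proof -
    have "flip \<pi> w k (Suc k)"
      using that len jl marked_adjacent[of k w \<pi>] by (intro flip_two_marks) auto
    then show ?thesis using j(1) that flip_unique by blast
  qed
  have eq2: "j = k" if "Suc k < length u" "w ! k = w ! Suc k" "i = Suc k" for k
  proof -
    have "flip \<pi> w (Suc k) k"
      using that len jl marked_adjacent[of k w \<pi>] by (intro flip_two_marks) auto
    then show ?thesis using j(1) that flip_unique by blast
  qed
  have "if u ! k < u ! Suc k
    then w[j := w ! j + 1] ! k < w[j := w ! j + 1] ! Suc k \<or> w[j := w ! j + 1] ! k = w[j := w ! j + 1] ! Suc k \<and> j = k
    else w[j := w ! j + 1] ! Suc k < w[j := w ! j + 1] ! k \<or> w[j := w ! j + 1] ! k = w[j := w ! j + 1] ! Suc k \<and> j = Suc k"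
    if k: "Suc k < length u" for k
  proof -
    have nk: "w[j := w ! j + 1] ! k = (if j = k then w ! k + 1 else w ! k)"
      "w[j := w ! j + 1] ! Suc k = (if j = Suc k then w ! Suc k + 1 else w ! Suc k)"
      using k len by (auto simp: nth_list_update)
    show ?thesis
    proof (cases "u ! k < u ! Suc k")
      case True
      then have "w ! k < w ! Suc k \<or> w ! k = w ! Suc k \<and> i = k" using inv k wi by (auto simp: desc_inv_def)
      then show ?thesis using True eq1[OF k] by (auto simp: nk simp del: nth_list_update)
    next
      case False
      then have "w ! Suc k < w ! k \<or> w ! k = w ! Suc k \<and> i = Suc k" using inv k wi by (auto simp: desc_inv_def)
      then show ?thesis using False eq2[OF k] by (auto simp: nk simp del: nth_list_update)
    qed
  qed
  then show ?thesis unfolding j(2) by (simp add: desc_inv_def push_def len)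
qed

lemma fb_same_desc:
  assumes w: "fpf_reduced w" shows "same_desc w (fb \<pi> w)"
proof (cases rule: fb_cases[OF w, of \<pi>])
  case (1 i j)
  have s: "(w, i) \<in> states \<pi>" using 1 by (simp add: states_def)
  have "desc_inv w (w, i)"
    unfolding desc_inv_def using fpf_reduced_adjacent[OF w] by (simp add: not_less) (metis order_le_less)
  then have "desc_inv w ((fpush \<pi> ^^ N) (w, i))" for N
    by (induction N) (auto intro!: desc_inv_fpush fpush_pow_states s)
  then have "desc_inv w (fb \<pi> w, j)" using 1(3) unfolding bump_def by metis
  then show ?thesis using fpf_reduced_adjacent[OF 1(4)] unfolding desc_inv_def same_desc_def
    by (auto split: if_splits)
next
  case 2
  then show ?thesis by (simp add: same_desc_def)
qed

section \<open>Local moves commute with bumps\<close>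

text \<open>The indices \<open>p\<close>, \<open>q\<close> record that a mark at position \<open>p\<close> of the first block corresponds
  to a mark at position \<open>q\<close> of the second one and vice versa.\<close>

inductive local_move :: "int list \<Rightarrow> int list \<Rightarrow> int list \<Rightarrow> nat \<Rightarrow> nat \<Rightarrow> bool" where
  bac_bca: "a < b \<Longrightarrow> b < c \<Longrightarrow> local_move x [b, a, c] [b, c, a] (Suc 0) (Suc (Suc 0))"
| acb_cab: "a < b \<Longrightarrow> b < c \<Longrightarrow> local_move x [a, c, b] [c, a, b] 0 (Suc 0)"
| braid: "local_move x [b, b + 1, b] [b + 1, b, b + 1] 0 (Suc (Suc 0))"
| initial_swap: "even a \<Longrightarrow> even b \<Longrightarrow> a < b \<Longrightarrow> local_move [] [a, b] [b, a] 0 (Suc 0)"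
| initial_step: "even b \<Longrightarrow> local_move [] [b, b + 1] [b, b - 1] 0 0"

lemma local_move_length: "local_move x T T' p q \<Longrightarrow> length T' = length T \<and> p < length T \<and> q < length T"
  by (induction rule: local_move.induct) auto

text \<open>The permutations of the two words differ; they agree only in their effect on
  \<open>fpf1\<close>.\<close>

lemma conj_word_initial_step: "even b \<Longrightarrow> conj_word [b, b + 1] = conj_word [b, b - 1]"
  by (auto simp: conj_word_act act_def fun_eq_iff sZ_def fpf1_def)

lemma conj_word_local_move:
  assumes "local_move x T T' p q" shows "conj_word (x @ T @ y) = conj_word (x @ T' @ y)"
  using assms
proof (induction rule: local_move.induct)
  case (bac_bca a b c x)
  have "perm_word [a, c] = perm_word [c, a]" using bac_bca by (intro perm_word_commute) auto
  then show ?case using conj_word_block[of "[a, c]" "[c, a]" "x @ [b]" y] by simp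
next
  case (acb_cab a b c x)
  have "perm_word [a, c] = perm_word [c, a]" using acb_cab by (intro perm_word_commute) auto
  then show ?case using conj_word_block[of "[a, c]" "[c, a]" x "b # y"] by simp
next
  case (braid x b)
  show ?case by (rule conj_word_block) (rule perm_word_braid)
next
  case (initial_swap a b)
  have "a + 1 < b" using initial_swap by presburger
  then have "perm_word [a, b] = perm_word [b, a]" by (intro perm_word_commute) auto
  then show ?case using conj_word_block by blast
next
  case (initial_step b)
  show ?case unfolding append_Nil conj_word_append conj_word_initial_step[OF initial_step] ..
qed

lemma not_fpf_reduced_square: "\<not> fpf_reduced (x @ b # b # y)"
  using fpf_reduced_adjacent[of "x @ b # b # y" "length x"] by (auto simp: nth_append)

text \<open>In a commutation each letter is matched with itself. In the braid move the outer letters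
  are interchanged: without its first letter \<open>b, b + 1, b\<close> becomes
  \<open>b + 1, b\<close>, and so does \<open>b + 1, b, b + 1\<close> without its last. Where
  matched deletions do not agree, both leave a square or both leave an odd first letter.\<close>

lemma local_move_del_at:
  assumes "local_move x T T' p q" "i < length (x @ T @ y)"
  shows "conj_word (del_at i (x @ T @ y))
      = conj_word (del_at (transpose (length x + p) (length x + q) i) (x @ T' @ y))
    \<or> \<not> fpf_reduced (del_at i (x @ T @ y))
      \<and> \<not> fpf_reduced (del_at (transpose (length x + p) (length x + q) i) (x @ T' @ y))"
proof -
  have len: "length T' = length T" "p < length T" "q < length T" using local_move_length[OF assms(1)] by auto
  consider "i < length x" | n where "i = length x + n" "n < length T"
    | n where "i = length x + (length T + n)"
    by (metis add_less_imp_less_left le_Suc_ex linorder_not_less)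
  then show ?thesis
  proof cases
    case 1
    then have "transpose (length x + p) (length x + q) i = i" by (simp add: transpose_def)
    moreover have "local_move (del_at i x) T T' p q"
      using assms(1) 1 by cases (auto intro: local_move.intros)
    ultimately show ?thesis using conj_word_local_move 1 by (simp add: del_at_append_left)
  next
    case (3 n)
    then have "transpose (length x + p) (length x + q) i = i" using len by (simp add: transpose_def)
    moreover have "del_at i (x @ T @ y) = x @ T @ del_at n y" "del_at i (x @ T' @ y) = x @ T' @ del_at n y"
      using 3 len del_at_append[of x "length T + n" "T @ y"] del_at_append[of T n y]
        del_at_append[of x "length T + n" "T' @ y"] del_at_append[of T' n y] by simp_all
    ultimately show ?thesis using conj_word_local_move[OF assms(1)] by simp
  next
    case (2 n)
    have t: "transpose (length x + p) (length x + q) i = length x + transpose p q n"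
      using 2 by (simp add: transpose_def)
    have m: "transpose p q n < length T'" using len 2 by (simp add: transpose_def)
    have d: "del_at i (x @ T @ y) = x @ del_at n T @ y"
      "del_at (length x + transpose p q n) (x @ T' @ y) = x @ del_at (transpose p q n) T' @ y"
      using 2 m by (simp_all add: del_at_append_left)
    have "conj_word (x @ del_at n T @ y) = conj_word (x @ del_at (transpose p q n) T' @ y)
      \<or> \<not> fpf_reduced (x @ del_at n T @ y) \<and> \<not> fpf_reduced (x @ del_at (transpose p q n) T' @ y)"
      using assms(1)
    proof cases
      case (bac_bca a b c)
      have "perm_word [a, c] = perm_word [c, a]" using bac_bca by (intro perm_word_commute) auto
      then have "conj_word (x @ [a, c] @ y) = conj_word (x @ [c, a] @ y)" by (rule conj_word_block)
      then show ?thesis using bac_bca 2(2) by (auto simp: less_Suc_eq transpose_def)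
    next
      case (acb_cab a b c)
      have "perm_word [a, c] = perm_word [c, a]" using acb_cab by (intro perm_word_commute) auto
      then have "conj_word (x @ [a, c] @ y) = conj_word (x @ [c, a] @ y)" by (rule conj_word_block)
      then show ?thesis using acb_cab 2(2) by (auto simp: less_Suc_eq transpose_def)
    next
      case (braid b)
      then show ?thesis using 2(2) not_fpf_reduced_square by (auto simp: less_Suc_eq transpose_def)
    next
      case (initial_swap a b)
      then show ?thesis using 2(2) by (auto simp: less_Suc_eq transpose_def)
    next
      case (initial_step b)
      then show ?thesis using 2(2) fpf_reduced_hd_even[of "b + 1" y] fpf_reduced_hd_even[of "b - 1" y]
        by (auto simp: less_Suc_eq transpose_def)
    qed
    then show ?thesis unfolding t d .
  qed
qed

lemma local_move_marked:
  assumes mv: "local_move x T T' p q"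
  shows "marked \<pi> (x @ T @ y) i \<longleftrightarrow> marked \<pi> (x @ T' @ y) (transpose (length x + p) (length x + q) i)"
    (is "?L \<longleftrightarrow> ?R")
proof -
  let ?t = "transpose (length x + p) (length x + q)"
  have len: "length T' = length T" "p < length T" "q < length T" using local_move_length[OF mv] by auto
  have lt: "i < length (x @ T @ y) \<longleftrightarrow> ?t i < length (x @ T' @ y)"
    using len by (auto simp: transpose_def)
  show ?thesis
  proof
    assume L: ?L
    then have "i < length (x @ T @ y)" by (simp add: marked_iff)
    then show ?R using L lt local_move_del_at[OF mv, of i y] len
      by (intro marked_transfer[OF L]) (auto simp: marked_iff)
  next
    assume R: ?R
    then have i: "i < length (x @ T @ y)" using lt by (simp add: marked_iff)
    then show ?L using R lt local_move_del_at[OF mv, of i y] len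
      by (intro marked_transfer[OF R]) (auto simp: marked_iff)
  qed
qed

section \<open>Bisimulation of two bumps\<close>

definition rel :: "nat \<Rightarrow> nat \<Rightarrow> int list \<times> nat \<Rightarrow> int list \<times> nat \<Rightarrow> bool" where
  "rel n k s s' \<longleftrightarrow> (\<exists>x T T' y p q. length x = k \<and> length T = n \<and> fst s = x @ T @ y \<and> fst s' = x @ T' @ y \<and>
     local_move x T T' p q \<and> snd s' = transpose (k + p) (k + q) (snd s))"

lemma rel_I:
  "local_move x T T' p q \<Longrightarrow> j = transpose (length x + p) (length x + q) i \<Longrightarrow> length T = n \<Longrightarrow> k = length x \<Longrightarrow>
    rel n k (x @ T @ y, i) (x @ T' @ y, j)"
  unfolding rel_def by fastforce

text \<open>Both runs may make further pushes, in different numbers, before they are again one local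
  move apart, possibly with the sides exchanged. Every state that is left on the way, including the
  present one, must not be fpf-reduced, so that no bump ends there.\<close>

definition sim :: "(int \<Rightarrow> int) \<Rightarrow> nat \<Rightarrow> nat \<Rightarrow> int list \<times> nat \<Rightarrow> int list \<times> nat \<Rightarrow> bool" where
  "sim \<pi> n k s s' \<longleftrightarrow> (\<exists>m m'. (rel n k ((fpush \<pi> ^^ m) s) ((fpush \<pi> ^^ m') s') \<or> rel n k ((fpush \<pi> ^^ m') s') ((fpush \<pi> ^^ m) s)) \<and>
     (\<forall>l<m. \<not> fpf_reduced (fst ((fpush \<pi> ^^ l) s))) \<and> (\<forall>l<m'. \<not> fpf_reduced (fst ((fpush \<pi> ^^ l) s'))))"

lemma sim_sym: "sim \<pi> n k s s' \<Longrightarrow> sim \<pi> n k s' s"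
  unfolding sim_def by blast

lemma sim_rel: "rel n k s s' \<Longrightarrow> sim \<pi> n k s s'"
  unfolding sim_def by (intro exI[of _ 0]) simp

lemma sim_step:
  assumes "\<not> fpf_reduced (fst s)" "sim \<pi> n k (fpush \<pi> s) s'" shows "sim \<pi> n k s s'"
proof -
  obtain m m' where m: "rel n k ((fpush \<pi> ^^ m) (fpush \<pi> s)) ((fpush \<pi> ^^ m') s') \<or> rel n k ((fpush \<pi> ^^ m') s') ((fpush \<pi> ^^ m) (fpush \<pi> s))"
     "\<forall>l<m. \<not> fpf_reduced (fst ((fpush \<pi> ^^ l) (fpush \<pi> s)))" "\<forall>l<m'. \<not> fpf_reduced (fst ((fpush \<pi> ^^ l) s'))"
    using assms(2) unfolding sim_def by blast
  have "\<not> fpf_reduced (fst ((fpush \<pi> ^^ l) s))" if "l < Suc m" for l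
    using that m(2) assms(1) by (cases l) (simp_all add: funpow_swap1)
  then show ?thesis unfolding sim_def using m(1,3)
    by (intro exI[of _ "Suc m"] exI[of _ m']) (simp add: funpow_swap1)
qed

lemma sim_other_mark:
  assumes "marked \<pi> w i" "marked \<pi> w j" "i \<noteq> j" "sim \<pi> n k (push w j) s'"
  shows "sim \<pi> n k (w, i) s'"
  using assms(4) two_marks_not_reduced(1)[OF assms(1-3)] fpush_flip[OF flip_two_marks[OF assms(1-3)]]
    sim_step[of "(w, i)" \<pi> n k s'] by simp

lemma marked_semi:
  assumes "marked \<pi> w i" "conj_word w = \<pi>" shows "\<not> fpf_reduced w" "fpush \<pi> (w, i) = push w i"
proof -
  show "\<not> fpf_reduced w" using fpf_reduced_min[of w "del_at i w"] assms by (auto simp: marked_iff)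
  have "flip \<pi> w i i" using assms by (simp add: flip_def)
  then show "fpush \<pi> (w, i) = push w i" by (rule fpush_flip)
qed

lemma sim_semi:
  assumes "marked \<pi> w i" "conj_word w = \<pi>" "sim \<pi> n k (push w i) s'"
  shows "sim \<pi> n k (w, i) s'"
  using assms(3) marked_semi[OF assms(1,2)] sim_step[of "(w, i)" \<pi> n k s'] by simp

lemma push_block: "n < length T \<Longrightarrow> push (x @ T @ y) (length x + n) = (x @ T[n := T ! n + 1] @ y, length x + n)"
  by (simp add: push_def nth_append list_update_append)

lemma marked_block:
  assumes "marked \<pi> (x @ T @ y) (length x + i)" "perm_word (del_at i T) = perm_word (del_at j T')"
    "i < length T" "j < length T'" "length T' = length T"
  shows "marked \<pi> (x @ T' @ y) (length x + j)"
  using conj_word_block[OF assms(2), of x y] assms(3-)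
  by (intro marked_transfer[OF assms(1)]) (simp_all add: del_at_append_left)

text \<open>One step back along a run, at a word with two marks. \<open>S\<close> with mark
  \<open>h\<close> is known to be marked; equal permutations after deletion yield the marks
  \<open>i\<close> and \<open>j\<close> of \<open>T\<close>, and the push at \<open>j\<close> turns
  \<open>T\<close> into \<open>U\<close>.\<close>

lemma sim_block:
  assumes "sim \<pi> n k (x @ U @ y, length x + j) s'" "marked \<pi> (x @ S @ y) (length x + h)" "h < length S"
    "length T = length S" "i < length T" "j < length T" "i \<noteq> j" "T[j := T ! j + 1] = U"
    "perm_word (del_at h S) = perm_word (del_at i T)" "perm_word (del_at h S) = perm_word (del_at j T)"
  shows "sim \<pi> n k (x @ T @ y, length x + i) s'"
proof -
  have "marked \<pi> (x @ T @ y) (length x + i)" "marked \<pi> (x @ T @ y) (length x + j)"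
    using assms marked_block[OF assms(2)] by blast+
  then show ?thesis using assms by (intro sim_other_mark[of _ _ _ "length x + j"]) (simp_all add: push_block)
qed

text \<open>One step back at a semi-reduced word, where the mark stays at \<open>i\<close>; the last
  hypothesis expresses semi-reducedness.\<close>

lemma sim_block_semi:
  assumes "sim \<pi> n k (x @ U @ y, length x + i) s'" "marked \<pi> (x @ S @ y) (length x + h)" "h < length S"
    "length T = length S" "i < length T" "T[i := T ! i + 1] = U"
    "perm_word (del_at h S) = perm_word (del_at i T)" "conj_word (x @ T @ y) = conj_word (x @ del_at h S @ y)"
  shows "sim \<pi> n k (x @ T @ y, length x + i) s'"
proof -
  have "marked \<pi> (x @ T @ y) (length x + i)"
    using assms marked_block[OF assms(2)] by blast
  moreover have "conj_word (x @ T @ y) = \<pi>" using assms(2,3,8) by (simp add: marked_iff del_at_append_left)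
  ultimately show ?thesis using assms by (intro sim_semi) (simp_all add: push_block)
qed

lemma sim_local_move:
  assumes "local_move x T T' p q" "j = transpose p q i" "length T = n"
  shows "sim \<pi> n (length x) (x @ T @ y, length x + i) (x @ T' @ y, length x + j)"
  using assms by (intro sim_rel rel_I[OF assms(1)]) (simp_all add: transpose_def)

abbreviation (input) at :: "int list \<Rightarrow> int list \<Rightarrow> int list \<Rightarrow> nat \<Rightarrow> int list \<times> nat" where
  "at x y T i \<equiv> (x @ T @ y, length x + i)"

text \<open>If the raised letter stays clear of the next larger one, the same move applies.
  Otherwise a letter occurs twice in the block; unless this is half of a braid, both occurrences are
  marked and one more push separates them.\<close>

lemma sim_push_bac:
  assumes ab: "a < b" "b < c" and n: "n < length [b, a, c]"
    and m: "marked \<pi> (x @ [b, a, c] @ y) (length x + n)"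
  shows "sim \<pi> 3 (length x) (push (x @ [b, a, c] @ y) (length x + n))
    (push (x @ [b, c, a] @ y) (length x + transpose (Suc 0) (Suc (Suc 0)) n))"
proof -
  consider "n = 0" | "n = Suc 0" | "n = Suc (Suc 0)" using n by (auto simp: less_Suc_eq)
  then show ?thesis
  proof cases
    case 1
    have "sim \<pi> 3 (length x) (at x y [b + 1, a, c] 0) (at x y [b + 1, c, a] 0)"
    proof (cases "b + 1 < c")
      case True
      then show ?thesis using ab by (intro sim_local_move[OF bac_bca]) (simp_all add: transpose_def)
    next
      case False
      then have c: "c = b + 1" using ab by simp
      have com: "perm_word [a, c] = perm_word [c, a]" using ab by (intro perm_word_commute) auto
      \<comment> \<open>Both words contain \<open>c\<close> twice; on either side the mark passes to
        the second \<open>c\<close>, which becomes \<open>c + 1\<close>.\<close>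
      have "sim \<pi> 3 (length x) (at x y [c, a, c + 1] (Suc (Suc 0))) (at x y [c, c + 1, a] (Suc 0))"
        using ab by (intro sim_local_move[OF bac_bca]) (simp_all add: transpose_def)
      then have "sim \<pi> 3 (length x) (at x y [c, a, c] 0) (at x y [c, c + 1, a] (Suc 0))"
        by (rule sim_block[OF _ m[unfolded 1]]) (use com in simp_all)
      then have "sim \<pi> 3 (length x) (at x y [c, c, a] 0) (at x y [c, a, c] 0)"
        by (rule sim_block[OF sim_sym m[unfolded 1]]) (use com in simp_all)
      then show ?thesis unfolding c by (rule sim_sym)
    qed
    then show ?thesis using 1 push_block[of 0 "[b, a, c]" x y] push_block[of 0 "[b, c, a]" x y] by (simp add: transpose_def)
  next
    case 2
    have "sim \<pi> 3 (length x) (at x y [b, a + 1, c] (Suc 0)) (at x y [b, c, a + 1] (Suc (Suc 0)))"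
    proof (cases "a + 1 < b")
      case True
      then show ?thesis using ab by (intro sim_local_move[OF bac_bca]) (simp_all add: transpose_def)
    next
      case False
      then have b: "a + 1 = b" using ab by simp
      have "sim \<pi> 3 (length x) (at x y [b + 1, b, c] 0) (at x y [b, c, b] (Suc (Suc 0)))"
      proof (cases "b + 1 < c")
        case True
        have com: "perm_word [b, c] = perm_word [c, b]" using True by (intro perm_word_commute) auto
        have "sim \<pi> 3 (length x) (at x y [b + 1, b, c] 0) (at x y [b + 1, c, b] 0)"
          using True by (intro sim_local_move[OF bac_bca]) (simp_all add: transpose_def)
        then have "sim \<pi> 3 (length x) (at x y [b, c, b] (Suc (Suc 0))) (at x y [b + 1, b, c] 0)"
          by (rule sim_block[OF sim_sym m[unfolded 2]]) (use com in simp_all)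
        then show ?thesis by (rule sim_sym)
      next
        case False
        then have c: "c = b + 1" using ab by simp
        \<comment> \<open>Here \<open>b, c, b\<close> is half of a braid and needs no further push;
          only \<open>b, b, c\<close> is pushed again.\<close>
        have "sim \<pi> 3 (length x) (at x y [b, b + 1, b] (Suc (Suc 0))) (at x y [b + 1, b, b + 1] 0)"
          by (intro sim_local_move[OF braid]) (simp_all add: transpose_def)
        then show ?thesis unfolding c by (rule sim_sym)
      qed
      then have "sim \<pi> 3 (length x) (at x y [b, b, c] (Suc 0)) (at x y [b, c, b] (Suc (Suc 0)))"
        by (rule sim_block[OF _ m[unfolded 2]]) simp_all
      then show ?thesis unfolding b .
    qed
    then show ?thesis using 2 push_block[of "Suc 0" "[b, a, c]" x y] push_block[of "Suc (Suc 0)" "[b, c, a]" x y]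
      by (simp add: transpose_def)
  next
    case 3
    have "sim \<pi> 3 (length x) (at x y [b, a, c + 1] (Suc (Suc 0))) (at x y [b, c + 1, a] (Suc 0))"
      using ab by (intro sim_local_move[OF bac_bca]) (simp_all add: transpose_def)
    then show ?thesis using 3 push_block[of "Suc (Suc 0)" "[b, a, c]" x y] push_block[of "Suc 0" "[b, c, a]" x y]
      by (simp add: transpose_def)
  qed
qed

lemma sim_push_acb:
  assumes ab: "a < b" "b < c" and n: "n < length [a, c, b]"
    and m: "marked \<pi> (x @ [a, c, b] @ y) (length x + n)"
  shows "sim \<pi> 3 (length x) (push (x @ [a, c, b] @ y) (length x + n))
    (push (x @ [c, a, b] @ y) (length x + transpose 0 (Suc 0) n))"
proof -
  consider "n = 0" | "n = Suc 0" | "n = Suc (Suc 0)" using n by (auto simp: less_Suc_eq)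
  then show ?thesis
  proof cases
    case 1
    have "sim \<pi> 3 (length x) (at x y [a + 1, c, b] 0) (at x y [c, a + 1, b] (Suc 0))"
    proof (cases "a + 1 < b")
      case True
      then show ?thesis using ab by (intro sim_local_move[OF acb_cab]) (simp_all add: transpose_def)
    next
      case False
      then have b: "a + 1 = b" using ab by simp
      have "sim \<pi> 3 (length x) (at x y [b, c, b] 0) (at x y [c, b, b + 1] (Suc (Suc 0)))"
      proof (cases "b + 1 < c")
        case True
        have com: "perm_word [b, c] = perm_word [c, b]" using True by (intro perm_word_commute) auto
        have "sim \<pi> 3 (length x) (at x y [b, c, b + 1] (Suc (Suc 0))) (at x y [c, b, b + 1] (Suc (Suc 0)))"
          using True by (intro sim_local_move[OF acb_cab]) (simp_all add: transpose_def)
        then show ?thesis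
          by (rule sim_block[OF _ m[unfolded 1]]) (use com in simp_all)
      next
        case False
        then have c: "c = b + 1" using ab by simp
        show ?thesis unfolding c
          by (intro sim_local_move[OF braid]) (simp_all add: transpose_def)
      qed
      then have "sim \<pi> 3 (length x) (at x y [c, b, b] (Suc 0)) (at x y [b, c, b] 0)"
        by (rule sim_block[OF sim_sym m[unfolded 1]]) simp_all
      then show ?thesis unfolding b by (rule sim_sym)
    qed
    then show ?thesis using 1 push_block[of 0 "[a, c, b]" x y] push_block[of "Suc 0" "[c, a, b]" x y]
      by (simp add: transpose_def)
  next
    case 2
    have "sim \<pi> 3 (length x) (at x y [a, c + 1, b] (Suc 0)) (at x y [c + 1, a, b] 0)"
      using ab by (intro sim_local_move[OF acb_cab]) (simp_all add: transpose_def)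
    then show ?thesis using 2 push_block[of "Suc 0" "[a, c, b]" x y] push_block[of 0 "[c, a, b]" x y]
      by (simp add: transpose_def)
  next
    case 3
    have "sim \<pi> 3 (length x) (at x y [a, c, b + 1] (Suc (Suc 0))) (at x y [c, a, b + 1] (Suc (Suc 0)))"
    proof (cases "b + 1 < c")
      case True
      then show ?thesis using ab by (intro sim_local_move[OF acb_cab]) (simp_all add: transpose_def)
    next
      case False
      then have c: "c = b + 1" using ab by simp
      have com: "perm_word [a, c] = perm_word [c, a]" using ab by (intro perm_word_commute) auto
      have "sim \<pi> 3 (length x) (at x y [a, c + 1, c] (Suc 0)) (at x y [c + 1, a, c] 0)"
        using ab by (intro sim_local_move[OF acb_cab]) (simp_all add: transpose_def)
      then have "sim \<pi> 3 (length x) (at x y [a, c, c] (Suc (Suc 0))) (at x y [c + 1, a, c] 0)"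
        by (rule sim_block[OF _ m[unfolded 3]]) simp_all
      then have "sim \<pi> 3 (length x) (at x y [c, a, c] (Suc (Suc 0))) (at x y [a, c, c] (Suc (Suc 0)))"
        by (rule sim_block[OF sim_sym m[unfolded 3]]) (use com in simp_all)
      then show ?thesis unfolding c by (rule sim_sym)
    qed
    then show ?thesis using 3 push_block[of "Suc (Suc 0)" "[a, c, b]" x y] push_block[of "Suc (Suc 0)" "[c, a, b]" x y]
      by (simp add: transpose_def)
  qed
qed

text \<open>Raising an outer letter makes two neighbours on the left-hand side equal, and one more
  push there leads to a commutation with the letters \<open>b, b + 1, b + 2\<close>. The middle
  letter cannot be marked, as its deletion leaves a square.\<close>

lemma sim_push_braid:
  assumes n: "n < length [b, b + 1, b]"
    and m: "marked \<pi> (x @ [b, b + 1, b] @ y) (length x + n)"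
  shows "sim \<pi> 3 (length x) (push (x @ [b, b + 1, b] @ y) (length x + n))
    (push (x @ [b + 1, b, b + 1] @ y) (length x + transpose 0 (Suc (Suc 0)) n))"
proof -
  consider "n = 0" | "n = Suc 0" | "n = Suc (Suc 0)" using n by (auto simp: less_Suc_eq)
  then show ?thesis
  proof cases
    case 1
    have "sim \<pi> 3 (length x) (at x y [b + 1, b, b + 2] (Suc (Suc 0))) (at x y [b + 1, b + 2, b] (Suc 0))"
      by (intro sim_local_move[OF bac_bca]) (simp_all add: transpose_def)
    then have "sim \<pi> 3 (length x) (at x y [b + 1, b + 1, b] 0) (at x y [b + 1, b, b + 2] (Suc (Suc 0)))"
      by (rule sim_block[OF sim_sym m[unfolded 1]]) simp_all
    then show ?thesis using 1 push_block[of 0 "[b, b + 1, b]" x y] push_block[of "Suc (Suc 0)" "[b + 1, b, b + 1]" x y]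
      by (simp add: transpose_def add.commute)
  next
    case 2
    have "del_at (length x + Suc 0) (x @ [b, b + 1, b] @ y) = x @ b # b # y" unfolding del_at_append by simp
    then show ?thesis using m[unfolded 2] not_fpf_reduced_square by (metis marked_iff)
  next
    case 3
    have "sim \<pi> 3 (length x) (at x y [b, b + 2, b + 1] (Suc 0)) (at x y [b + 2, b, b + 1] 0)"
      by (intro sim_local_move[OF acb_cab]) (simp_all add: transpose_def)
    then have "sim \<pi> 3 (length x) (at x y [b, b + 1, b + 1] (Suc (Suc 0))) (at x y [b + 2, b, b + 1] 0)"
      by (rule sim_block[OF _ m[unfolded 3]]) simp_all
    then show ?thesis using 3 push_block[of "Suc (Suc 0)" "[b, b + 1, b]" x y] push_block[of 0 "[b + 1, b, b + 1]" x y]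
      by (simp add: transpose_def add.commute)
  qed
qed

lemma conj_word_odd_Cons: "odd c \<Longrightarrow> conj_word (c # y) = conj_word y"
proof -
  assume "odd c"
  then have "sZ c \<circ> fpf1 \<circ> sZ c = fpf1" by (intro sZ_conj_fixed) (simp_all add: fpf_inv_def fpf1_def)
  then have "conj_word [c] = conj_word []" using conj_word_snoc[of "[]" c] by simp
  then show ?thesis using conj_word_append[of "[c]" y] conj_word_append[of "[]" y] by simp
qed

text \<open>The raised letter becomes odd. If it can be moved to the front it acts trivially there,
  so the word is semi-reduced and the same letter is pushed again, to the next even number. Only if
  \<open>b = a + 2\<close> does it meet the other letter.\<close>

lemma sim_push_initial_swap:
  assumes ab: "even a" "even b" "a < b" and n: "n < length [a, b]"
    and m: "marked \<pi> ([] @ [a, b] @ y) (length ([] :: int list) + n)"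
  shows "sim \<pi> 2 0 (push ([] @ [a, b] @ y) n) (push ([] @ [b, a] @ y) (transpose 0 (Suc 0) n))"
proof -
  have conj2: "conj_word ([] @ [e, c] @ y) = conj_word ([] @ [e] @ y)" if "odd c" "c + 1 < e \<or> e + 1 < c" for c e
  proof -
    have "conj_word ([] @ [e, c] @ y) = conj_word ([] @ [c, e] @ y)"
      using that(2) by (intro conj_word_block perm_word_commute) auto
    then show ?thesis using conj_word_odd_Cons[OF that(1)] by simp
  qed
  consider "n = 0" | "n = Suc 0" using n by (auto simp: less_Suc_eq)
  then show ?thesis
  proof cases
    case 1
    have "sim \<pi> 2 (length ([] :: int list)) (at [] y [a + 1, b] 0) (at [] y [b, a + 1] (Suc 0))"
    proof (cases "a + 2 = b")
      case True
      \<comment> \<open>The left word runs through \<open>b, b\<close> to \<open>b, b + 1\<close>,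
        whose partner under \<open>initial_step\<close> is the right word \<open>b, b - 1\<close> as
        it stands.\<close>
      have "sim \<pi> 2 (length ([] :: int list)) (at [] y [b, b + 1] (Suc 0)) (at [] y [b, b - 1] (Suc 0))"
        using ab by (intro sim_local_move[OF initial_step]) (simp_all add: transpose_def)
      then have "sim \<pi> 2 (length ([] :: int list)) (at [] y [b, b] 0) (at [] y [b, b - 1] (Suc 0))"
        by (rule sim_block[OF _ m[unfolded 1]]) simp_all
      then have "sim \<pi> 2 (length ([] :: int list)) (at [] y [a + 1, b] 0) (at [] y [b, b - 1] (Suc 0))"
        by (rule sim_block_semi[OF _ m[unfolded 1]]) (use ab True conj_word_odd_Cons[of "a + 1"] in simp_all)
      moreover have "b - 1 = a + 1" using True by simp
      ultimately show ?thesis by simp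
    next
      case False
      then have lt: "a + 2 < b" using ab by presburger
      have "sim \<pi> 2 (length ([] :: int list)) (at [] y [a + 2, b] 0) (at [] y [b, a + 2] (Suc 0))"
        using ab lt by (intro sim_local_move[OF initial_swap]) (simp_all add: transpose_def)
      then have "sim \<pi> 2 (length ([] :: int list)) (at [] y [a + 1, b] 0) (at [] y [b, a + 2] (Suc 0))"
        by (rule sim_block_semi[OF _ m[unfolded 1]]) (use ab conj_word_odd_Cons[of "a + 1"] in simp_all)
      then have "sim \<pi> 2 (length ([] :: int list)) (at [] y [b, a + 1] (Suc 0)) (at [] y [a + 1, b] 0)"
        by (rule sim_block_semi[OF sim_sym m[unfolded 1]]) (use ab lt conj2[of "a + 1" b] in simp_all)
      then show ?thesis by (rule sim_sym)
    qed
    then show ?thesis using 1 push_block[of 0 "[a, b]" "[]" y] push_block[of "Suc 0" "[b, a]" "[]" y]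
      by (simp add: transpose_def)
  next
    case 2
    have lt: "a + 1 < b" using ab by presburger
    have "sim \<pi> 2 (length ([] :: int list)) (at [] y [a, b + 2] (Suc 0)) (at [] y [b + 2, a] 0)"
      using ab by (intro sim_local_move[OF initial_swap]) (simp_all add: transpose_def)
    then have "sim \<pi> 2 (length ([] :: int list)) (at [] y [a, b + 1] (Suc 0)) (at [] y [b + 2, a] 0)"
      by (rule sim_block_semi[OF _ m[unfolded 2]]) (use ab lt conj2[of "b + 1" a] in simp_all)
    then have "sim \<pi> 2 (length ([] :: int list)) (at [] y [b + 1, a] 0) (at [] y [a, b + 1] (Suc 0))"
      by (rule sim_block_semi[OF sim_sym m[unfolded 2]]) (use ab conj_word_odd_Cons[of "b + 1"] in simp_all)
    then show ?thesis using 2 sim_sym push_block[of "Suc 0" "[a, b]" "[]" y] push_block[of 0 "[b, a]" "[]" y]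
      by (simp add: transpose_def)
  qed
qed

text \<open>One push on the left matches three on the right, where \<open>b, b - 1\<close> passes
  through \<open>b, b\<close> and the semi-reduced \<open>b + 1, b\<close> to
  \<open>b + 2, b\<close>. The first letter cannot be marked, as its deletion leaves an odd first
  letter.\<close>

lemma sim_push_initial_step:
  assumes b: "even b" and n: "n < length [b, b + 1]"
    and m: "marked \<pi> ([] @ [b, b + 1] @ y) (length ([] :: int list) + n)"
  shows "sim \<pi> 2 0 (push ([] @ [b, b + 1] @ y) n) (push ([] @ [b, b - 1] @ y) n)"
proof -
  consider "n = 0" | "n = Suc 0" using n by (auto simp: less_Suc_eq)
  then show ?thesis
  proof cases
    case 1
    then show ?thesis using m b fpf_reduced_hd_even[of "b + 1" y] by (simp add: marked_iff)
  next
    case 2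
    have "sim \<pi> 2 (length ([] :: int list)) (at [] y [b, b + 2] (Suc 0)) (at [] y [b + 2, b] 0)"
      using b by (intro sim_local_move[OF initial_swap]) (simp_all add: transpose_def)
    then have "sim \<pi> 2 (length ([] :: int list)) (at [] y [b + 1, b] 0) (at [] y [b, b + 2] (Suc 0))"
      by (rule sim_block_semi[OF sim_sym m[unfolded 2]]) (use b conj_word_odd_Cons[of "b + 1"] in simp_all)
    then have "sim \<pi> 2 (length ([] :: int list)) (at [] y [b, b] (Suc 0)) (at [] y [b, b + 2] (Suc 0))"
      by (rule sim_block[OF _ m[unfolded 2]]) simp_all
    then show ?thesis using 2 sim_sym push_block[of "Suc 0" "[b, b + 1]" "[]" y] push_block[of "Suc 0" "[b, b - 1]" "[]" y]
      by (simp add: add.commute)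
  qed
qed

lemma sim_push:
  assumes mv: "local_move x T T' p q" and m: "marked \<pi> (x @ T @ y) j"
  shows "sim \<pi> (length T) (length x) (push (x @ T @ y) j)
    (push (x @ T' @ y) (transpose (length x + p) (length x + q) j))"
proof -
  have len: "length T' = length T" "p < length T" "q < length T" using local_move_length[OF mv] by auto
  consider "j < length x" | n where "j = length x + n" "n < length T"
    | n where "j = length x + (length T + n)"
    by (metis add_less_imp_less_left le_Suc_ex linorder_not_less)
  then show ?thesis
  proof cases
    case 1
    then have t: "transpose (length x + p) (length x + q) j = j" by (simp add: transpose_def)
    have "local_move (x[j := x ! j + 1]) T T' p q"
      using mv 1 by cases (auto intro: local_move.intros)
    then have "rel (length T) (length x) (x[j := x ! j + 1] @ T @ y, j) (x[j := x ! j + 1] @ T' @ y, j)"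
      by (rule rel_I) (simp_all add: t)
    then show ?thesis unfolding t using 1 by (intro sim_rel) (simp add: push_def nth_append list_update_append)
  next
    case (3 n)
    then have t: "transpose (length x + p) (length x + q) j = j" using len by (simp add: transpose_def)
    have "rel (length T) (length x) (x @ T @ y[n := y ! n + 1], j) (x @ T' @ y[n := y ! n + 1], j)"
      using mv by (rule rel_I) (simp_all add: t)
    then show ?thesis unfolding t using 3 len
      by (intro sim_rel) (simp add: push_def nth_append list_update_append)
  next
    case (2 n)
    have t: "transpose (length x + p) (length x + q) j = length x + transpose p q n"
      using 2 by (simp add: transpose_def)
    have m2: "marked \<pi> (x @ T @ y) (length x + n)" using m 2 by simp
    have "sim \<pi> (length T) (length x) (push (x @ T @ y) (length x + n)) (push (x @ T' @ y) (length x + transpose p q n))"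
      using mv
    proof cases
      case (bac_bca a b c)
      then show ?thesis using sim_push_bac[of a b c n \<pi> x y] m2 2(2) by (simp add: numeral_3_eq_3)
    next
      case (acb_cab a b c)
      then show ?thesis using sim_push_acb[of a b c n \<pi> x y] m2 2(2) by (simp add: numeral_3_eq_3)
    next
      case (braid b)
      then show ?thesis using sim_push_braid[of n b \<pi> x y] m2 2(2) by (simp add: numeral_3_eq_3)
    next
      case (initial_swap a b)
      then show ?thesis using sim_push_initial_swap[of a b n \<pi> y] m2 2(2) by (simp add: numeral_2_eq_2)
    next
      case (initial_step b)
      then show ?thesis using sim_push_initial_step[of b n \<pi> y] m2 2(2) by (simp add: numeral_2_eq_2)
    qed
    then show ?thesis unfolding t unfolding 2(1) .
  qed
qed

section \<open>From single pushes to whole bumps\<close>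

definition rel_sym :: "nat \<Rightarrow> nat \<Rightarrow> int list \<times> nat \<Rightarrow> int list \<times> nat \<Rightarrow> bool" where
  "rel_sym n k s s' \<longleftrightarrow> rel n k s s' \<or> rel n k s' s"

lemma rel_states:
  assumes "rel n k s s'" shows "s \<in> states \<pi> \<longleftrightarrow> s' \<in> states \<pi>"
proof -
  obtain x T T' y p q where r: "length x = k" "fst s = x @ T @ y" "fst s' = x @ T' @ y"
     "local_move x T T' p q" "snd s' = transpose (k + p) (k + q) (snd s)"
    using assms unfolding rel_def by blast
  then show ?thesis using local_move_marked[OF r(4), of \<pi> y "snd s"] by (cases s; cases s') (simp add: states_def)
qed

lemma rel_fpf_reduced:
  assumes "rel n k s s'" shows "fpf_reduced (fst s) \<longleftrightarrow> fpf_reduced (fst s')" "conj_word (fst s) = conj_word (fst s')"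
proof -
  obtain x T T' y p q where r: "fst s = x @ T @ y" "fst s' = x @ T' @ y" "local_move x T T' p q"
    using assms unfolding rel_def by blast
  then show "conj_word (fst s) = conj_word (fst s')" using conj_word_local_move by simp
  moreover have "length (fst s) = length (fst s')" using r local_move_length by simp
  ultimately show "fpf_reduced (fst s) \<longleftrightarrow> fpf_reduced (fst s')" using fpf_reduced_cong by (metis order_refl)
qed

lemma rel_fpush:
  assumes rel: "rel n k s s'" and s: "s \<in> states \<pi>"
  shows "sim \<pi> n k (fpush \<pi> s) (fpush \<pi> s')"
proof -
  obtain x T T' y p q where r: "length x = k" "length T = n" "fst s = x @ T @ y" "fst s' = x @ T' @ y"
     "local_move x T T' p q" "snd s' = transpose (k + p) (k + q) (snd s)"
    using rel unfolding rel_def by blast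
  let ?w = "x @ T @ y" and ?w' = "x @ T' @ y" and ?t = "transpose (k + p) (k + q)"
  have s2: "s = (?w, snd s)" "s' = (?w', ?t (snd s))" using r by (metis prod.collapse)+
  obtain j where j: "flip \<pi> ?w (snd s) j" "fpush \<pi> s = push ?w j"
    using s s2(1) fpush_cases by metis
  have mk: "marked \<pi> ?w i \<longleftrightarrow> marked \<pi> ?w' (?t i)" for i using local_move_marked[OF r(5), of \<pi> y i] r(1) by simp
  have "?t a = ?t b \<longleftrightarrow> a = b" for a b by (metis transpose_involutory)
  then have "flip \<pi> ?w' (?t (snd s)) (?t j)"
    using j(1) rel_fpf_reduced[OF rel] r(3,4) unfolding flip_def by (auto simp: mk)
  then have "fpush \<pi> s' = push ?w' (?t j)" using s2(2) fpush_flip by metis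
  moreover have "marked \<pi> ?w j" using j(1) by (simp add: flip_def)
  ultimately show ?thesis using sim_push[OF r(5)] j(2) r(1,2) by metis
qed

lemma rel_sym_fpush:
  assumes "rel_sym n k s s'" "s \<in> states \<pi>"
  shows "sim \<pi> n k (fpush \<pi> s) (fpush \<pi> s')"
  using assms rel_fpush rel_states sim_sym unfolding rel_sym_def by metis

text \<open>Induction on the number of pushes from \<open>s\<close>. After its first push each run
  reaches a related state without passing a reduced word, and related words are reduced together. So
  both bumps end there, or both continue with fewer pushes left on the side of
  \<open>s\<close>.\<close>

lemma bump_rel_sym:
  assumes "rel_sym n k s s'" "s \<in> states \<pi>" "bump \<pi> s t"
  shows "\<exists>t'. bump \<pi> s' t' \<and> rel_sym n k t t'"
proof -
  obtain N where "0 < N" "(fpush \<pi> ^^ N) s = t" "fpf_reduced (fst t)"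
    "\<forall>M. 0 < M \<and> M < N \<longrightarrow> \<not> fpf_reduced (fst ((fpush \<pi> ^^ M) s))"
    using assms(3) unfolding bump_def by blast
  then show ?thesis using assms(1,2)
  proof (induction N arbitrary: s s' rule: less_induct)
    case (less N)
    obtain m m' where m: "rel_sym n k ((fpush \<pi> ^^ m) (fpush \<pi> s)) ((fpush \<pi> ^^ m') (fpush \<pi> s'))"
       "\<forall>l<m. \<not> fpf_reduced (fst ((fpush \<pi> ^^ l) (fpush \<pi> s)))" "\<forall>l<m'. \<not> fpf_reduced (fst ((fpush \<pi> ^^ l) (fpush \<pi> s')))"
      using rel_sym_fpush[OF less.prems(5,6)] unfolding sim_def rel_sym_def by blast
    let ?s = "(fpush \<pi> ^^ Suc m) s" and ?s' = "(fpush \<pi> ^^ Suc m') s'"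
    have r: "rel_sym n k ?s ?s'" using m(1) by (simp add: funpow_swap1)
    have nr: "\<not> fpf_reduced (fst ((fpush \<pi> ^^ l) s))" if "0 < l" "l < Suc m" for l
      using that m(2) by (cases l) (simp_all add: funpow_swap1)
    have nr': "\<not> fpf_reduced (fst ((fpush \<pi> ^^ l) s'))" if "0 < l" "l < Suc m'" for l
      using that m(3) by (cases l) (simp_all add: funpow_swap1)
    have red: "fpf_reduced (fst ?s) \<longleftrightarrow> fpf_reduced (fst ?s')"
      using r rel_fpf_reduced(1)[of n k ?s ?s'] rel_fpf_reduced(1)[of n k ?s' ?s] unfolding rel_sym_def by blast
    have "Suc m \<le> N" using nr[of N] less.prems(1-3) by (metis linorder_not_less)
    then consider "N = Suc m" | "Suc m < N" by linarith
    then show ?case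
    proof cases
      case 1
      then have "bump \<pi> s' ?s'" unfolding bump_def using red less.prems(2,3) nr' by blast
      then show ?thesis using r less.prems(2) 1 by metis
    next
      case 2
      have shift: "(fpush \<pi> ^^ L) ?s = (fpush \<pi> ^^ (L + Suc m)) s" for L by (simp only: funpow_add comp_apply)
      have shift': "(fpush \<pi> ^^ L) ?s' = (fpush \<pi> ^^ (L + Suc m')) s'" for L by (simp only: funpow_add comp_apply)
      have "\<exists>t'. bump \<pi> ?s' t' \<and> rel_sym n k t t'"
      proof (rule less.IH[of "N - Suc m" ?s ?s'])
        show "(fpush \<pi> ^^ (N - Suc m)) ?s = t" unfolding shift using 2 less.prems(2) by simp
        show "\<forall>M. 0 < M \<and> M < N - Suc m \<longrightarrow> \<not> fpf_reduced (fst ((fpush \<pi> ^^ M) ?s))"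
        proof (intro allI impI)
          fix M assume "0 < M \<and> M < N - Suc m"
          then have "0 < M + Suc m \<and> M + Suc m < N" by auto
          then show "\<not> fpf_reduced (fst ((fpush \<pi> ^^ M) ?s))" unfolding shift using less.prems(4) by blast
        qed
        show "?s \<in> states \<pi>" using less.prems(6) by (rule fpush_pow_states)
      qed (use 2 r less.prems in auto)
      then obtain t' where t': "bump \<pi> ?s' t'" "rel_sym n k t t'" by blast
      obtain L where L: "0 < L" "(fpush \<pi> ^^ L) ?s' = t'" "fpf_reduced (fst t')"
        "\<forall>M. 0 < M \<and> M < L \<longrightarrow> \<not> fpf_reduced (fst ((fpush \<pi> ^^ M) ?s'))"
        using t'(1) unfolding bump_def by blast
      have ns': "\<not> fpf_reduced (fst ?s')" using red less.prems(4) 2 by blast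
      have "\<not> fpf_reduced (fst ((fpush \<pi> ^^ M) s'))" if "0 < M" "M < L + Suc m'" for M
      proof -
        consider "M < Suc m'" | "M = Suc m'" | "Suc m' < M" by linarith
        then show ?thesis
        proof cases
          case 3
          then have "M = (M - Suc m') + Suc m'" by simp
          moreover have "\<not> fpf_reduced (fst ((fpush \<pi> ^^ (M - Suc m')) ?s'))" using L(4) 3 that(2) by auto
          ultimately show ?thesis unfolding shift' by metis
        qed (use nr' that ns' in auto)
      qed
      then have "bump \<pi> s' t'" unfolding bump_def using L(1,2,3) unfolding shift' by (metis add_gr_0)
      then show ?thesis using t'(2) by blast
    qed
  qed
qed

inductive moves :: "nat \<Rightarrow> nat \<Rightarrow> int list \<Rightarrow> int list \<Rightarrow> bool" for n k where
  moves_I: "local_move x T T' p q \<or> local_move x T' T p q \<Longrightarrow> length x = k \<Longrightarrow> length T = n \<Longrightarrow>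
    moves n k (x @ T @ y) (x @ T' @ y)"

lemma moves_E:
  assumes "moves n k w w'"
  obtains x T T' y p q where "length x = k" "length T = n" "w = x @ T @ y" "w' = x @ T' @ y"
    "local_move x T T' p q \<or> local_move x T' T p q"
  using assms
proof (cases rule: moves.cases)
  case (moves_I x T T' p q y)
  show ?thesis by (rule that[of x T y T' p q]) (fact moves_I)+
qed

lemma moves_rel_sym:
  assumes "moves n k w w'"
  shows "\<exists>t. (\<forall>i. rel_sym n k (w, i) (w', t i)) \<and> (\<forall>i. marked \<pi> w i \<longleftrightarrow> marked \<pi> w' (t i)) \<and> (\<forall>i. t (t i) = i)"
proof -
  obtain x T T' y p q where r: "length x = k" "length T = n" "w = x @ T @ y" "w' = x @ T' @ y"
    "local_move x T T' p q \<or> local_move x T' T p q"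
    using assms by (rule moves_E)
  let ?t = "transpose (k + p) (k + q)"
  from r(5) show ?thesis
  proof
    assume mv: "local_move x T T' p q"
    have "rel n k (w, i) (w', ?t i)" for i
      unfolding r(3,4) by (rule rel_I[OF mv]) (use r(1,2) in simp_all)
    then have "rel_sym n k (w, i) (w', ?t i)" for i unfolding rel_sym_def by blast
    moreover have "marked \<pi> w i \<longleftrightarrow> marked \<pi> w' (?t i)" for i using local_move_marked[OF mv, of \<pi> y i] r(1,3,4) by simp
    ultimately show ?thesis by (intro exI[of _ ?t]) simp
  next
    assume mv: "local_move x T' T p q"
    have len: "length T' = n" using local_move_length[OF mv] r(2) by simp
    have "rel n k (w', ?t i) (w, i)" for i
      unfolding r(3,4) by (rule rel_I[OF mv]) (use r(1) len in simp_all)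
    then have "rel_sym n k (w, i) (w', ?t i)" for i unfolding rel_sym_def by blast
    moreover have "marked \<pi> w i \<longleftrightarrow> marked \<pi> w' (?t i)" for i
      using local_move_marked[OF mv, of \<pi> y "?t i"] r(1,3,4) by simp
    ultimately show ?thesis by (intro exI[of _ ?t]) simp
  qed
qed

lemma rel_sym_moves:
  assumes "rel_sym n k s s'" shows "moves n k (fst s) (fst s')"
proof -
  have "moves n k (fst t) (fst t') \<and> moves n k (fst t') (fst t)" if rel: "rel n k t t'" for t t'
  proof -
    obtain x T T' y p q where r: "length x = k" "length T = n" "fst t = x @ T @ y" "fst t' = x @ T' @ y"
      "local_move x T T' p q"
      using rel unfolding rel_def by blast
    have "length T' = n" using local_move_length[OF r(5)] r(2) by simp
    then show ?thesis unfolding r(3,4) using r(1,2,5) moves_I[of x T T' p q k n y] moves_I[of x T' T p q k n y] by simp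
  qed
  then show ?thesis using assms unfolding rel_sym_def by metis
qed

lemma moves_fpf_reduced:
  assumes "moves n k w w'" shows "fpf_reduced w \<longleftrightarrow> fpf_reduced w'"
proof -
  obtain j where "rel_sym n k (w, 0) (w', j)" using moves_rel_sym[OF assms, of fpf1] by blast
  then show ?thesis using rel_fpf_reduced(1)[of n k "(w, 0)" "(w', j)"] rel_fpf_reduced(1)[of n k "(w', j)" "(w, 0)"]
    unfolding rel_sym_def by auto
qed

text \<open>The matching of positions takes the mark of \<open>w\<close> to that of
  \<open>w'\<close>, so the two bumps start in related states; words without marks are
  fixed.\<close>

lemma fb_moves:
  assumes mv: "moves n k w w'" and w: "fpf_reduced w"
  shows "moves n k (fb \<pi> w) (fb \<pi> w')"
proof -
  obtain t where t: "\<And>i. rel_sym n k (w, i) (w', t i)" "\<And>i. marked \<pi> w i \<longleftrightarrow> marked \<pi> w' (t i)" "\<And>i. t (t i) = i"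
    using moves_rel_sym[OF mv, of \<pi>] by metis
  have w': "fpf_reduced w'" using moves_fpf_reduced[OF mv] w by blast
  show ?thesis
  proof (cases rule: fb_cases[OF w, of \<pi>])
    case (1 i j)
    obtain s where s: "bump \<pi> (w', t i) s" "rel_sym n k (fb \<pi> w, j) s"
      using bump_rel_sym[OF t(1) _ 1(3)] 1(1) by (auto simp: states_def)
    obtain j' where "bump \<pi> (w', t i) (fb \<pi> w', j')" using fb_bump[OF w'] 1(1) t(2) by blast
    then have "s = (fb \<pi> w', j')" using s(1) bump_unique by blast
    then show ?thesis using rel_sym_moves[OF s(2)] by simp
  next
    case 2
    then have "\<not> (\<exists>i. marked \<pi> w' i)" using t(2,3) by metis
    then show ?thesis using 2 mv fb_unmarked by simp
  qed
qed

section \<open>Coxeter--Knuth operators\<close>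

text \<open>As a total function, fixing words to which no move applies, a move can be composed with
  others at prescribed positions.\<close>

fun ck3 :: "int list \<Rightarrow> int list" where
  "ck3 (x # y # z # w) =
    (if y < x \<and> x < z \<or> z < x \<and> x < y then x # z # y # w
     else if x < z \<and> z < y \<or> y < z \<and> z < x then y # x # z # w
     else if x = z \<and> (y = x + 1 \<or> x = y + 1) then y # x # y # w
     else x # y # z # w)"
| "ck3 w = w"

definition ck :: "nat \<Rightarrow> int list \<Rightarrow> int list" where
  "ck k w = take k w @ ck3 (drop k w)"

text \<open>The two moves on the first two letters. In a reduced word the first letter is even, and
  the second one is even unless it is adjacent to the first.\<close>

fun d0 :: "int list \<Rightarrow> int list" where
  "d0 (a # b # w) = (if b = a + 1 then a # (a - 1) # w else if b = a - 1 then a # (a + 1) # w else b # a # w)"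
| "d0 w = w"

lemma ck_append: "ck (length x) (x @ w) = x @ ck3 w"
  by (simp add: ck_def)

lemma moves_ck:
  assumes "moves 3 k w w'" shows "ck k w = w'"
proof -
  obtain x T T' y p q where r: "length x = k" "length T = 3" "w = x @ T @ y" "w' = x @ T' @ y"
    "local_move x T T' p q \<or> local_move x T' T p q"
    using assms by (rule moves_E)
  have "ck3 (S @ y) = S' @ y \<and> ck3 (S' @ y) = S @ y" if "local_move x S S' p q" "length S = 3" for S S'
    using that by (cases rule: local_move.cases) auto
  then have "ck3 (T @ y) = T' @ y" using r(2,5) local_move_length by metis
  then show ?thesis using r(1,3,4) ck_append[of x "T @ y"] by simp
qed

lemma moves_d0:
  assumes "moves 2 0 w w'" shows "d0 w = w'"
proof -
  obtain x T T' y p q where r: "length x = 0" "length T = 2" "w = x @ T @ y" "w' = x @ T' @ y"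
    "local_move x T T' p q \<or> local_move x T' T p q"
    using assms by (rule moves_E)
  have "d0 (S @ y) = S' @ y \<and> d0 (S' @ y) = S @ y" if "local_move x S S' p q" "length S = 2" for S S'
    using that by (cases rule: local_move.cases) auto
  then have "d0 (T @ y) = T' @ y" using r(2,5) local_move_length by metis
  then show ?thesis using r(1,3,4) by simp
qed

text \<open>For letters that differ from their neighbours: the middle one is a peak or a valley. In
  a reduced word this decides whether a move applies, and it depends only on descents, which bumps
  preserve.\<close>

definition bent :: "nat \<Rightarrow> int list \<Rightarrow> bool" where
  "bent k w \<longleftrightarrow> Suc (Suc k) < length w \<and> (w ! k < w ! Suc k \<longleftrightarrow> \<not> w ! Suc k < w ! Suc (Suc k))"

lemma split_three:
  assumes "Suc (Suc k) < length w"
  shows "w = take k w @ [w ! k, w ! Suc k, w ! Suc (Suc k)] @ drop (Suc (Suc (Suc k))) w"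
  using assms by (metis Cons_nth_drop_Suc Suc_lessD append_Cons append_Nil id_take_nth_drop)

lemma ck_not_bent:
  assumes "\<not> bent k w" shows "ck k w = w"
proof (cases "Suc (Suc k) < length w")
  case True
  let ?a = "w ! k" and ?b = "w ! Suc k" and ?c = "w ! Suc (Suc k)"
  have d: "drop k w = ?a # ?b # ?c # drop (Suc (Suc (Suc k))) w"
    using True by (simp add: Cons_nth_drop_Suc)
  have "?a < ?b \<longleftrightarrow> ?b < ?c" using assms True by (auto simp: bent_def)
  then have "ck3 (drop k w) = drop k w" unfolding d by auto
  then show ?thesis by (simp add: ck_def)
next
  case False
  then have "length (drop k w) \<le> 2" by simp
  then have "ck3 (drop k w) = drop k w"
    by (cases "drop k w" rule: ck3.cases) auto
  then show ?thesis by (simp add: ck_def)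
qed

text \<open>Letters that are not adjacent integers commute, which would create a square. Hence every
  bent triple of a reduced word is a side of some move.\<close>

lemma fpf_reduced_sandwich:
  assumes "fpf_reduced (x @ [a, b, a] @ y)" shows "b = a + 1 \<or> a = b + 1"
proof (rule ccontr)
  assume n: "\<not> ?thesis"
  have "a \<noteq> b" using assms not_fpf_reduced_square[of x a] by auto
  then have "perm_word [a, b] = perm_word [b, a]" using n by (intro perm_word_commute) auto
  then have "conj_word (x @ [a, b] @ (a # y)) = conj_word (x @ [b, a] @ (a # y))" by (rule conj_word_block)
  then have "fpf_reduced (x @ [b, a] @ (a # y))" using fpf_reduced_cong[OF assms, of "x @ [b, a] @ (a # y)"] by simp
  then show False using not_fpf_reduced_square[of "x @ [b]" a y] by simp
qed

lemma ck_bent: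
  assumes w: "fpf_reduced w" and bent: "bent k w" shows "moves 3 k w (ck k w)"
proof -
  let ?X = "take k w" and ?a = "w ! k" and ?b = "w ! Suc k" and ?c = "w ! Suc (Suc k)" and ?Y = "drop (Suc (Suc (Suc k))) w"
  have l: "Suc (Suc k) < length w" using bent by (simp add: bent_def)
  have sp: "w = ?X @ [?a, ?b, ?c] @ ?Y" using l by (rule split_three)
  have X: "length ?X = k" using l by simp
  have ne: "?a \<noteq> ?b" "?b \<noteq> ?c" using fpf_reduced_adjacent[OF w] l by auto
  have sw: "?a = ?c \<Longrightarrow> ?b = ?a + 1 \<or> ?a = ?b + 1"
    using w sp fpf_reduced_sandwich[of ?X ?a ?b ?Y] by metis
  have mv: "\<exists>T' p q. local_move ?X [?a, ?b, ?c] T' p q \<or> local_move ?X T' [?a, ?b, ?c] p q"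
  proof (cases "?a < ?b")
    case True
    then have cb: "?c < ?b" using bent ne by (auto simp: bent_def)
    consider "?a < ?c" | "?c < ?a" | "?a = ?c" by linarith
    then show ?thesis
    proof cases
      case 1
      then show ?thesis using acb_cab[of ?a ?c ?b ?X] cb by blast
    next
      case 2
      then show ?thesis using bac_bca[of ?c ?a ?b ?X] True by blast
    next
      case 3
      then have e: "?b = ?a + 1" using sw True by simp
      show ?thesis using braid[of ?X ?a] unfolding e 3[symmetric] by blast
    qed
  next
    case False
    then have ba: "?b < ?a" and bc: "?b < ?c" using bent ne by (auto simp: bent_def)
    consider "?a < ?c" | "?c < ?a" | "?a = ?c" by linarith
    then show ?thesis
    proof cases
      case 1
      then show ?thesis using bac_bca[of ?b ?a ?c ?X] ba by blast
    next
      case 2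
      then show ?thesis using acb_cab[of ?b ?c ?a ?X] bc by blast
    next
      case 3
      then have e: "?a = ?b + 1" using sw ba by simp
      show ?thesis using braid[of ?X ?b] unfolding 3[symmetric] e by blast
    qed
  qed
  then obtain T' where "moves 3 k (?X @ [?a, ?b, ?c] @ ?Y) (?X @ T' @ ?Y)"
    using moves_I[OF _ X, of "[?a, ?b, ?c]" _ _ _ 3 ?Y] by (metis length_Cons list.size(3) numeral_3_eq_3)
  then have "moves 3 k w (?X @ T' @ ?Y)" using sp by simp
  then show ?thesis using moves_ck by metis
qed

text \<open>A second letter not adjacent to the first one commutes with it, so it could come first
  and must be even.\<close>

lemma d0_moves:
  assumes w: "fpf_reduced (a # b # y)" shows "moves 2 0 (a # b # y) (d0 (a # b # y))"
proof -
  have a: "even a" using w by (rule fpf_reduced_hd_even)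
  have ne: "a \<noteq> b" using w not_fpf_reduced_square[of "[]" a] by auto
  have "\<exists>T' p q. local_move [] [a, b] T' p q \<or> local_move [] T' [a, b] p q"
  proof (cases "b = a + 1 \<or> b = a - 1")
    case True
    then show ?thesis using initial_step[OF a] by blast
  next
    case False
    then have "perm_word [a, b] = perm_word [b, a]" using ne by (intro perm_word_commute) auto
    then have "conj_word ([] @ [a, b] @ y) = conj_word ([] @ [b, a] @ y)" by (rule conj_word_block)
    then have "fpf_reduced (b # a # y)" using fpf_reduced_cong[OF w] by simp
    then have "even b" by (rule fpf_reduced_hd_even)
    then show ?thesis using a ne initial_swap[of a b] initial_swap[of b a] by (metis linorder_neqE)
  qed
  then obtain T' where "moves 2 0 ([] @ [a, b] @ y) ([] @ T' @ y)"
    using moves_I[of "[]" "[a, b]" _ _ _ 0 2 y] by (metis length_Cons list.size(3) numeral_2_eq_2)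
  then show ?thesis using moves_d0 by (metis append_Cons append_Nil)
qed

lemma fpf_reduced_ck: "fpf_reduced w \<Longrightarrow> fpf_reduced (ck k w)"
  using ck_bent ck_not_bent moves_fpf_reduced by metis

lemma fpf_reduced_d0: "fpf_reduced w \<Longrightarrow> fpf_reduced (d0 w)"
  by (cases w rule: d0.cases) (use d0_moves moves_fpf_reduced in \<open>blast, simp_all\<close>)

lemma moves_sym:
  assumes "moves n k w w'" shows "moves n k w' w"
proof -
  obtain x T T' y p q where r: "length x = k" "length T = n" "w = x @ T @ y" "w' = x @ T' @ y"
    "local_move x T T' p q \<or> local_move x T' T p q"
    using assms by (rule moves_E)
  have "length T' = n" using r(2,5) local_move_length by metis
  then show ?thesis unfolding r(3,4) using r(1,5) by (intro moves_I[of x T' T p q]) auto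
qed

lemma ck_ck: "fpf_reduced w \<Longrightarrow> ck k (ck k w) = w"
  using ck_bent ck_not_bent moves_ck moves_sym by metis

lemma same_desc_bent: "same_desc w v \<Longrightarrow> bent k w \<longleftrightarrow> bent k v"
  unfolding same_desc_def bent_def by auto

lemma fb_ck:
  assumes w: "fpf_reduced w" shows "fb \<pi> (ck k w) = ck k (fb \<pi> w)"
proof (cases "bent k w")
  case True
  have "ck k (fb \<pi> w) = fb \<pi> (ck k w)" using fb_moves[OF ck_bent[OF w True] w] by (rule moves_ck)
  then show ?thesis by simp
next
  case False
  then have "\<not> bent k (fb \<pi> w)" using same_desc_bent fb_same_desc[OF w] by blast
  then show ?thesis using False ck_not_bent by simp
qed

lemma fb_d0:
  assumes w: "fpf_reduced w" shows "fb \<pi> (d0 w) = d0 (fb \<pi> w)"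
proof (cases "Suc 0 < length w")
  case True
  then obtain a b y where "w = a # b # y" by (cases w rule: d0.cases) auto
  then have mv: "moves 2 0 w (d0 w)" using d0_moves w by blast
  have "d0 (fb \<pi> w) = fb \<pi> (d0 w)" using fb_moves[OF mv w] by (rule moves_d0)
  then show ?thesis by simp
next
  case False
  have short: "d0 v = v" if "length v = length w" for v
    using that False by (cases v rule: d0.cases) auto
  have "length (fb \<pi> w) = length w" using fb_same_desc[OF w, of \<pi>] by (simp add: same_desc_def)
  then show ?thesis using short by simp
qed

text \<open>All that the crystal argument uses of a bump, chosen so that the inverse map satisfies
  it too.\<close>

locale word_map =
  fixes \<Psi> :: "int list \<Rightarrow> int list"
  assumes bij: "bij_betw \<Psi> {w. fpf_reduced w} {w. fpf_reduced w}"
    and desc: "fpf_reduced w \<Longrightarrow> same_desc w (\<Psi> w)"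
    and ck: "fpf_reduced w \<Longrightarrow> \<Psi> (ck k w) = ck k (\<Psi> w)"
    and d0: "fpf_reduced w \<Longrightarrow> \<Psi> (d0 w) = d0 (\<Psi> w)"
begin

lemma reduced [simp]: "fpf_reduced w \<Longrightarrow> fpf_reduced (\<Psi> w)"
  using bij by (auto simp: bij_betw_def)

lemma length [simp]: "fpf_reduced w \<Longrightarrow> length (\<Psi> w) = length w"
  using desc by (auto simp: same_desc_def)

end

lemma word_map_fb: "word_map (fb \<pi>)"
  by unfold_locales (simp_all add: bij_betw_fb fb_same_desc fb_ck fb_d0)

lemma word_map_inv:
  assumes "word_map \<Psi>" shows "word_map (inv_into {w. fpf_reduced w} \<Psi>)" (is "word_map ?\<Phi>")
proof -
  interpret word_map \<Psi> by fact
  have inv: "bij_betw ?\<Phi> {w. fpf_reduced w} {w. fpf_reduced w}" using bij by (rule bij_betw_inv_into)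
  have red: "fpf_reduced (?\<Phi> w)" if "fpf_reduced w" for w using inv that by (auto simp: bij_betw_def)
  have r: "\<Psi> (?\<Phi> w) = w" if "fpf_reduced w" for w
    using bij that by (intro f_inv_into_f) (simp add: bij_betw_def)
  have l: "?\<Phi> (\<Psi> w) = w" if "fpf_reduced w" for w
    using bij that by (intro inv_into_f_f) (simp_all add: bij_betw_def)
  show ?thesis
  proof
    show "bij_betw ?\<Phi> {w. fpf_reduced w} {w. fpf_reduced w}" by (rule inv)
    fix w k assume w: "fpf_reduced w"
    show "same_desc w (?\<Phi> w)" using desc[OF red[OF w]] r[OF w] by (auto simp: same_desc_def)
    have "\<Psi> (ck k (?\<Phi> w)) = ck k w" using ck[OF red[OF w]] r[OF w] by simp
    then show "?\<Phi> (ck k w) = ck k (?\<Phi> w)" using l[OF fpf_reduced_ck[OF red[OF w]]] by metis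
    have "\<Psi> (d0 (?\<Phi> w)) = d0 w" using d0[OF red[OF w]] r[OF w] by simp
    then show "?\<Phi> (d0 w) = d0 (?\<Phi> w)" using l[OF fpf_reduced_d0[OF red[OF w]]] by metis
  qed
qed

section \<open>Row insertion\<close>

text \<open>Inserts the letter at position \<open>k + p\<close> into the row occupying positions
  \<open>k\<close> to \<open>k + p - 1\<close>, by moves at \<open>k + p - 2\<close> down to
  \<open>k\<close>. The bumped letter ends up at \<open>k\<close> and the new row starts at
  \<open>k + 1\<close>; a row of one letter needs no move.\<close>

fun row_ins :: "nat \<Rightarrow> nat \<Rightarrow> int list \<Rightarrow> int list" where
  "row_ins k 0 w = w"
| "row_ins k (Suc 0) w = w"
| "row_ins k (Suc (Suc p)) w = row_ins k (Suc p) (ck (k + p) w)"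

text \<open>Each insertion leaves its bumped letter in front, so the next one works one position
  further right.\<close>

fun rows_ins :: "nat \<Rightarrow> nat \<Rightarrow> nat \<Rightarrow> int list \<Rightarrow> int list" where
  "rows_ins k p 0 w = w"
| "rows_ins k p (Suc r) w = rows_ins (Suc k) p r (row_ins k p w)"

text \<open>The letters that are bumped when the increasing word \<open>B\<close> is row inserted into the increasing
  word \<open>A\<close>: every \<open>b\<close> bumps the least larger letter of \<open>A\<close> not bumped before.\<close>

fun gr :: "int list \<Rightarrow> int list \<Rightarrow> int list" where
  "gr (a # A) (b # B) = (if a \<le> b then gr A (b # B) else a # gr A B)"
| "gr A B = []"

lemma fpf_reduced_row_ins: "fpf_reduced w \<Longrightarrow> fpf_reduced (row_ins k p w)"
  by (induction k p w rule: row_ins.induct) (auto simp: fpf_reduced_ck)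

lemma row_ins_inject:
  assumes "fpf_reduced v" "fpf_reduced w" "row_ins k p v = row_ins k p w" shows "v = w"
  using assms
proof (induction k p v arbitrary: w rule: row_ins.induct)
  case (3 k p v)
  then have "ck (k + p) v = ck (k + p) w" using fpf_reduced_ck by simp
  then show ?case using ck_ck 3 by metis
qed auto

lemma rows_ins_inject:
  assumes "fpf_reduced v" "fpf_reduced w" "rows_ins k p r v = rows_ins k p r w" shows "v = w"
  using assms
proof (induction k p r v arbitrary: w rule: rows_ins.induct)
  case (2 k p r v)
  then have "row_ins k p v = row_ins k p w" using fpf_reduced_row_ins by simp
  then show ?case using row_ins_inject 2 by metis
qed auto

text \<open>Unlike \<open>initial_step\<close>, these moves are relations between permutations. This
  finer invariant is needed because an increasing word will be recovered from its
  permutation.\<close>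

lemma perm_word_ck:
  assumes "fpf_reduced w" shows "perm_word (ck k w) = perm_word w"
proof (cases "bent k w")
  case True
  have block: "perm_word (x @ T' @ y) = perm_word (x @ T @ y)"
    if mv: "local_move x T T' p q" and len: "length T = 3" for x T T' y p q
  proof -
    have "perm_word T' = perm_word T"
      using mv
    proof cases
      case (bac_bca a b c)
      then have "perm_word [a, c] = perm_word [c, a]" by (intro perm_word_commute) auto
      then show ?thesis unfolding bac_bca perm_word_Cons[of b] by (simp only:)
    next
      case (acb_cab a b c)
      then have "perm_word [a, c] = perm_word [c, a]" by (intro perm_word_commute) auto
      then show ?thesis unfolding acb_cab
        using perm_word_append[of "[a, c]" "[b]"] perm_word_append[of "[c, a]" "[b]"] by (simp only: append.simps)
    next
      case (braid b)
      then show ?thesis using perm_word_braid[of b] by (simp only:)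
    qed (use len in auto)
    then show ?thesis by (simp only: perm_word_append)
  qed
  obtain x T T' y p q where r: "length x = k" "length T = 3" "w = x @ T @ y" "ck k w = x @ T' @ y"
    "local_move x T T' p q \<or> local_move x T' T p q"
    using ck_bent[OF assms True] by (rule moves_E)
  from r(5) show ?thesis
  proof
    assume mv: "local_move x T T' p q"
    show ?thesis unfolding r(4) unfolding r(3) by (rule block[OF mv r(2)])
  next
    assume mv: "local_move x T' T p q"
    have "length T' = 3" using local_move_length[OF mv] r(2) by simp
    then show ?thesis unfolding r(4) unfolding r(3) by (rule block[OF mv, symmetric])
  qed
next
  case False
  then show ?thesis using ck_not_bent by simp
qed

lemma perm_word_row_ins: "fpf_reduced w \<Longrightarrow> perm_word (row_ins k p w) = perm_word w"
proof (induction k p w rule: row_ins.induct)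
  case (3 k p w)
  then show ?case using perm_word_ck[OF 3(2)] fpf_reduced_ck[OF 3(2)] by (metis row_ins.simps(3))
qed auto

lemma perm_word_rows_ins: "fpf_reduced w \<Longrightarrow> perm_word (rows_ins k p r w) = perm_word w"
proof (induction k p r w rule: rows_ins.induct)
  case (2 k p r w)
  then show ?case using perm_word_row_ins[OF 2(2)] fpf_reduced_row_ins[OF 2(2)] by (metis rows_ins.simps(2))
qed auto

text \<open>A letter exceeding the whole row reaches its front by moves from \<open>a c b\<close> to
  \<open>c a b\<close>.\<close>

lemma row_ins_slide:
  assumes "incr (R @ [r])" "r < c"
  shows "row_ins (length X) (Suc (length R)) (X @ R @ [c, r] @ Y) = X @ c # R @ [r] @ Y"
  using assms
proof (induction R arbitrary: r Y rule: rev_induct)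
  case (snoc s R)
  have s: "s < r" "incr (R @ [s])" using snoc.prems by (auto simp: sorted_wrt_append)
  have "ck (length X + length R) (X @ (R @ [s]) @ [c, r] @ Y) = X @ R @ [c, s] @ (r # Y)"
    using ck_append[of "X @ R" "s # c # r # Y"] s snoc.prems(2) by simp
  then show ?case using snoc.IH[OF s(2), of "r # Y"] s snoc.prems(2) by simp
qed simp

text \<open>This is Edelman-Greene insertion. While \<open>b\<close> is smaller than the last two
  letters of the row it moves left past the end; then the letter it meets is bumped and slides to
  the front. If \<open>b\<close> is in the row already, reducedness forces \<open>c = b + 1\<close>,
  and the row does not change.\<close>

lemma row_ins_bump:
  assumes "incr R" "R \<noteq> []" "b < last R" "fpf_reduced (X @ R @ b # Y)"
  shows "\<exists>R1 c R2 m. R = R1 @ c # R2 \<and> (\<forall>a\<in>set R1. a \<le> b) \<and> b < c \<and>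
    row_ins (length X) (length R) (X @ R @ b # Y) = X @ c # R1 @ m # R2 @ Y \<and>
    incr (R1 @ m # R2) \<and> (m = b \<or> m = c \<and> c = b + 1)"
  using assms
proof (induction R arbitrary: Y rule: rev_induct)
  case (snoc r R)
  have br: "b < r" using snoc.prems by simp
  show ?case
  proof (cases R rule: rev_cases)
    case Nil
    then show ?thesis using br by (intro exI[of _ "[]"] exI[of _ r] exI[of _ b]) simp
  next
    case (snoc S s)
    have sr: "s < r" "incr (S @ [s])" "\<forall>a\<in>set S. a < s"
      using snoc.prems(1) \<open>R = S @ [s]\<close> by (auto simp: sorted_wrt_append)
    let ?w = "X @ (R @ [r]) @ b # Y"
    have step: "row_ins (length X) (length (R @ [r])) ?w = row_ins (length X) (length R) (ck (length X + length S) ?w)"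
      using \<open>R = S @ [s]\<close> by simp
    have ckw: "ck (length X + length S) ?w = X @ S @ ck3 (s # r # b # Y)"
      using ck_append[of "X @ S" "s # r # b # Y"] \<open>R = S @ [s]\<close> by simp
    consider "b < s" | "s < b" | "s = b" by linarith
    then show ?thesis
    proof cases
      case 1
      then have ck1: "ck (length X + length S) ?w = X @ R @ b # (r # Y)"
        using ckw br sr \<open>R = S @ [s]\<close> by simp
      have "fpf_reduced (X @ R @ b # (r # Y))" using fpf_reduced_ck[OF \<open>fpf_reduced ?w\<close>] ck1 by metis
      moreover have "incr R" "R \<noteq> []" "b < last R" using sr 1 \<open>R = S @ [s]\<close> by auto
      ultimately obtain R1 c R2 m where IH: "R = R1 @ c # R2" "\<forall>a\<in>set R1. a \<le> b" "b < c"
        "row_ins (length X) (length R) (X @ R @ b # (r # Y)) = X @ c # R1 @ m # R2 @ (r # Y)"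
        "incr (R1 @ m # R2)" "m = b \<or> m = c \<and> c = b + 1"
        using snoc.IH[of "r # Y"] by blast
      have "\<forall>a\<in>set R. a < r" using snoc.prems(1) by (simp add: sorted_wrt_append)
      then have "incr (R1 @ m # R2 @ [r])"
        using IH(1,3,5,6) br by (auto simp: sorted_wrt_append)
      then show ?thesis using IH step ck1
        by (intro exI[of _ R1] exI[of _ c] exI[of _ "R2 @ [r]"] exI[of _ m]) simp
    next
      case 2
      then have ck1: "ck (length X + length S) ?w = X @ S @ [r, s] @ (b # Y)"
        using ckw br sr by simp
      then have "row_ins (length X) (length (R @ [r])) ?w = X @ r # S @ [s] @ b # Y"
        using step row_ins_slide[OF sr(2,1), of X "b # Y"] \<open>R = S @ [s]\<close> by simp
      moreover have "incr (R @ b # [])" using sr 2 \<open>R = S @ [s]\<close> by (auto simp: sorted_wrt_append)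
      ultimately show ?thesis using 2 br sr \<open>R = S @ [s]\<close>
        by (intro exI[of _ R] exI[of _ r] exI[of _ "[]"] exI[of _ b]) auto
    next
      case 3
      have "fpf_reduced ((X @ S) @ [b, r, b] @ Y)" using snoc.prems(4) \<open>R = S @ [s]\<close> 3 by simp
      then have rb: "r = b + 1" using fpf_reduced_sandwich[of "X @ S" b r Y] br by simp
      then have ck1: "ck (length X + length S) ?w = X @ S @ [r, s] @ (r # Y)"
        using ckw 3 by simp
      then have "row_ins (length X) (length (R @ [r])) ?w = X @ r # S @ [s] @ r # Y"
        using step row_ins_slide[OF sr(2,1), of X "r # Y"] \<open>R = S @ [s]\<close> by simp
      moreover have "incr (R @ r # [])" using snoc.prems(1) by simp
      ultimately show ?thesis using 3 br sr rb \<open>R = S @ [s]\<close>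
        by (intro exI[of _ R] exI[of _ r] exI[of _ "[]"] exI[of _ r]) auto
    qed
  qed
qed simp

lemma gr_Nil [simp]: "gr A [] = []"
  by (cases A) auto

lemma gr_skip: "\<forall>a\<in>set A1. a \<le> b \<Longrightarrow> gr (A1 @ A) (b # B) = gr A (b # B)"
  by (induction A1) auto

lemma gr_skip_le:
  assumes "\<forall>a\<in>set A1. \<forall>b\<in>set B. a \<le> b" shows "gr (A1 @ A) B = gr A B"
  using assms gr_skip[of A1] by (cases B) auto

lemma gr_all_le: "\<forall>a\<in>set A. a \<le> b \<Longrightarrow> gr A (b # B) = []"
  using gr_skip[of A b "[]" B] by simp

text \<open>Insertion only writes \<open>m\<close> for \<open>c\<close> in the row, and
  \<open>m\<close> is at most every later letter of \<open>B\<close>, so it is not bumped later.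
  This is why \<open>gr\<close> may be computed from the original letters.\<close>

lemma rows_ins_step:
  assumes A: "incr A" "A \<noteq> []" "b < last A" and B: "incr (b # B)"
    and red: "fpf_reduced (X @ A @ b # B @ Y)"
  obtains c R where "row_ins (length X) (length A) (X @ A @ b # B @ Y) = (X @ [c]) @ R @ B @ Y"
    "incr R" "length R = length A" "gr A (b # B) = c # gr R B"
    "fpf_reduced ((X @ [c]) @ R @ B @ Y)"
proof -
  obtain R1 c R2 m where r: "A = R1 @ c # R2" "\<forall>a\<in>set R1. a \<le> b" "b < c"
    "row_ins (length X) (length A) (X @ A @ b # (B @ Y)) = X @ c # R1 @ m # R2 @ (B @ Y)"
    "incr (R1 @ m # R2)" "m = b \<or> m = c \<and> c = b + 1"
    using row_ins_bump[OF A red] by blast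
  have "gr (R1 @ m # R2) B = gr ((R1 @ [m]) @ R2) B" by simp
  also have "\<dots> = gr R2 B" using r(2,6) B by (intro gr_skip_le) fastforce
  finally have "gr A (b # B) = c # gr (R1 @ m # R2) B" using r(1,2,3) gr_skip[of R1 b] by simp
  moreover have "row_ins (length X) (length A) (X @ A @ b # B @ Y) = (X @ [c]) @ (R1 @ m # R2) @ B @ Y"
    using r(4) by simp
  moreover have "fpf_reduced ((X @ [c]) @ (R1 @ m # R2) @ B @ Y)"
    using fpf_reduced_row_ins[OF red, of "length X" "length A"] calculation(2) by simp
  ultimately show ?thesis using that[of c "R1 @ m # R2"] r(1,5) by simp
qed

lemma last_neq_hd_reduced:
  assumes "fpf_reduced (X @ A @ b # Y)" "A \<noteq> []" shows "last A \<noteq> b"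
  using assms not_fpf_reduced_square[of "X @ butlast A" b Y] by (metis append_assoc append_butlast_last_id append_Cons append_Nil)

lemma sorted_all_less_last: "incr A \<Longrightarrow> a \<in> set A \<Longrightarrow> a \<le> last A" for A :: "int list"
  by (induction A rule: rev_induct) (auto simp: sorted_wrt_append)

text \<open>Insertions stop at the first letter of \<open>B\<close> above the whole row. From there
  on \<open>B\<close> continues the row, so row and remainder form one increasing word.\<close>

lemma rows_ins_normal_form:
  assumes "incr A" "incr B" "fpf_reduced (X @ A @ B @ Y)"
  shows "\<exists>R. incr R \<and>
    rows_ins (length X) (length A) (length (gr A B)) (X @ A @ B @ Y) = X @ gr A B @ R @ Y"
  using assms
proof (induction B arbitrary: X A)
  case (Cons b B)
  show ?case
  proof (cases "A = []")
    case True
    then show ?thesis using Cons.prems by auto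
  next
    case ne: False
    then have "last A \<noteq> b" using last_neq_hd_reduced Cons.prems(3) by simp
    then consider "last A < b" | "b < last A" by linarith
    then show ?thesis
    proof cases
      case 1
      then have less: "\<forall>a\<in>set A. a < b" using sorted_all_less_last[OF Cons.prems(1)] by force
      then have "gr A (b # B) = []" by (intro gr_all_le) auto
      moreover have "incr (A @ b # B)" using Cons.prems less by (fastforce simp: sorted_wrt_append)
      ultimately show ?thesis by (intro exI[of _ "A @ b # B"]) simp
    next
      case 2
      have redw: "fpf_reduced (X @ A @ b # B @ Y)" using Cons.prems(3) by simp
      obtain c R where r: "row_ins (length X) (length A) (X @ A @ b # B @ Y) = (X @ [c]) @ R @ B @ Y"
        "incr R" "length R = length A" "gr A (b # B) = c # gr R B"
        "fpf_reduced ((X @ [c]) @ R @ B @ Y)"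
        by (rule rows_ins_step[OF Cons.prems(1) ne 2 Cons.prems(2) redw])
      obtain R' where "incr R'"
        "rows_ins (length (X @ [c])) (length R) (length (gr R B)) ((X @ [c]) @ R @ B @ Y) = (X @ [c]) @ gr R B @ R' @ Y"
        using Cons.IH[OF r(2) _ r(5)] Cons.prems(2) by auto
      then show ?thesis using r by (intro exI[of _ R']) simp
    qed
  qed
qed auto

context word_map
begin

lemma row_ins: "fpf_reduced w \<Longrightarrow> \<Psi> (row_ins k p w) = row_ins k p (\<Psi> w)"
  by (induction k p w rule: row_ins.induct) (auto simp: ck fpf_reduced_ck)

lemma rows_ins: "fpf_reduced w \<Longrightarrow> \<Psi> (rows_ins k p r w) = rows_ins k p r (\<Psi> w)"
  by (induction k p r w rule: rows_ins.induct) (auto simp: row_ins fpf_reduced_row_ins)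

text \<open>Another letter is inserted exactly if there is a descent behind the row.
  \<open>\<Psi>\<close> keeps descents and commutes with each insertion, so both sides stop at the
  same time.\<close>

lemma length_gr:
  assumes "incr A" "incr B" "fpf_reduced (X @ A @ B @ Y)"
    "\<Psi> (X @ A @ B @ Y) = X' @ A' @ B' @ Y'" "length X' = length X" "length A' = length A" "length B' = length B"
    "incr A'" "incr B'"
  shows "length (gr A' B') = length (gr A B)"
  using assms
proof (induction B arbitrary: X A X' A' B')
  case (Cons b B)
  obtain b' C' where B': "B' = b' # C'" using Cons.prems(7) by (cases B') auto
  show ?case
  proof (cases "A = []")
    case True
    then show ?thesis using Cons.prems by simp
  next
    case ne: False
    have ne': "A' \<noteq> []" using ne Cons.prems(6) by auto
    let ?w = "X @ A @ (b # B) @ Y" and ?v = "X' @ A' @ B' @ Y'"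
    have redv: "fpf_reduced ?v" using Cons.prems(3,4) reduced by metis
    have lb: "last A \<noteq> b" "last A' \<noteq> b'" using last_neq_hd_reduced Cons.prems(3) redv ne ne' B' by auto
    define q where "q = length A - 1"
    have q: "length A = Suc q" using ne by (cases A) (auto simp: q_def)
    have pos: "Suc (length X + q) < length ?w" using q by simp
    have lasts: "last A = A ! q" "last A' = A' ! q" using ne ne' q Cons.prems(6) by (simp_all add: last_conv_nth)
    have nth: "?w ! (length X + q) = last A" "?w ! Suc (length X + q) = b"
      using q lasts by (simp_all add: nth_append)
    have nth': "?v ! (length X + q) = last A'" "?v ! Suc (length X + q) = b'"
      using q lasts B' Cons.prems(5,6) by (simp_all add: nth_append)
    have "last A < b \<longleftrightarrow> last A' < b'"
      using desc[OF Cons.prems(3)] pos nth nth' Cons.prems(4) unfolding same_desc_def by metis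
    then consider "last A < b" "last A' < b'" | "b < last A" "b' < last A'" using lb by linarith
    then show ?thesis
    proof cases
      case 1
      have "\<forall>a\<in>set A. a \<le> b" using 1 sorted_all_less_last[OF Cons.prems(1)] by force
      moreover have "\<forall>a\<in>set A'. a \<le> b'" using 1 sorted_all_less_last[OF Cons.prems(8)] by force
      ultimately show ?thesis using gr_all_le B' by simp
    next
      case 2
      have redw: "fpf_reduced (X @ A @ b # B @ Y)" using Cons.prems(3) by simp
      obtain c R where r: "row_ins (length X) (length A) (X @ A @ b # B @ Y) = (X @ [c]) @ R @ B @ Y"
        "incr R" "length R = length A" "gr A (b # B) = c # gr R B"
        "fpf_reduced ((X @ [c]) @ R @ B @ Y)"
        by (rule rows_ins_step[OF Cons.prems(1) ne 2(1) Cons.prems(2) redw])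
      have sB: "incr (b' # C')" and redv': "fpf_reduced (X' @ A' @ b' # C' @ Y')"
        using Cons.prems(9) redv B' by simp_all
      obtain c' R' where r': "row_ins (length X') (length A') (X' @ A' @ b' # C' @ Y') = (X' @ [c']) @ R' @ C' @ Y'"
        "incr R'" "length R' = length A'" "gr A' (b' # C') = c' # gr R' C'"
        "fpf_reduced ((X' @ [c']) @ R' @ C' @ Y')"
        by (rule rows_ins_step[OF Cons.prems(8) ne' 2(2) sB redv'])
      have "\<Psi> ((X @ [c]) @ R @ B @ Y) = (X' @ [c']) @ R' @ C' @ Y'"
        using row_ins[OF Cons.prems(3), of "length X" "length A"] r(1) r'(1) Cons.prems(4,5,6) B' by simp
      then have "length (gr R' C') = length (gr R B)"
        using Cons.IH[OF r(2) _ r(5), of "X' @ [c']" R' C'] Cons.prems r r' B' by simp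
      then show ?thesis using r(4) r'(4) B' by simp
    qed
  qed
qed simp

end

section \<open>Increasing words are determined by their permutations\<close>

lemma perm_word_fixes_above: "\<forall>r\<in>set R. r \<le> m \<Longrightarrow> x > m + 1 \<Longrightarrow> perm_word R x = x"
  by (induction R) (auto simp: sZ_def)

lemma perm_word_moves_top:
  assumes "incr (R @ [m])" shows "perm_word (R @ [m]) (m + 1) \<noteq> m + 1"
proof
  assume "perm_word (R @ [m]) (m + 1) = m + 1"
  then have "perm_word R m = m + 1" by (simp add: perm_word_append sZ_def)
  moreover have "perm_word R (m + 1) = m + 1"
    using assms by (intro perm_word_fixes_above[of R "m - 1"]) (auto simp: sorted_wrt_append)
  ultimately have "m = m + 1" using bij_perm_word[of R] by (metis bij_pointE)
  then show False by simp
qed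

text \<open>The largest integer moved is one more than the last letter, so the last letter can be
  read off and removed.\<close>

lemma sorted_perm_word_inject:
  assumes "incr R" "incr R'" "perm_word R = perm_word R'" shows "R = R'"
  using assms
proof (induction R arbitrary: R' rule: rev_induct)
  case Nil
  show ?case
  proof (cases R' rule: rev_cases)
    case (snoc S m)
    then show ?thesis using perm_word_moves_top Nil by (metis id_apply perm_word_Nil)
  qed simp
next
  case (snoc m R)
  show ?case
  proof (cases R' rule: rev_cases)
    case Nil
    then show ?thesis using perm_word_moves_top snoc.prems by (metis id_apply perm_word_Nil)
  next
    case R': (snoc S n)
    have top: "n \<le> m" if "incr (S @ [n])" "incr (R @ [m])" "perm_word (R @ [m]) = perm_word (S @ [n])"
      for R S :: "int list" and m n :: int
    proof (rule ccontr)
      assume "\<not> n \<le> m"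
      then have "perm_word (R @ [m]) (n + 1) = n + 1"
        using that(2) by (intro perm_word_fixes_above[of _ m]) (auto simp: sorted_wrt_append)
      then show False using perm_word_moves_top[OF that(1)] that(3) by simp
    qed
    have "n \<le> m" using top[of S n R m] snoc.prems R' by simp
    moreover have "m \<le> n" using top[of R m S n] snoc.prems R' by simp
    ultimately have "m = n" by simp
    have "perm_word R x = perm_word S x" for x
      using snoc.prems(3) unfolding R' \<open>m = n\<close> perm_word_append
      by (metis comp_apply perm_word_Cons perm_word_Nil sZ_sZ comp_id)
    then have "perm_word R = perm_word S" by blast
    then have "R = S" using snoc.IH[of S] snoc.prems R' by (auto simp: sorted_wrt_append)
    then show ?thesis using R' \<open>m = n\<close> by simp
  qed
qed

context word_map
begin

text \<open>The two pairs have the same normal form: the bumped letters agree by assumption, and the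
  increasing rest is determined by its permutation. This holds for the primed pairs too, so
  \<open>\<Psi>\<close> of the second word and its claimed value have the same insertion result, and
  insertion is injective on reduced words.\<close>

lemma transport:
  assumes sorted: "incr A" "incr B" "incr A2" "incr B2"
    and same: "gr A2 B2 = gr A B" "perm_word (A2 @ B2) = perm_word (A @ B)"
    and len: "length (A2 @ B2) = length (A @ B)"
    and red: "fpf_reduced (X @ A @ B @ Y)"
    and img: "\<Psi> (X @ A @ B @ Y) = X' @ A' @ B' @ Y'" "length X' = length X" "length A' = length A" "length B' = length B"
    and sorted': "incr A'" "incr B'" "incr A2'" "incr B2'"
    and same': "gr A2' B2' = gr A' B'" "perm_word (A2' @ B2') = perm_word (A' @ B')"
    and len': "length A2' = length A2" "length B2' = length B2"
  shows "\<Psi> (X @ A2 @ B2 @ Y) = X' @ A2' @ B2' @ Y'"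
proof -
  have main: "rows_ins (length X) (length A2) (length (gr A B)) (X @ A2 @ B2 @ Y)
      = rows_ins (length X) (length A) (length (gr A B)) (X @ A @ B @ Y) \<and> fpf_reduced (X @ A2 @ B2 @ Y)"
    if sorted: "incr A" "incr B" "incr A2" "incr B2"
    and same: "gr A2 B2 = gr A B" "perm_word (A2 @ B2) = perm_word (A @ B)"
    and len: "length (A2 @ B2) = length (A @ B)"
    and red: "fpf_reduced (X @ A @ B @ Y)" for A B A2 B2 X Y :: "int list"
  proof -
    let ?w = "X @ A @ B @ Y" and ?v = "X @ A2 @ B2 @ Y"
    have pw: "perm_word ?v = perm_word ?w"
    proof -
      have "perm_word (X @ (A2 @ B2) @ Y) = perm_word (X @ (A @ B) @ Y)"
        unfolding perm_word_append[of X] perm_word_append[of "_ @ _" Y] same(2) ..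
      then show ?thesis by simp
    qed
    have redv: "fpf_reduced ?v" using fpf_reduced_cong[OF red] conj_word_cong_perm_word[OF pw] len by simp
    obtain R where R: "incr R" "rows_ins (length X) (length A) (length (gr A B)) ?w = X @ gr A B @ R @ Y"
      using rows_ins_normal_form[OF sorted(1,2) red] by blast
    obtain S where S: "incr S" "rows_ins (length X) (length A2) (length (gr A B)) ?v = X @ gr A B @ S @ Y"
      using rows_ins_normal_form[OF sorted(3,4) redv] same(1) by auto
    have "perm_word (X @ gr A B @ R @ Y) = perm_word (X @ gr A B @ S @ Y)"
      using perm_word_rows_ins[OF red] perm_word_rows_ins[OF redv] R(2) S(2) pw by metis
    then have "perm_word ((X @ gr A B) @ R @ Y) = perm_word ((X @ gr A B) @ S @ Y)" by simp
    then have e: "perm_word (X @ gr A B) (perm_word R (perm_word Y k)) = perm_word (X @ gr A B) (perm_word S (perm_word Y k))" for k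
      by (metis perm_word_append_apply)
    then have "perm_word R (perm_word Y k) = perm_word S (perm_word Y k)" for k
      by (metis perm_word_rev_apply')
    then have "perm_word R k = perm_word S k" for k by (metis perm_word_rev_apply)
    then have "R = S" using sorted_perm_word_inject R(1) S(1) by blast
    then show ?thesis using R S redv by simp
  qed
  have redv: "fpf_reduced (X' @ A' @ B' @ Y')" using img(1) reduced[OF red] by simp
  have r: "length (gr A' B') = length (gr A B)" using length_gr[OF sorted(1,2) red img sorted'(1,2)] .
  note m = main[OF sorted same len red]
  have len2: "length (A2' @ B2') = length (A' @ B')" using len len' img by simp
  note m' = main[OF sorted' same' len2 redv]
  have "rows_ins (length X) (length A2) (length (gr A B)) (\<Psi> (X @ A2 @ B2 @ Y))
    = \<Psi> (rows_ins (length X) (length A) (length (gr A B)) (X @ A @ B @ Y))"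
    using m rows_ins[of "X @ A2 @ B2 @ Y"] by metis
  also have "\<dots> = rows_ins (length X) (length A) (length (gr A B)) (X' @ A' @ B' @ Y')"
    using rows_ins[OF red] img(1) by metis
  also have "\<dots> = rows_ins (length X) (length A2) (length (gr A B)) (X' @ A2' @ B2' @ Y')"
    using m' r img len' by metis
  finally show ?thesis using rows_ins_inject[of "\<Psi> (X @ A2 @ B2 @ Y)" "X' @ A2' @ B2' @ Y'"] m m' reduced by blast
qed

end

section \<open>Moving a letter between two increasing words\<close>

lemma perm_word_upto:
  "x \<le> y + 1 \<Longrightarrow> perm_word [x..y] k = (if k = y + 1 then x else if x \<le> k \<and> k \<le> y then k + 1 else k)"
proof (induction x y arbitrary: k rule: upto.induct)
  case (1 x y)
  show ?case
  proof (cases "x \<le> y")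
    case True
    then have "perm_word [x..y] k = sZ x (perm_word [x + 1..y] k)" by (simp add: upto_rec1)
    then show ?thesis using 1(1)[OF True, of k] True by (auto simp: sZ_def)
  next
    case False
    then show ?thesis using 1(2) by auto
  qed
qed

text \<open>The relation behind \<open>f_i\<close>: the run in the first factor loses its least
  letter \<open>x\<close> while the run in the second gains \<open>y\<close>.\<close>

lemma perm_word_upto_shift:
  assumes "x \<le> y" shows "perm_word ([x..y] @ [x..y - 1]) = perm_word ([x + 1..y] @ [x..y])"
proof
  fix k
  show "perm_word ([x..y] @ [x..y - 1]) k = perm_word ([x + 1..y] @ [x..y]) k"
    using assms by (auto simp: perm_word_append_apply perm_word_upto)
qed

text \<open>The right-hand side is shorter by two, so a doubled run cannot occur in a reduced
  word.\<close>

lemma perm_word_upto_square: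
  assumes "x \<le> z" shows "perm_word ([x..z] @ [x..z]) = perm_word ([x + 1..z] @ [x..z - 1])"
proof
  fix k
  show "perm_word ([x..z] @ [x..z]) k = perm_word ([x + 1..z] @ [x..z - 1]) k"
    using assms by (auto simp: perm_word_append_apply perm_word_upto)
qed

lemma perm_word_commute_lists:
  assumes "\<forall>u\<in>set U. \<forall>v\<in>set V. v + 1 < u \<or> u + 1 < v"
  shows "perm_word (U @ V) = perm_word (V @ U)"
  using assms
proof (induction U)
  case (Cons u U)
  have "perm_word ((u # U) @ V) k = perm_word (V @ u # U) k" for k
  proof -
    have "perm_word ((u # U) @ V) k = sZ u (perm_word (U @ V) k)" by simp
    also have "perm_word (U @ V) = perm_word (V @ U)" by (rule Cons.IH) (use Cons.prems in auto)
    also have "sZ u (perm_word (V @ U) k) = perm_word (u # V) (perm_word U k)" by (simp add: perm_word_append_apply)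
    also have "perm_word (u # V) = perm_word (V @ [u])" using Cons.prems by (intro perm_word_commute_list) auto
    finally show ?thesis by (simp add: perm_word_append_apply)
  qed
  then show ?case by blast
qed simp

lemma sorted_split:
  fixes A :: "int list"
  assumes "incr A" "{x..z} \<subseteq> set A" "x \<le> z + 1"
  shows "A = filter (\<lambda>a. a < x) A @ [x..z] @ filter (\<lambda>a. z < a) A"
proof (rule strict_sorted_equal)
  show "incr A" by fact
  show "incr (filter (\<lambda>a. a < x) A @ [x..z] @ filter (\<lambda>a. z < a) A)"
    using assms by (auto simp: sorted_wrt_append sorted_wrt_filter)
  show "set A = set (filter (\<lambda>a. a < x) A @ [x..z] @ filter (\<lambda>a. z < a) A)"
    using assms(2) by auto
qed

text \<open>The letters between the two runs are above \<open>z + 1\<close> or below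
  \<open>x - 1\<close>, so they commute with the runs, which become adjacent and form a doubled
  run.\<close>

lemma overlap_not_reduced:
  assumes A: "incr A" "{x..z} \<subseteq> set A" "z + 1 \<notin> set A"
    and B: "incr B" "{x..z} \<subseteq> set B" "x - 1 \<notin> set B" and xz: "x \<le> z"
  shows "\<not> fpf_reduced (X @ A @ B @ Y)"
proof
  assume red: "fpf_reduced (X @ A @ B @ Y)"
  let ?A1 = "filter (\<lambda>a. a < x) A" and ?A3 = "filter (\<lambda>a. z < a) A"
    and ?B1 = "filter (\<lambda>a. a < x) B" and ?B3 = "filter (\<lambda>a. z < a) B"
  have sA: "A = ?A1 @ [x..z] @ ?A3" and sB: "B = ?B1 @ [x..z] @ ?B3"
    using sorted_split[OF A(1,2)] sorted_split[OF B(1,2)] xz by auto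
  have "a \<in> set ?A3 \<Longrightarrow> a > z + 1" for a using A(3) by (cases "a = z + 1") auto
  moreover have "b \<in> set ?B1 \<Longrightarrow> b < x - 1" for b using B(3) by (cases "b = x - 1") auto
  ultimately have "\<forall>u\<in>set (?A3 @ ?B1). \<forall>v\<in>set [x..z]. v + 1 < u \<or> u + 1 < v" by force
  then have com: "perm_word ((?A3 @ ?B1) @ [x..z]) = perm_word ([x..z] @ (?A3 @ ?B1))"
    by (rule perm_word_commute_lists)
  let ?w = "X @ ?A1 @ [x + 1..z] @ [x..z - 1] @ ?A3 @ ?B1 @ ?B3 @ Y"
  have "conj_word ((X @ ?A1 @ [x..z]) @ ((?A3 @ ?B1) @ [x..z]) @ (?B3 @ Y))
      = conj_word ((X @ ?A1 @ [x..z]) @ ([x..z] @ (?A3 @ ?B1)) @ (?B3 @ Y))" using com by (rule conj_word_block)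
  also have "\<dots> = conj_word ((X @ ?A1) @ ([x..z] @ [x..z]) @ (?A3 @ ?B1 @ ?B3 @ Y))" by simp
  also have "\<dots> = conj_word ((X @ ?A1) @ ([x + 1..z] @ [x..z - 1]) @ (?A3 @ ?B1 @ ?B3 @ Y))"
    using perm_word_upto_square[OF xz] by (rule conj_word_block)
  finally have "conj_word (X @ (?A1 @ [x..z] @ ?A3) @ (?B1 @ [x..z] @ ?B3) @ Y) = conj_word ?w" by simp
  then have "conj_word ?w = conj_word (X @ A @ B @ Y)" using sA sB by metis
  then have "length (X @ A @ B @ Y) \<le> length ?w" using fpf_reduced_min[OF red] by blast
  moreover have "length A = length ?A1 + length [x..z] + length ?A3" using arg_cong[OF sA, of length] by simp
  moreover have "length B = length ?B1 + length [x..z] + length ?B3" using arg_cong[OF sB, of length] by simp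
  ultimately show False using xz by simp
qed

section \<open>Hall conditions for the bumped letters\<close>

lemma length_gr_le: "length (gr A B) \<le> length A" "length (gr A B) \<le> length B"
  by (induction A B rule: gr.induct) auto

lemma card_filter_Cons:
  assumes "a \<notin> set A"
  shows "card {c \<in> set (a # A). P c} = (if P a then 1 else 0) + card {c \<in> set A. P c}"
proof -
  have "{c \<in> set (a # A). P c} = (if P a then insert a {c \<in> set A. P c} else {c \<in> set A. P c})" by auto
  then show ?thesis using assms by simp
qed

text \<open>A Hall condition giving each letter of \<open>A\<close> its own smaller letter of
  \<open>B\<close>. At \<open>w = a\<close> it forces \<open>b < a\<close>, and it passes to the
  tails.\<close>

lemma gr_eq_left:
  assumes "incr A" "incr B"
    "\<And>w. card {a \<in> set A. a \<le> w} \<le> card {b \<in> set B. b < w}"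
  shows "gr A B = A"
  using assms
proof (induction A B rule: gr.induct)
  case (1 a A b B)
  have nin: "a \<notin> set A" "b \<notin> set B" using 1(3,4) by auto
  note cA = card_filter_Cons[OF nin(1)] and cB = card_filter_Cons[OF nin(2)]
  have ba: "b < a"
  proof (rule ccontr)
    assume "\<not> b < a"
    then have "{c \<in> set (b # B). c < a} = {}" using 1(4) by fastforce
    then have "card {c \<in> set (b # B). c < a} = 0" by (metis card.empty)
    moreover have "card {c \<in> set (a # A). c \<le> a} > 0" by (subst card_gt_0_iff) auto
    ultimately show False using 1(5)[of a] by linarith
  qed
  have "card {c \<in> set A. c \<le> w} \<le> card {c \<in> set B. c < w}" for w
  proof (cases "a \<le> w")
    case True
    then show ?thesis using 1(5)[of w] ba nin unfolding cA cB by simp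
  next
    case False
    then have "{c \<in> set A. c \<le> w} = {}" using 1(3) by fastforce
    then show ?thesis by (simp only: card.empty le0)
  qed
  then show ?case using 1 ba by simp
next
  case ("2_2" A)
  show ?case
  proof (cases A)
    case (Cons a A')
    then have "card {c \<in> set A. c \<le> a} > 0" by (subst card_gt_0_iff) auto
    moreover have "{b \<in> set ([] :: int list). b < a} = {}" by simp
    ultimately show ?thesis using "2_2"(3)[of a] by (metis card.empty not_le)
  qed simp
qed simp

lemma gr_full:
  assumes "incr A" "incr B"
    "\<And>v. card {b \<in> set B. v \<le> b} \<le> card {a \<in> set A. v < a}"
  shows "length (gr A B) = length B"
  using assms
proof (induction A B rule: gr.induct)
  case (1 a A b B)
  have nin: "a \<notin> set A" "b \<notin> set B" using 1(3,4) by auto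
  note cA = card_filter_Cons[OF nin(1)] and cB = card_filter_Cons[OF nin(2)]
  have b: "b < c" if "c \<in> set B" for c using that 1(4) by auto
  have a: "a < c" if "c \<in> set A" for c using that 1(3) by auto
  show ?case
  proof (cases "a \<le> b")
    case True
    have "card {c \<in> set (b # B). v \<le> c} \<le> card {c \<in> set A. v < c}" for v
    proof (cases "v < a")
      case v: True
      have "card {c \<in> set (b # B). v \<le> c} \<le> card {c \<in> set (b # B). b \<le> c}"
        by (intro card_mono) (auto intro: less_imp_le[OF b])
      also have "\<dots> \<le> card {c \<in> set (a # A). b < c}" by (rule 1(5))
      also have "\<dots> = card {c \<in> set A. b < c}" using True nin unfolding cA cB by simp
      also have "\<dots> \<le> card {c \<in> set A. v < c}" by (intro card_mono) (use v True in auto)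
      finally show ?thesis .
    next
      case False
      then show ?thesis using 1(5)[of v] nin(1) unfolding cA cB by simp
    qed
    then have "length (gr A (b # B)) = length (b # B)" using 1(1)[OF True] 1(3,4) by simp
    then show ?thesis using True by simp
  next
    case False
    have "card {c \<in> set B. v \<le> c} \<le> card {c \<in> set A. v < c}" for v
    proof (cases "v \<le> b")
      case True
      then show ?thesis using 1(5)[of v] nin False unfolding cA cB by simp
    next
      case vb: False
      show ?thesis
      proof (cases "v < a")
        case True
        have "card {c \<in> set B. v \<le> c} \<le> card {c \<in> set B. b \<le> c}"
          by (intro card_mono) (use vb in auto)
        also have "\<dots> \<le> card {c \<in> set A. b < c}" using 1(5)[of b] nin False unfolding cA cB by simp
        also have "\<dots> \<le> card {c \<in> set A. v < c}" by (intro card_mono) (use True in \<open>auto dest: a\<close>)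
        finally show ?thesis .
      next
        case False
        then show ?thesis using 1(5)[of v] nin vb unfolding cA cB by simp
      qed
    qed
    then have "length (gr A B) = length B" using 1(2)[OF False] 1(3,4) by simp
    then show ?thesis using False by simp
  qed
next
  case ("2_1" B)
  show ?case
  proof (cases B)
    case (Cons b B')
    then have "card {c \<in> set B. b \<le> c} > 0" by (subst card_gt_0_iff) auto
    moreover have "{a \<in> set ([] :: int list). b < a} = {}" by simp
    ultimately show ?thesis using "2_1"(3)[of b] by (metis card.empty not_le)
  qed simp
qed simp

text \<open>Once \<open>B1\<close> is used up, the letters left from \<open>A1\<close> are at most
  those of \<open>B2\<close> and are skipped.\<close>

lemma gr_append:
  assumes "length (gr A1 B1) = length B1" "\<forall>a\<in>set A1. \<forall>b\<in>set B2. a \<le> b"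
  shows "gr (A1 @ D) (B1 @ B2) = gr A1 B1 @ gr D B2"
  using assms
proof (induction A1 B1 rule: gr.induct)
  case (1 a A b B)
  then show ?case using length_gr_le(2)[of A B] by (auto split: if_splits)
next
  case ("2_2" A)
  then show ?case using gr_skip_le[of A B2 D] by simp
qed simp

text \<open>Both \<open>f_op\<close> and \<open>e_op\<close> relate a pair \<open>(A, B)\<close> in this configuration to the pair
  in which \<open>x\<close> is deleted from \<open>A\<close> and \<open>y\<close> is added to \<open>B\<close>. The two cardinality conditions are
  Hall conditions: the letters of \<open>B\<close> below \<open>x\<close> are matched to letters of \<open>A\<close> below \<open>x\<close>, and
  the letters of \<open>A\<close> above \<open>x\<close> to letters of \<open>B\<close> from \<open>x\<close> on.\<close>

definition config :: "int list \<Rightarrow> int list \<Rightarrow> int \<Rightarrow> int \<Rightarrow> bool" where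
  "config A B x y \<longleftrightarrow> incr A \<and> incr B \<and> x \<le> y \<and> {x..y} \<subseteq> set A \<and> {x..y - 1} \<subseteq> set B \<and>
    y \<notin> set B \<and> y + 1 \<notin> set A \<and> x - 1 \<notin> set B \<and>
    (\<forall>v. card {b \<in> set B. v \<le> b \<and> b < x} \<le> card {a \<in> set A. v < a \<and> a < x}) \<and>
    (\<forall>w. card {a \<in> set A. x < a \<and> a \<le> w} \<le> card {b \<in> set B. x \<le> b \<and> b < w})"

text \<open>Cut both words at \<open>x\<close> and behind the run. Below \<open>x\<close> every
  letter of \<open>B\<close> bumps; from \<open>x\<close> on every letter of \<open>A\<close> except
  \<open>x\<close> is bumped. So neither losing \<open>x\<close> nor gaining \<open>y\<close>
  affects \<open>gr\<close>. The permutation is kept because the letters between the two runs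
  commute with them.\<close>

lemma config_transfer:
  assumes conf: "config A B x y" and A': "incr A'" "set A' = set A - {x}"
    and B': "incr B'" "set B' = insert y (set B)"
  shows "gr A' B' = gr A B" "perm_word (A' @ B') = perm_word (A @ B)" "length (gr A B) < length A"
    "length A = Suc (length A')" "length B' = Suc (length B)"
proof -
  note c = conf[unfolded config_def]
  let ?A1 = "filter (\<lambda>a. a < x) A" and ?A3 = "filter (\<lambda>a. y < a) A"
    and ?B1 = "filter (\<lambda>a. a < x) B" and ?B3 = "filter (\<lambda>a. y - 1 < a) B"
  have sA: "A = ?A1 @ [x..y] @ ?A3" using c by (intro sorted_split) auto
  have sB: "B = ?B1 @ [x..y - 1] @ ?B3" using c by (intro sorted_split) auto
  have B3: "y < b" if "b \<in> set B" "y - 1 < b" for b using that c by (cases "b = y") auto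
  have sA': "A' = ?A1 @ [x + 1..y] @ ?A3"
  proof (rule strict_sorted_equal)
    show "incr (?A1 @ [x + 1..y] @ ?A3)"
      using c by (auto simp: sorted_wrt_append sorted_wrt_filter)
    show "set A' = set (?A1 @ [x + 1..y] @ ?A3)" unfolding A'(2) using c by auto
  qed fact
  have sB': "B' = ?B1 @ [x..y] @ ?B3"
  proof (rule strict_sorted_equal)
    show "incr (?B1 @ [x..y] @ ?B3)"
      using c by (auto simp: sorted_wrt_append sorted_wrt_filter dest!: B3)
    have "{x..y} \<subseteq> insert y (set B)"
    proof
      fix z assume "z \<in> {x..y}"
      then show "z \<in> insert y (set B)" using c by (cases "z = y") auto
    qed
    moreover have "insert y (set B) = {b \<in> set B. b < x} \<union> insert y {b \<in> set B. x \<le> b}" by auto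
    ultimately show "set B' = set (?B1 @ [x..y] @ ?B3)" unfolding B'(2) using c by fastforce
  qed fact
  have upx: "[x..y] = x # [x + 1..y]" using c by (simp add: upto_rec1)
  have upy: "[x..y] = [x..y - 1] @ [y]" using c by (simp add: upto_rec2)
  show lenA: "length A = Suc (length A')"
    using arg_cong[OF sA, of length] arg_cong[OF sA', of length] upx by simp
  show "length B' = Suc (length B)"
    using arg_cong[OF sB, of length] arg_cong[OF sB', of length] upy by simp
  have full: "length (gr ?A1 ?B1) = length ?B1"
  proof (rule gr_full)
    fix v
    have "{b \<in> set ?B1. v \<le> b} = {b \<in> set B. v \<le> b \<and> b < x}" "{a \<in> set ?A1. v < a} = {a \<in> set A. v < a \<and> a < x}" by auto
    then show "card {b \<in> set ?B1. v \<le> b} \<le> card {a \<in> set ?A1. v < a}" using c by auto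
  qed (use c in \<open>auto simp: sorted_wrt_filter\<close>)
  \<comment> \<open>\<open>D\<close> will be the part from \<open>x\<close> on of \<open>B\<close>
    or of \<open>B'\<close>; the additional \<open>y\<close> does not disturb the Hall
    condition.\<close>
  have tail: "gr ([x + 1..y] @ ?A3) D = [x + 1..y] @ ?A3"
    if D: "incr D" "{b \<in> set B. x \<le> b} \<subseteq> set D" for D
  proof (rule gr_eq_left)
    fix w
    have "card {a \<in> set ([x + 1..y] @ ?A3). a \<le> w} \<le> card {a \<in> set A. x < a \<and> a \<le> w}"
      by (intro card_mono) (use c in auto)
    also have "\<dots> \<le> card {b \<in> set B. x \<le> b \<and> b < w}" using c by blast
    also have "\<dots> \<le> card {b \<in> set D. b < w}" by (intro card_mono) (use D in auto)
    finally show "card {a \<in> set ([x + 1..y] @ ?A3). a \<le> w} \<le> card {b \<in> set D. b < w}" .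
  qed (use c D in \<open>auto simp: sorted_wrt_append sorted_wrt_filter\<close>)
  let ?C = "[x..y - 1] @ ?B3" and ?C' = "[x..y] @ ?B3"
  have sC: "incr ?C" "incr ?C'"
    using c by (auto simp: sorted_wrt_append sorted_wrt_filter dest!: B3)
  have t1: "gr ([x + 1..y] @ ?A3) ?C = [x + 1..y] @ ?A3" using c by (intro tail[OF sC(1)]) auto
  have t2: "gr ([x + 1..y] @ ?A3) ?C' = [x + 1..y] @ ?A3" using c by (intro tail[OF sC(2)]) auto
  have le: "\<forall>a\<in>set ?A1. \<forall>b\<in>set ?C. a \<le> b" "\<forall>a\<in>set ?A1. \<forall>b\<in>set ?C'. a \<le> b" using c by auto
  have "gr ([x] @ ([x + 1..y] @ ?A3)) ?C = gr ([x + 1..y] @ ?A3) ?C" using c by (intro gr_skip_le) auto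
  then have "gr (?A1 @ [x..y] @ ?A3) (?B1 @ ?C) = gr ?A1 ?B1 @ [x + 1..y] @ ?A3"
    using gr_append[OF full le(1), of "[x..y] @ ?A3"] t1 upx by simp
  then have grAB: "gr A B = gr ?A1 ?B1 @ [x + 1..y] @ ?A3" using sA sB by metis
  have "gr (?A1 @ [x + 1..y] @ ?A3) (?B1 @ ?C') = gr ?A1 ?B1 @ [x + 1..y] @ ?A3"
    using gr_append[OF full le(2), of "[x + 1..y] @ ?A3"] t2 by simp
  then show "gr A' B' = gr A B" using sA' sB' grAB by metis
  show "length (gr A B) < length A"
    unfolding lenA using grAB arg_cong[OF sA', of length] length_gr_le(1)[of ?A1 ?B1] by simp
  have A3: "a > y + 1" if "a \<in> set ?A3" for a using that c by (cases "a = y + 1") auto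
  have B1: "b < x - 1" if "b \<in> set ?B1" for b using that c by (cases "b = x - 1") auto
  have com: "perm_word ((?A3 @ ?B1) @ [x..m]) = perm_word ([x..m] @ (?A3 @ ?B1))" if "m \<le> y" for m
    by (rule perm_word_commute_lists) (use A3 B1 that in force)
  have "perm_word (A @ B) k = perm_word (A' @ B') k" for k
  proof -
    have "perm_word (A @ B) k = perm_word ((?A1 @ [x..y] @ ?A3) @ (?B1 @ [x..y - 1] @ ?B3)) k"
      using sA sB by metis
    also have "\<dots> = perm_word ?A1 (perm_word [x..y] (perm_word ((?A3 @ ?B1) @ [x..y - 1]) (perm_word ?B3 k)))"
      by (simp add: perm_word_append_apply)
    also have "\<dots> = perm_word ?A1 (perm_word ([x..y] @ [x..y - 1]) (perm_word (?A3 @ ?B1) (perm_word ?B3 k)))"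
      using com[of "y - 1"] by (simp add: perm_word_append_apply)
    also have "\<dots> = perm_word ?A1 (perm_word ([x + 1..y] @ [x..y]) (perm_word (?A3 @ ?B1) (perm_word ?B3 k)))"
      using perm_word_upto_shift[of x y] c by simp
    also have "\<dots> = perm_word ?A1 (perm_word [x + 1..y] (perm_word ([x..y] @ (?A3 @ ?B1)) (perm_word ?B3 k)))"
      by (simp add: perm_word_append_apply)
    also have "\<dots> = perm_word ?A1 (perm_word [x + 1..y] (perm_word ((?A3 @ ?B1) @ [x..y]) (perm_word ?B3 k)))"
      using com[of y] by simp
    also have "\<dots> = perm_word ((?A1 @ [x + 1..y] @ ?A3) @ (?B1 @ [x..y] @ ?B3)) k"
      by (simp add: perm_word_append_apply)
    also have "\<dots> = perm_word (A' @ B') k" using sA' sB' by metis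
    finally show ?thesis .
  qed
  then show "perm_word (A' @ B') = perm_word (A @ B)" by auto
qed

section \<open>The pairing of two increasing words\<close>

lemma pairing_Nil [simp]: "pairing A [] = ({}, {})"
  by (simp add: pairing_def)

text \<open>Pairing starts from the largest letter, so the head of an increasing word is treated
  last.\<close>

lemma pairing_Cons:
  assumes "incr (b # B)" shows "pairing A (b # B) = pair_step A (pairing A B) b"
proof -
  have "sorted (b # B)" using assms by (rule strict_sorted_imp_sorted)
  then have "sort (b # B) = b # B" "sort B = B" using sorted_sort_id[of "b # B"] sorted_sort_id[of B] by simp_all
  then show ?thesis by (simp add: pairing_def del: sort_key_simps)
qed

lemma pairing_cases:
  assumes "incr (b # B)"
  obtains (unpaired) "\<forall>a\<in>set A. b < a \<longrightarrow> a \<in> fst (pairing A B)" "pairing A (b # B) = pairing A B"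
  | (paired) c where "c \<in> set A" "b < c" "c \<notin> fst (pairing A B)"
    "\<forall>a\<in>set A. b < a \<longrightarrow> a \<notin> fst (pairing A B) \<longrightarrow> c \<le> a"
    "fst (pairing A (b # B)) = insert c (fst (pairing A B))" "snd (pairing A (b # B)) = insert b (snd (pairing A B))"
proof -
  let ?C = "{a \<in> set A. b < a \<and> a \<notin> fst (pairing A B)}"
  note step = pairing_Cons[OF assms, of A, unfolded pair_step_def Let_def]
  have fin: "finite ?C" by simp
  show ?thesis
  proof (cases "?C = {}")
    case True
    then show ?thesis using unpaired step by auto
  next
    case False
    have "Min ?C \<in> ?C" using fin False by (rule Min_in)
    moreover have "Min ?C \<le> a" if "a \<in> ?C" for a using fin that by (rule Min_le)
    moreover have "fst (pairing A (b # B)) = insert (Min ?C) (fst (pairing A B))"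
      "snd (pairing A (b # B)) = insert b (snd (pairing A B))" using False step by auto
    ultimately show ?thesis using paired[of "Min ?C"] by blast
  qed
qed

lemma pairing_subset:
  assumes "incr B" shows "fst (pairing A B) \<subseteq> set A \<and> snd (pairing A B) \<subseteq> set B"
  using assms
proof (induction B)
  case (Cons b B)
  then show ?case by (cases rule: pairing_cases[OF Cons.prems, of A]) auto
qed simp

lemma pairing_mono:
  assumes "incr (C @ B)" 
  shows "fst (pairing A B) \<subseteq> fst (pairing A (C @ B)) \<and> snd (pairing A B) \<subseteq> snd (pairing A (C @ B))"
  using assms
proof (induction C)
  case (Cons c C)
  then have s: "incr (c # (C @ B))" by simp
  show ?case using Cons by (cases rule: pairing_cases[OF s, of A]) auto
qed simp

lemma card_insert_filter:
  assumes "finite P" shows "card {a \<in> insert c P. Q a} \<le> (if Q c then 1 else 0) + card {a \<in> P. Q a}"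
proof -
  have "{a \<in> insert c P. Q a} \<subseteq> (if Q c then {c} else {}) \<union> {a \<in> P. Q a}" by auto
  then have "card {a \<in> insert c P. Q a} \<le> card ((if Q c then {c} else {}) \<union> {a \<in> P. Q a})"
    using assms by (intro card_mono) auto
  also have "\<dots> \<le> card (if Q c then {c} else {}) + card {a \<in> P. Q a}" by (rule card_Un_le)
  finally show ?thesis by (auto split: if_splits)
qed

text \<open>Every paired letter of \<open>A\<close> exceeds its own partner in
  \<open>B\<close>.\<close>

lemma pairing_count:
  assumes "incr B"
  shows "card {a \<in> fst (pairing A B). a \<le> w} \<le> card {b \<in> set B. b < w}"
  using assms
proof (induction B)
  case (Cons b B)
  then have sB: "incr B" and nb: "b \<notin> set B" by auto
  have IH: "card {a \<in> fst (pairing A B). a \<le> w} \<le> card {b \<in> set B. b < w}" using Cons.IH sB by blast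
  have fin: "finite (fst (pairing A B))" using pairing_subset[OF sB, of A] finite_subset by blast
  show ?case
  proof (cases rule: pairing_cases[OF Cons.prems, of A])
    case 1
    then show ?thesis using IH unfolding card_filter_Cons[OF nb] by simp
  next
    case (2 c)
    have "card {a \<in> fst (pairing A (b # B)). a \<le> w} \<le> (if c \<le> w then 1 else 0) + card {a \<in> fst (pairing A B). a \<le> w}"
      unfolding 2(5) using fin by (rule card_insert_filter)
    then show ?thesis using IH 2(2) unfolding card_filter_Cons[OF nb] by (auto split: if_splits)
  qed
qed simp

text \<open>\<open>B1\<close> is treated after \<open>B2\<close>. If each of its letters finds a
  partner below \<open>m\<close>, the pairing from \<open>m\<close> on is that of \<open>B2\<close>
  alone, and these partners account for the count.\<close>

lemma pairing_below:
  assumes "incr (B1 @ B2)"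
    "\<And>b C D c. B1 = C @ b # D \<Longrightarrow> c \<in> fst (pairing A (b # D @ B2)) \<Longrightarrow> c \<notin> fst (pairing A (D @ B2)) \<Longrightarrow> c < m"
    "\<And>b C D. B1 = C @ b # D \<Longrightarrow> pairing A (b # D @ B2) \<noteq> pairing A (D @ B2)"
  shows "fst (pairing A (B1 @ B2)) \<inter> {m..} = fst (pairing A B2) \<inter> {m..} \<and>
    card {b \<in> set B1. v \<le> b} \<le> card {a \<in> fst (pairing A (B1 @ B2)). v < a \<and> a < m}"
  using assms
proof (induction B1)
  case (Cons b B1)
  have s: "incr (b # (B1 @ B2))" and nb: "b \<notin> set B1" using Cons.prems(1) by auto
  have sB: "incr (B1 @ B2)" using s by simp
  have IH: "fst (pairing A (B1 @ B2)) \<inter> {m..} = fst (pairing A B2) \<inter> {m..} \<and>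
    card {b \<in> set B1. v \<le> b} \<le> card {a \<in> fst (pairing A (B1 @ B2)). v < a \<and> a < m}"
  proof (rule Cons.IH[OF sB])
    fix b' C D c assume "B1 = C @ b' # D" "c \<in> fst (pairing A (b' # D @ B2))" "c \<notin> fst (pairing A (D @ B2))"
    then show "c < m" using Cons.prems(2)[of "b # C" b' D c] by simp
  next
    fix b' C D assume "B1 = C @ b' # D"
    then show "pairing A (b' # D @ B2) \<noteq> pairing A (D @ B2)" using Cons.prems(3)[of "b # C" b' D] by simp
  qed
  have fin: "finite (fst (pairing A (B1 @ B2)))" using pairing_subset[OF sB, of A] finite_subset by blast
  show ?case
  proof (cases rule: pairing_cases[OF s, of A])
    case 1
    then show ?thesis using Cons.prems(3)[of "[]" b B1] by simp
  next
    case (2 c)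
    have cm: "c < m" using Cons.prems(2)[of "[]" b B1 c] 2(3,5) by simp
    let ?P = "fst (pairing A (B1 @ B2))"
    have "{a \<in> insert c ?P. v < a \<and> a < m} = (if v < c then insert c {a \<in> ?P. v < a \<and> a < m} else {a \<in> ?P. v < a \<and> a < m})"
      using cm by auto
    then have "card {a \<in> insert c ?P. v < a \<and> a < m} = (if v < c then 1 else 0) + card {a \<in> ?P. v < a \<and> a < m}"
      using fin 2(3) by simp
    then have "card {b' \<in> set (b # B1). v \<le> b'} \<le> card {a \<in> insert c ?P. v < a \<and> a < m}"
      unfolding card_filter_Cons[OF nb] using IH 2(2) by auto
    then show ?thesis using IH cm 2(5) by auto
  qed
qed simp

text \<open>\<open>x\<close> remains available throughout, so every letter of \<open>B\<close> below
  \<open>x\<close> finds a partner, and one below \<open>x\<close>. The letters of \<open>A\<close>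
  above \<open>x\<close> are all paired, hence with letters of \<open>B\<close> from
  \<open>x\<close> on. This yields the Hall conditions; reducedness and counting yield the
  runs.\<close>

lemma pairing_f_config:
  assumes A: "incr A" and B: "incr B" and red: "fpf_reduced (X @ A @ B @ Y)"
    and x: "x \<in> set A" "x \<notin> fst (pairing A B)" "\<And>a. a \<in> set A \<Longrightarrow> a \<notin> fst (pairing A B) \<Longrightarrow> a \<le> x"
    and y: "x \<le> y" "y \<notin> set B" "{x..y - 1} \<subseteq> set B"
  shows "config A B x y"
proof -
  let ?B1 = "filter (\<lambda>b. b < x) B" and ?B2 = "filter (\<lambda>b. x - 1 < b) B"
  have sB: "B = ?B1 @ ?B2" using sorted_split[OF B, of x "x - 1"] by simp
  have s: "incr (?B1 @ ?B2)" using B sB by metis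
  have s2: "incr ?B2" using B by (rule sorted_wrt_filter)
  have new: "pairing A (b # D @ ?B2) \<noteq> pairing A (D @ ?B2) \<and>
      (\<forall>c. c \<in> fst (pairing A (b # D @ ?B2)) \<longrightarrow> c \<notin> fst (pairing A (D @ ?B2)) \<longrightarrow> c < x)"
    if split: "?B1 = C @ b # D" for b C D
  proof -
    have "incr (C @ (b # D @ ?B2))" using s split by simp
    then have sD: "incr (b # (D @ ?B2))" and "fst (pairing A (b # (D @ ?B2))) \<subseteq> fst (pairing A B)"
      using pairing_mono[of C "b # (D @ ?B2)" A] sB split by (auto simp: sorted_wrt_append)
    then have nx: "x \<notin> fst (pairing A (b # (D @ ?B2)))" using x(2) by blast
    have "b \<in> set ?B1" using split by simp
    then have bx: "b < x" by simp
    show ?thesis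
    proof (cases rule: pairing_cases[OF sD, of A])
      case 1
      then show ?thesis using nx bx x(1) by metis
    next
      case (2 c)
      then have cx: "c < x" using nx bx x(1) by (metis insertI1 insertI2 order_le_less)
      have "pairing A (b # D @ ?B2) \<noteq> pairing A (D @ ?B2)" using 2(3,5) by (metis insertI1)
      moreover have "\<forall>d. d \<in> fst (pairing A (b # D @ ?B2)) \<longrightarrow> d \<notin> fst (pairing A (D @ ?B2)) \<longrightarrow> d < x"
        unfolding 2(5) using cx by blast
      ultimately show ?thesis by blast
    qed
  qed
  have new1: "c < x" if "?B1 = C @ b # D" "c \<in> fst (pairing A (b # D @ ?B2))" "c \<notin> fst (pairing A (D @ ?B2))" for b C D c
    using conjunct2[OF new[OF that(1)]] that(2,3) by blast
  have new2: "pairing A (b # D @ ?B2) \<noteq> pairing A (D @ ?B2)" if "?B1 = C @ b # D" for b C D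
    using conjunct1[OF new[OF that]] .
  note below' = pairing_below[OF s, of A x, OF new1 new2, folded sB]
  have below: "fst (pairing A B) \<inter> {x..} = fst (pairing A ?B2) \<inter> {x..} \<and>
    card {b \<in> set ?B1. v \<le> b} \<le> card {a \<in> fst (pairing A B). v < a \<and> a < x}" for v
    by (rule below')
  have PA: "fst (pairing A B) \<subseteq> set A" using pairing_subset[OF B] by blast
  have alpha: "card {b \<in> set B. v \<le> b \<and> b < x} \<le> card {a \<in> set A. v < a \<and> a < x}" for v
  proof -
    have "{b \<in> set B. v \<le> b \<and> b < x} = {b \<in> set ?B1. v \<le> b}" by auto
    also have "card \<dots> \<le> card {a \<in> fst (pairing A B). v < a \<and> a < x}" using below by blast
    also have "\<dots> \<le> card {a \<in> set A. v < a \<and> a < x}" using PA by (intro card_mono) auto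
    finally show ?thesis .
  qed
  have beta: "card {a \<in> set A. x < a \<and> a \<le> w} \<le> card {b \<in> set B. x \<le> b \<and> b < w}" for w
  proof -
    have "a \<in> fst (pairing A ?B2)" if "a \<in> set A" "x < a" for a
    proof -
      have "a \<in> fst (pairing A B)" using x(3)[OF that(1)] that(2) by fastforce
      then have "a \<in> fst (pairing A B) \<inter> {x..}" using that by simp
      then have "a \<in> fst (pairing A ?B2) \<inter> {x..}" using conjunct1[OF below[of 0]] by simp
      then show ?thesis by simp
    qed
    moreover have "finite (fst (pairing A ?B2))" using pairing_subset[OF s2, of A] finite_subset by blast
    ultimately have "card {a \<in> set A. x < a \<and> a \<le> w} \<le> card {a \<in> fst (pairing A ?B2). a \<le> w}"
      by (intro card_mono) auto
    also have "\<dots> \<le> card {b \<in> set ?B2. b < w}" using s2 by (rule pairing_count)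
    also have "{b \<in> set ?B2. b < w} = {b \<in> set B. x \<le> b \<and> b < w}" by auto
    finally show ?thesis .
  qed
  have x1: "x - 1 \<notin> set B"
  proof
    assume "x - 1 \<in> set B"
    then have "card {b \<in> set B. x - 1 \<le> b \<and> b < x} > 0" by (subst card_gt_0_iff) auto
    moreover have "{a \<in> set A. x - 1 < a \<and> a < x} = {}" by auto
    ultimately show False using alpha[of "x - 1"] by (metis card.empty not_le)
  qed
  \<comment> \<open>A gap of \<open>A\<close> at \<open>k + 1\<close> would leave the run from
    \<open>x\<close> to \<open>k\<close> in both words, as excluded by
    \<open>overlap_not_reduced\<close>.\<close>
  have inA: "{x..k} \<subseteq> set A" if "x \<le> k" "k \<le> y" for k
    using that
  proof (induction k rule: int_ge_induct)
    case base
    then show ?case using x(1) by simp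
  next
    case (step k)
    have kA: "{x..k} \<subseteq> set A" using step by simp
    have "k + 1 \<in> set A"
    proof (rule ccontr)
      assume "k + 1 \<notin> set A"
      moreover have "{x..k} \<subseteq> set B" using y(3) step.prems by auto
      ultimately show False using overlap_not_reduced[OF A kA _ B _ x1 step.hyps(1)] red by blast
    qed
    moreover have "{x..k + 1} = insert (k + 1) {x..k}" using step by auto
    ultimately show ?case using kA by simp
  qed
  \<comment> \<open>Otherwise the letters of \<open>A\<close> from \<open>x + 1\<close> to
    \<open>y + 1\<close> would face only those of \<open>B\<close> from \<open>x\<close> to
    \<open>y - 1\<close>, one fewer.\<close>
  have "y + 1 \<notin> set A"
  proof
    assume y1: "y + 1 \<in> set A"
    have "{x + 1..y + 1} \<subseteq> {a \<in> set A. x < a \<and> a \<le> y + 1}"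
    proof
      fix a assume "a \<in> {x + 1..y + 1}"
      then show "a \<in> {a \<in> set A. x < a \<and> a \<le> y + 1}" using y1 inA[of y] y(1) by (cases "a = y + 1") auto
    qed
    then have "card {x + 1..y + 1} \<le> card {a \<in> set A. x < a \<and> a \<le> y + 1}" by (intro card_mono) auto
    also have "\<dots> \<le> card {b \<in> set B. x \<le> b \<and> b < y + 1}" by (rule beta)
    also have "\<dots> \<le> card {x..y - 1}"
    proof (rule card_mono)
      show "{b \<in> set B. x \<le> b \<and> b < y + 1} \<subseteq> {x..y - 1}"
      proof
        fix b assume "b \<in> {b \<in> set B. x \<le> b \<and> b < y + 1}"
        then show "b \<in> {x..y - 1}" using y(2) by (cases "b = y") auto
      qed
    qed simp
    finally show False using y(1) by simp
  qed
  then show ?thesis unfolding config_def using A B y x1 inA[of y] alpha beta by blast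
qed

lemma pairing_snd_append:
  assumes "incr (C @ E)" shows "snd (pairing A (C @ E)) \<subseteq> set C \<union> snd (pairing A E)"
  using assms
proof (induction C)
  case (Cons c C)
  then have s: "incr (c # (C @ E))" by simp
  have IH: "snd (pairing A (C @ E)) \<subseteq> set C \<union> snd (pairing A E)" using Cons by simp
  show ?case
  proof (cases rule: pairing_cases[OF s, of A])
    case 1
    then show ?thesis using IH by auto
  next
    case 2
    then show ?thesis using IH by auto
  qed
qed simp

text \<open>\<open>y\<close> finds no partner, so all letters of \<open>A\<close> above
  \<open>y\<close> were taken by larger letters of \<open>B\<close>. The letters of \<open>B\<close>
  below \<open>y\<close> are all paired, hence only with letters up to \<open>y\<close>.\<close>

lemma pairing_e_hall:
  assumes A: "incr A" and B: "incr B"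
    and y: "y \<in> set B" "y \<notin> snd (pairing A B)" "\<And>b. b \<in> set B \<Longrightarrow> b \<notin> snd (pairing A B) \<Longrightarrow> y \<le> b"
  shows "card {a \<in> set A. y < a \<and> a \<le> w} \<le> card {b \<in> set B. y < b \<and> b < w}"
    "card {b \<in> set B. v \<le> b \<and> b < y} \<le> card {a \<in> set A. v < a \<and> a \<le> y}"
proof -
  let ?B1 = "filter (\<lambda>b. b < y) B" and ?B2 = "filter (\<lambda>b. y < b) B"
  have sB: "B = ?B1 @ (y # ?B2)" using sorted_split[OF B, of y y] y(1) by simp
  have s: "incr (?B1 @ (y # ?B2))" using B sB by metis
  have s2: "incr (y # ?B2)" "incr ?B2" using s by (auto simp: sorted_wrt_append)
  have snd_sub: "snd (pairing A (y # ?B2)) \<subseteq> snd (pairing A B)"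
    using pairing_mono[OF s, of A, folded sB] by blast
  have up: "\<forall>a\<in>set A. y < a \<longrightarrow> a \<in> fst (pairing A ?B2)" and eq: "pairing A (y # ?B2) = pairing A ?B2"
  proof -
    have "(\<forall>a\<in>set A. y < a \<longrightarrow> a \<in> fst (pairing A ?B2)) \<and> pairing A (y # ?B2) = pairing A ?B2"
    proof (cases rule: pairing_cases[OF s2(1), of A])
      case 1
      then show ?thesis by blast
    next
      case (2 c)
      then have "y \<in> snd (pairing A (y # ?B2))" by (metis insertI1)
      then show ?thesis using snd_sub y(2) by blast
    qed
    then show "\<forall>a\<in>set A. y < a \<longrightarrow> a \<in> fst (pairing A ?B2)" "pairing A (y # ?B2) = pairing A ?B2" by blast+
  qed
  have fin: "finite (fst (pairing A ?B2))" using pairing_subset[OF s2(2), of A] finite_subset by blast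
  have "card {a \<in> set A. y < a \<and> a \<le> w} \<le> card {a \<in> fst (pairing A ?B2). a \<le> w}"
    using up fin by (intro card_mono) auto
  also have "\<dots> \<le> card {b \<in> set ?B2. b < w}" using s2(2) by (rule pairing_count)
  also have "{b \<in> set ?B2. b < w} = {b \<in> set B. y < b \<and> b < w}" by auto
  finally show "card {a \<in> set A. y < a \<and> a \<le> w} \<le> card {b \<in> set B. y < b \<and> b < w}" .
  have tail: "incr (C @ (b # D @ y # ?B2)) \<and> B = C @ (b # D @ y # ?B2)" if "?B1 = C @ b # D" for C b D
  proof -
    have "?B1 @ (y # ?B2) = C @ (b # D @ y # ?B2)" using that by simp
    then show ?thesis using s sB by metis
  qed
  have new1: "c < y + 1" if "?B1 = C @ b # D" "c \<in> fst (pairing A (b # D @ y # ?B2))" "c \<notin> fst (pairing A (D @ y # ?B2))" for b C D c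
  proof (rule ccontr)
    assume "\<not> c < y + 1"
    have sD: "incr (b # D @ y # ?B2)" "incr (D @ y # ?B2)"
      using tail[OF that(1)] by (auto simp: sorted_wrt_append)
    have "c \<in> set A" using pairing_subset[OF sD(1), of A] that(2) by blast
    then have "c \<in> fst (pairing A (y # ?B2))" using up \<open>\<not> c < y + 1\<close> eq by simp
    then show False using pairing_mono[OF sD(2), of A] that(3) by blast
  qed
  have new2: "pairing A (b # D @ y # ?B2) \<noteq> pairing A (D @ y # ?B2)" if "?B1 = C @ b # D" for b C D
  proof
    assume e: "pairing A (b # D @ y # ?B2) = pairing A (D @ y # ?B2)"
    note t = tail[OF that]
    have sD: "incr (D @ y # ?B2)" and nb: "b \<notin> set C" "b \<notin> set (D @ y # ?B2)"
      using t by (auto simp: sorted_wrt_append)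
    have "b \<in> set ?B1" using that by simp
    then have "b \<in> set B" "b < y" by auto
    then have bB: "b \<in> snd (pairing A B)" using y(3)[of b] by fastforce
    have "pairing A B = pairing A (C @ (b # D @ y # ?B2))" using conjunct2[OF t] by (rule arg_cong)
    with bB have "b \<in> snd (pairing A (C @ (b # D @ y # ?B2)))" by (rule subst[rotated])
    then have "b \<in> set C \<union> snd (pairing A (b # D @ y # ?B2))"
      using pairing_snd_append[OF conjunct1[OF t], of A] by blast
    then show False using nb e pairing_subset[OF sD, of A] by auto
  qed
  note below' = pairing_below[OF s, of A "y + 1", OF new1 new2, folded sB]
  have below: "fst (pairing A B) \<inter> {y + 1..} = fst (pairing A (y # ?B2)) \<inter> {y + 1..} \<and>
    card {b \<in> set ?B1. v \<le> b} \<le> card {a \<in> fst (pairing A B). v < a \<and> a < y + 1}"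
    by (rule below')
  have "{b \<in> set B. v \<le> b \<and> b < y} = {b \<in> set ?B1. v \<le> b}" by auto
  also have "card \<dots> \<le> card {a \<in> fst (pairing A B). v < a \<and> a < y + 1}" using below by blast
  also have "\<dots> \<le> card {a \<in> set A. v < a \<and> a \<le> y}" using pairing_subset[OF B, of A] by (intro card_mono) auto
  finally show "card {b \<in> set B. v \<le> b \<and> b < y} \<le> card {a \<in> set A. v < a \<and> a \<le> y}" .
qed

text \<open>The configuration is that of the new pair, since \<open>e_pair\<close> runs the transfer
  backwards. Its Hall conditions come from those at \<open>y\<close> after accounting for the runs
  between \<open>x\<close> and \<open>y\<close>.\<close>

lemma pairing_e_config:
  assumes A: "incr A" and B: "incr B" and red: "fpf_reduced (X @ A @ B @ Y)"
    and y: "y \<in> set B" "y \<notin> snd (pairing A B)" "\<And>b. b \<in> set B \<Longrightarrow> b \<notin> snd (pairing A B) \<Longrightarrow> y \<le> b"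
    and x: "x \<le> y" "x \<notin> set A" "{x + 1..y} \<subseteq> set A"
    and A': "incr A'" "set A' = insert x (set A)"
    and B': "incr B'" "set B' = set B - {y}"
  shows "config A' B' x y"
proof -
  note hall = pairing_e_hall[OF A B y]
  have y1: "y + 1 \<notin> set A"
  proof
    assume "y + 1 \<in> set A"
    then have "card {a \<in> set A. y < a \<and> a \<le> y + 1} > 0" by (subst card_gt_0_iff) (auto intro!: exI[of _ "y + 1"])
    moreover have "{b \<in> set B. y < b \<and> b < y + 1} = {}" by auto
    ultimately show False using hall(1)[of "y + 1"] by (metis card.empty not_le)
  qed
  have inB: "{k..y} \<subseteq> set B" if "k \<le> y" "x \<le> k" for k
    using that
  proof (induction k rule: int_le_induct)
    case base
    then show ?case using y(1) by simp
  next
    case (step k)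
    have kB: "{k..y} \<subseteq> set B" using step by simp
    have "k - 1 \<in> set B"
    proof (rule ccontr)
      assume k1: "k - 1 \<notin> set B"
      have kA: "{k..y} \<subseteq> set A" using x(3) step.prems by auto
      show False using overlap_not_reduced[OF A kA y1 B kB k1 step.hyps(1)] red by blast
    qed
    moreover have "{k - 1..y} = insert (k - 1) {k..y}" using step by auto
    ultimately show ?case using kB by simp
  qed
  have xyB: "{x..y} \<subseteq> set B" using inB[of x] x(1) by simp
  have x1: "x - 1 \<notin> set B"
  proof
    assume xB: "x - 1 \<in> set B"
    have "{x - 1..y - 1} \<subseteq> {b \<in> set B. x - 1 \<le> b \<and> b < y}"
    proof
      fix b assume "b \<in> {x - 1..y - 1}"
      then show "b \<in> {b \<in> set B. x - 1 \<le> b \<and> b < y}" using xB xyB by (cases "b = x - 1") auto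
    qed
    then have "card {x - 1..y - 1} \<le> card {b \<in> set B. x - 1 \<le> b \<and> b < y}" by (intro card_mono) auto
    also have "\<dots> \<le> card {a \<in> set A. x - 1 < a \<and> a \<le> y}" by (rule hall(2))
    also have "\<dots> \<le> card {x + 1..y}"
    proof (rule card_mono)
      show "{a \<in> set A. x - 1 < a \<and> a \<le> y} \<subseteq> {x + 1..y}"
      proof
        fix a assume "a \<in> {a \<in> set A. x - 1 < a \<and> a \<le> y}"
        then show "a \<in> {x + 1..y}" using x(2) by (cases "a = x") auto
      qed
    qed simp
    finally show False using x(1) by simp
  qed
  have alpha: "card {b \<in> set B'. v \<le> b \<and> b < x} \<le> card {a \<in> set A'. v < a \<and> a < x}" for v
  proof (cases "v \<le> x")
    case True
    have e1: "{b \<in> set B. v \<le> b \<and> b < y} = {b \<in> set B'. v \<le> b \<and> b < x} \<union> {x..y - 1}"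
      unfolding B'(2) using True xyB x(1) by auto
    have e2: "{a \<in> set A. v < a \<and> a \<le> y} \<subseteq> {a \<in> set A'. v < a \<and> a < x} \<union> {x + 1..y}"
    proof
      fix a assume "a \<in> {a \<in> set A. v < a \<and> a \<le> y}"
      then show "a \<in> {a \<in> set A'. v < a \<and> a < x} \<union> {x + 1..y}" unfolding A'(2) using x(2) by (cases "a = x") auto
    qed
    have "card {b \<in> set B'. v \<le> b \<and> b < x} + card {x..y - 1} = card {b \<in> set B. v \<le> b \<and> b < y}"
      unfolding e1 by (intro card_Un_disjoint[symmetric]) auto
    also have "\<dots> \<le> card {a \<in> set A. v < a \<and> a \<le> y}" by (rule hall(2))
    also have "\<dots> \<le> card ({a \<in> set A'. v < a \<and> a < x} \<union> {x + 1..y})" using e2 by (intro card_mono) auto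
    also have "\<dots> \<le> card {a \<in> set A'. v < a \<and> a < x} + card {x + 1..y}" by (rule card_Un_le)
    finally show ?thesis by simp
  next
    case False
    then have "{b \<in> set B'. v \<le> b \<and> b < x} = {}" by auto
    then show ?thesis by (simp only: card.empty le0)
  qed
  have beta: "card {a \<in> set A'. x < a \<and> a \<le> w} \<le> card {b \<in> set B'. x \<le> b \<and> b < w}" for w
  proof (cases "w \<le> y")
    case True
    \<comment> \<open>All candidates lie in the run, so lowering them by one lands in the run from
      \<open>x\<close> to \<open>y - 1\<close> of \<open>B'\<close>.\<close>
    show ?thesis
    proof (rule card_inj_on_le)
      show "inj_on (\<lambda>a. a - 1) {a \<in> set A'. x < a \<and> a \<le> w}" by (simp add: inj_on_def)
      show "(\<lambda>a. a - 1) ` {a \<in> set A'. x < a \<and> a \<le> w} \<subseteq> {b \<in> set B'. x \<le> b \<and> b < w}"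
        unfolding B'(2) using True xyB by auto
    qed simp
  next
    case False
    have e1: "{a \<in> set A'. x < a \<and> a \<le> w} \<subseteq> {x + 1..y} \<union> {a \<in> set A. y < a \<and> a \<le> w}"
      unfolding A'(2) by auto
    have e2: "{x..y - 1} \<union> {b \<in> set B. y < b \<and> b < w} \<subseteq> {b \<in> set B'. x \<le> b \<and> b < w}"
      unfolding B'(2) using False xyB x(1) by auto
    have "card {a \<in> set A'. x < a \<and> a \<le> w} \<le> card ({x + 1..y} \<union> {a \<in> set A. y < a \<and> a \<le> w})"
      using e1 by (intro card_mono) auto
    also have "\<dots> \<le> card {x + 1..y} + card {a \<in> set A. y < a \<and> a \<le> w}" by (rule card_Un_le)
    also have "\<dots> \<le> card {x..y - 1} + card {b \<in> set B. y < b \<and> b < w}" using hall(1)[of w] by simp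
    also have "\<dots> = card ({x..y - 1} \<union> {b \<in> set B. y < b \<and> b < w})" by (intro card_Un_disjoint[symmetric]) auto
    also have "\<dots> \<le> card {b \<in> set B'. x \<le> b \<and> b < w}" using e2 by (intro card_mono) auto
    finally show ?thesis .
  qed
  have "{x..y} \<subseteq> set A'"
  proof
    fix a assume "a \<in> {x..y}"
    then show "a \<in> set A'" unfolding A'(2) using x(3) by (cases "a = x") auto
  qed
  moreover have "{x..y - 1} \<subseteq> set B'" "x - 1 \<notin> set B'" "y \<notin> set B'" unfolding B'(2) using xyB x1 by auto
  moreover have "y + 1 \<notin> set A'" unfolding A'(2) using y1 x(1) by simp
  ultimately show ?thesis unfolding config_def using A'(1) B'(1) x(1) alpha beta by blast
qed

lemma gr_all_paired_left:
  assumes A: "incr A" and B: "incr B" and "set A - fst (pairing A B) = {}"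
  shows "gr A B = A"
proof (rule gr_eq_left[OF A B])
  fix w
  have "set A = fst (pairing A B)" using assms(3) pairing_subset[OF B, of A] by blast
  then show "card {a \<in> set A. a \<le> w} \<le> card {b \<in> set B. b < w}" using pairing_count[OF B, of A w] by (simp only:)
qed

lemma gr_all_paired_right:
  assumes A: "incr A" and B: "incr B" and all: "set B - snd (pairing A B) = {}"
  shows "length (gr A B) = length B"
proof (rule gr_full[OF A B])
  fix v
  \<comment> \<open>A bound above all of \<open>A\<close>, so that lying below \<open>m\<close> is
    no restriction; the \<open>0\<close> only covers an empty \<open>A\<close>.\<close>
  define m where "m = Max (insert 0 (set A)) + 1"
  have m: "a < m" if "a \<in> set A" for a
    unfolding m_def using that Max_ge[of "insert 0 (set A)" a] by simp
  have s: "incr (B @ [])" using B by simp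
  have new1: "c < m" if "B = C @ b # D" "c \<in> fst (pairing A (b # D @ []))" "c \<notin> fst (pairing A (D @ []))" for b C D c
  proof -
    have "incr (b # D @ [])" using B that(1) by (simp add: sorted_wrt_append)
    then show ?thesis using pairing_subset[of "b # D @ []" A] that(2) m by blast
  qed
  have new2: "pairing A (b # D @ []) \<noteq> pairing A (D @ [])" if "B = C @ b # D" for b C D
  proof
    assume e: "pairing A (b # D @ []) = pairing A (D @ [])"
    have sD: "incr (C @ (b # D))" "incr D" and nb: "b \<notin> set C" "b \<notin> set D"
      using B that by (auto simp: sorted_wrt_append)
    have "b \<in> snd (pairing A B)" using all that by auto
    then have "b \<in> set C \<union> snd (pairing A (b # D))" using pairing_snd_append[OF sD(1), of A] that by blast
    then show False using nb e pairing_subset[OF sD(2), of A] by auto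
  qed
  have "fst (pairing A (B @ [])) \<inter> {m..} = fst (pairing A []) \<inter> {m..} \<and>
    card {b \<in> set B. v \<le> b} \<le> card {a \<in> fst (pairing A (B @ [])). v < a \<and> a < m}"
    by (rule pairing_below[OF s, of A m, OF new1 new2])
  then have "card {b \<in> set B. v \<le> b} \<le> card {a \<in> fst (pairing A (B @ [])). v < a \<and> a < m}" by blast
  also have "\<dots> \<le> card {a \<in> set A. v < a}" using pairing_subset[OF B, of A] by (intro card_mono) auto
  finally show "card {b \<in> set B. v \<le> b} \<le> card {a \<in> set A. v < a}" .
qed

section \<open>Crystal operators on pairs of factors\<close>

type_synonym pair_op = "int list \<Rightarrow> int list \<Rightarrow> (int list \<times> int list) option"

definition f_pair :: pair_op where
  "f_pair A B = (let U = set A - fst (pairing A B) in if U = {} then None else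
     (let x = Max U; y = (LEAST y. x \<le> y \<and> y \<notin> set B) in Some (remove1 x A, insort y B)))"

definition e_pair :: pair_op where
  "e_pair A B = (let U = set B - snd (pairing A B) in if U = {} then None else
     (let y = Min U; x = (GREATEST x. x \<le> y \<and> x \<notin> set A) in Some (insort x A, remove1 y B)))"

definition fbar_pair :: pair_op where
  "fbar_pair A B = (if A = [] \<or> (B \<noteq> [] \<and> Min (set B) \<le> Min (set A)) then None else
     (let x = Min (set A) in if x + 1 \<notin> set A then Some (remove1 x A, x # B)
       else Some (remove1 (x + 1) A, (x - 1) # B)))"

definition ebar_pair :: pair_op where
  "ebar_pair A B = (if B = [] \<or> (A \<noteq> [] \<and> Min (set A) \<le> Min (set B)) then None else
     (let x = Min (set B) in if even x then Some (insort x A, remove1 x B)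
       else Some (insort (x + 2) A, remove1 x B)))"

lemma ex_least_missing:
  fixes x :: int
  assumes "finite S" shows "\<exists>y\<ge>x. y \<notin> S \<and> {x..y - 1} \<subseteq> S"
proof -
  have "\<exists>k. x + int k \<notin> S"
  proof (rule ccontr)
    assume "\<not> (\<exists>k. x + int k \<notin> S)"
    then have "range (\<lambda>k. x + int k) \<subseteq> S" by auto
    moreover have "infinite (range (\<lambda>k. x + int k))" by (auto dest!: finite_imageD simp: inj_def)
    ultimately show False using assms finite_subset by blast
  qed
  then have k: "x + int (LEAST k. x + int k \<notin> S) \<notin> S" by (rule LeastI_ex)
  have "{x..x + int (LEAST k. x + int k \<notin> S) - 1} \<subseteq> S"
  proof
    fix z assume z: "z \<in> {x..x + int (LEAST k. x + int k \<notin> S) - 1}"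
    then have "nat (z - x) < (LEAST k. x + int k \<notin> S)" by auto
    then have "x + int (nat (z - x)) \<in> S" using not_less_Least by blast
    then show "z \<in> S" using z by simp
  qed
  then show ?thesis using k by (intro exI[of _ "x + int (LEAST k. x + int k \<notin> S)"]) simp
qed

lemma ex_greatest_missing:
  fixes y :: int
  assumes "finite S" shows "\<exists>x\<le>y. x \<notin> S \<and> {x + 1..y} \<subseteq> S"
proof -
  obtain z where z: "- y \<le> z" "z \<notin> uminus ` S" "{- y..z - 1} \<subseteq> uminus ` S"
    using ex_least_missing[of "uminus ` S" "- y"] assms by blast
  have "{- z + 1..y} \<subseteq> S"
  proof
    fix a assume "a \<in> {- z + 1..y}"
    then have "- a \<in> uminus ` S" using z(3) by auto
    then show "a \<in> S" by auto
  qed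
  moreover have "- z \<notin> S" using z(2) by force
  ultimately show ?thesis using z(1) by (intro exI[of _ "- z"]) simp
qed

lemma strict_sorted_remove1:
  fixes A :: "int list"
  assumes "incr A" shows "incr (remove1 x A)" "set (remove1 x A) = set A - {x}"
  using assms by (auto simp: strict_sorted_iff sorted_remove1)

lemma strict_sorted_insort:
  fixes A :: "int list"
  assumes "incr A" "x \<notin> set A" shows "incr (insort x A)" "set (insort x A) = insert x (set A)"
  using assms by (auto simp: strict_sorted_iff sorted_insort distinct_insort set_insort_key)

text \<open>A pair operator that moves one letter without changing the normal form, and that is undefined
  exactly when the number of bumped letters equals \<open>l\<close> of the two lengths.\<close>

definition letter_transfer :: "(nat \<Rightarrow> nat \<Rightarrow> nat) \<Rightarrow> (nat \<Rightarrow> nat) \<Rightarrow> (nat \<Rightarrow> nat) \<Rightarrow> pair_op \<Rightarrow> bool" where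
  "letter_transfer l p q op \<longleftrightarrow> (\<forall>X A B Y. incr A \<longrightarrow> incr B \<longrightarrow> fpf_reduced (X @ A @ B @ Y) \<longrightarrow>
     op A B = None \<and> length (gr A B) = l (length A) (length B) \<or>
     (\<exists>A2 B2. op A B = Some (A2, B2) \<and> incr A2 \<and> incr B2 \<and> gr A2 B2 = gr A B \<and>
       perm_word (A2 @ B2) = perm_word (A @ B) \<and> length A2 = p (length A) \<and> length B2 = q (length B) \<and>
       length (A2 @ B2) = length (A @ B) \<and> length (gr A B) < l (length A) (length B)))"

lemma letter_transfer_f_pair: "letter_transfer (\<lambda>a b. a) (\<lambda>a. a - 1) Suc f_pair"
  unfolding letter_transfer_def
proof (intro allI impI)
  fix X A B Y :: "int list"
  assume A: "incr A" and B: "incr B" and red: "fpf_reduced (X @ A @ B @ Y)"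
  let ?U = "set A - fst (pairing A B)"
  show "f_pair A B = None \<and> length (gr A B) = length A \<or>
     (\<exists>A2 B2. f_pair A B = Some (A2, B2) \<and> incr A2 \<and> incr B2 \<and> gr A2 B2 = gr A B \<and>
       perm_word (A2 @ B2) = perm_word (A @ B) \<and> length A2 = length A - 1 \<and> length B2 = Suc (length B) \<and>
       length (A2 @ B2) = length (A @ B) \<and> length (gr A B) < length A)"
  proof (cases "?U = {}")
    case True
    then have "f_pair A B = None" by (simp add: f_pair_def Let_def del: Diff_eq_empty_iff)
    then show ?thesis using gr_all_paired_left[OF A B True] by simp
  next
    case False
    define x where "x = Max ?U"
    have "finite ?U" by simp
    then have xU: "x \<in> ?U" and xmax: "\<And>a. a \<in> ?U \<Longrightarrow> a \<le> x" unfolding x_def using False by (auto intro: Max_in simp del: Diff_iff)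
    obtain y where y: "x \<le> y" "y \<notin> set B" "{x..y - 1} \<subseteq> set B" using ex_least_missing[of "set B" x] by auto
    have least: "(LEAST y. x \<le> y \<and> y \<notin> set B) = y"
    proof (rule Least_equality)
      fix z assume "x \<le> z \<and> z \<notin> set B"
      then show "y \<le> z" using y(3) by (meson atLeastAtMost_iff in_mono linorder_not_less zle_diff1_eq)
    qed (use y in simp)
    have conf: "config A B x y"
      by (rule pairing_f_config[OF A B red _ _ _ y]) (use xU xmax in auto)
    note A2 = strict_sorted_remove1[OF A, of x] and B2 = strict_sorted_insort[OF B y(2)]
    have "f_pair A B = Some (remove1 x A, insort y B)"
      using False least unfolding f_pair_def Let_def x_def[symmetric] by simp
    then show ?thesis using A2 B2 config_transfer[OF conf A2 B2] by simp
  qed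
qed

lemma letter_transfer_e_pair: "letter_transfer (\<lambda>a b. b) Suc (\<lambda>b. b - 1) e_pair"
  unfolding letter_transfer_def
proof (intro allI impI)
  fix X A B Y :: "int list"
  assume A: "incr A" and B: "incr B" and red: "fpf_reduced (X @ A @ B @ Y)"
  let ?U = "set B - snd (pairing A B)"
  show "e_pair A B = None \<and> length (gr A B) = length B \<or>
     (\<exists>A2 B2. e_pair A B = Some (A2, B2) \<and> incr A2 \<and> incr B2 \<and> gr A2 B2 = gr A B \<and>
       perm_word (A2 @ B2) = perm_word (A @ B) \<and> length A2 = Suc (length A) \<and> length B2 = length B - 1 \<and>
       length (A2 @ B2) = length (A @ B) \<and> length (gr A B) < length B)"
  proof (cases "?U = {}")
    case True
    then have "e_pair A B = None" by (simp add: e_pair_def Let_def del: Diff_eq_empty_iff)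
    then show ?thesis using gr_all_paired_right[OF A B True] by simp
  next
    case False
    define y where "y = Min ?U"
    have "finite ?U" by simp
    then have yU: "y \<in> ?U" and ymin: "\<And>b. b \<in> ?U \<Longrightarrow> y \<le> b" unfolding y_def using False by (auto intro: Min_in simp del: Diff_iff)
    obtain x where x: "x \<le> y" "x \<notin> set A" "{x + 1..y} \<subseteq> set A" using ex_greatest_missing[of "set A" y] by auto
    have greatest: "(GREATEST x. x \<le> y \<and> x \<notin> set A) = x"
    proof (rule Greatest_equality)
      fix z assume z: "z \<le> y \<and> z \<notin> set A"
      show "z \<le> x"
      proof (rule ccontr)
        assume "\<not> z \<le> x"
        then have "z \<in> {x + 1..y}" using z by simp
        then show False using x(3) z by blast
      qed
    qed (use x in simp)
    note A2 = strict_sorted_insort[OF A x(2)] and B2 = strict_sorted_remove1[OF B, of y]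
    have conf: "config (insort x A) (remove1 y B) x y"
      by (rule pairing_e_config[OF A B red _ _ _ x A2 B2]) (use yU ymin in auto)
    have sets: "set A = set (insort x A) - {x}" "set B = insert y (set (remove1 y B))" using A2 B2 x yU by auto
    \<comment> \<open>The transfer is applied from the new pair to \<open>(A, B)\<close>.\<close>
    note t = config_transfer[OF conf A sets(1) B sets(2)]
    have "length (gr A B) \<le> length (remove1 y B)" unfolding t(1) by (rule length_gr_le)
    then have less: "length (gr A B) < length B" using t(5) by simp
    have "e_pair A B = Some (insort x A, remove1 y B)"
      using False greatest unfolding e_pair_def Let_def y_def[symmetric] by simp
    moreover have "length (remove1 y B) = length B - 1" using t(5) by simp
    moreover have "length (insort x A @ remove1 y B) = length (A @ B)" using t(4,5) by simp
    ultimately show ?thesis using A2(1) B2(1) t(1,2,4) less by metis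
  qed
qed

text \<open>The flag restricts the statement to the first two factors.\<close>

definition equivariant :: "bool \<Rightarrow> pair_op \<Rightarrow> bool" where
  "equivariant first op \<longleftrightarrow> (\<forall>\<Psi> X A B Y X' A' B' Y' A2 B2. word_map \<Psi> \<longrightarrow> (first \<longrightarrow> X = []) \<longrightarrow>
     incr A \<longrightarrow> incr B \<longrightarrow> fpf_reduced (X @ A @ B @ Y) \<longrightarrow>
     \<Psi> (X @ A @ B @ Y) = X' @ A' @ B' @ Y' \<longrightarrow> length X' = length X \<longrightarrow> length A' = length A \<longrightarrow> length B' = length B \<longrightarrow>
     incr A' \<longrightarrow> incr B' \<longrightarrow> op A B = Some (A2, B2) \<longrightarrow>
     (\<exists>A2' B2'. op A' B' = Some (A2', B2') \<and> \<Psi> (X @ A2 @ B2 @ Y) = X' @ A2' @ B2' @ Y' \<and>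
       length A2' = length A2 \<and> length B2' = length B2 \<and> incr A2 \<and> incr B2 \<and>
       fpf_reduced (X @ A2 @ B2 @ Y)))"

lemma fpf_reduced_replace:
  assumes "fpf_reduced (X @ A @ B @ Y)" "perm_word (A2 @ B2) = perm_word (A @ B)" "length (A2 @ B2) = length (A @ B)"
  shows "fpf_reduced (X @ A2 @ B2 @ Y)"
  using conj_word_block[OF assms(2), of X Y] assms(3) by (intro fpf_reduced_cong[OF assms(1)]) simp_all

text \<open>The number of bumped letters and both lengths agree on the two sides, so the operator is
  defined on both or on neither; the results are matched through their normal forms.\<close>

lemma equivariant_letter_transfer:
  assumes lt: "letter_transfer l p q op" shows "equivariant False op"
  unfolding equivariant_def
proof (intro allI impI)
  fix \<Psi> X A B Y X' A' B' Y' A2 B2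
  assume \<Psi>: "word_map \<Psi>" and s: "incr A" "incr B" and red: "fpf_reduced (X @ A @ B @ Y)"
    and img: "\<Psi> (X @ A @ B @ Y) = X' @ A' @ B' @ Y'" "length X' = length X" "length A' = length A" "length B' = length B"
    and s': "incr A'" "incr B'" and op: "op A B = Some (A2, B2)"
  interpret word_map \<Psi> by fact
  have red': "fpf_reduced (X' @ A' @ B' @ Y')" using reduced[OF red] img(1) by simp
  have r: "length (gr A' B') = length (gr A B)" by (rule length_gr[OF s red img s'])
  have P: "incr A2" "incr B2" "gr A2 B2 = gr A B" "perm_word (A2 @ B2) = perm_word (A @ B)"
    "length A2 = p (length A)" "length B2 = q (length B)" "length (A2 @ B2) = length (A @ B)"
    "length (gr A B) < l (length A) (length B)"
    using lt[unfolded letter_transfer_def, rule_format, OF s red] op by auto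
  have "length (gr A' B') \<noteq> l (length A') (length B')" using r P(8) img(3,4) by simp
  then obtain A2' B2' where P': "op A' B' = Some (A2', B2')" "incr A2'" "incr B2'" "gr A2' B2' = gr A' B'"
    "perm_word (A2' @ B2') = perm_word (A' @ B')" "length A2' = p (length A')" "length B2' = q (length B')"
    using lt[unfolded letter_transfer_def, rule_format, OF s' red'] by blast
  have len: "length A2' = length A2" "length B2' = length B2" using P P' img by auto
  have "\<Psi> (X @ A2 @ B2 @ Y) = X' @ A2' @ B2' @ Y'"
    by (rule transport[OF s P(1,2,3,4,7) red img s' P'(2,3,4,5) len])
  moreover have "fpf_reduced (X @ A2 @ B2 @ Y)" by (rule fpf_reduced_replace[OF red P(4,7)])
  ultimately show "\<exists>A2' B2'. op A' B' = Some (A2', B2') \<and> \<Psi> (X @ A2 @ B2 @ Y) = X' @ A2' @ B2' @ Y' \<and>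
       length A2' = length A2 \<and> length B2' = length B2 \<and> incr A2 \<and> incr B2 \<and>
       fpf_reduced (X @ A2 @ B2 @ Y)"
    using P(1,2) P'(1) len by blast
qed

section \<open>The queer operators\<close>

text \<open>Moves at \<open>k\<close>, \<open>k + 1\<close> and so on, which carry a small letter to
  the right through an increasing row.\<close>

fun slide :: "nat \<Rightarrow> nat \<Rightarrow> int list \<Rightarrow> int list" where
  "slide k 0 w = w"
| "slide k (Suc m) w = slide (Suc k) m (ck k w)"

text \<open>On words \<open>fbar\<close> is one initial move and a slide that brings the second
  letter to the end of the first factor; its last triple starts at \<open>p - 3\<close>. For a
  single letter only the cut between the factors moves.\<close>

definition bar_word :: "nat \<Rightarrow> int list \<Rightarrow> int list" where
  "bar_word p w = (if p \<le> 1 then w else slide 0 (p - 2) (d0 w))"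

lemma fpf_reduced_slide: "fpf_reduced w \<Longrightarrow> fpf_reduced (slide k m w)"
  by (induction k m w rule: slide.induct) (auto simp: fpf_reduced_ck)

lemma fpf_reduced_bar_word: "fpf_reduced w \<Longrightarrow> fpf_reduced (bar_word p w)"
  by (simp add: bar_word_def fpf_reduced_slide fpf_reduced_d0)

lemma (in word_map) slide: "fpf_reduced w \<Longrightarrow> \<Psi> (slide k m w) = slide k m (\<Psi> w)"
  by (induction k m w rule: slide.induct) (auto simp: ck fpf_reduced_ck)

lemma (in word_map) bar_word: "fpf_reduced w \<Longrightarrow> \<Psi> (bar_word p w) = bar_word p (\<Psi> w)"
  by (simp add: bar_word_def slide d0 fpf_reduced_d0)

lemma slide_right:
  assumes "incr (s # A)" "z < s"
  shows "slide (length X) (length A) (X @ [s, z] @ A @ Y) = X @ s # A @ z # Y"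
  using assms
proof (induction A arbitrary: X s)
  case (Cons a A)
  have "ck (length X) (X @ [s, z] @ (a # A) @ Y) = (X @ [s]) @ [a, z] @ A @ Y"
    using ck_append[of X "s # z # a # A @ Y"] Cons.prems by simp
  then show ?case using Cons.IH[of a "X @ [s]"] Cons.prems by simp
qed simp

text \<open>The remaining first factor and the letter handed over. In an increasing word
  \<open>x + 1\<close> directly follows \<open>x\<close>, which is why it is removed by a second
  \<open>tl\<close>.\<close>

definition bar_split :: "int list \<Rightarrow> int list \<times> int" where
  "bar_split A = (let x = hd A in if x + 1 \<notin> set A then (tl A, x) else (x # tl (tl A), x - 1))"

lemma bar_word_bar_split:
  assumes A: "incr A" "A \<noteq> []" and red: "fpf_reduced (A @ Z)"
  shows "bar_word (length A) (A @ Z) = fst (bar_split A) @ snd (bar_split A) # Z"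
    "incr (fst (bar_split A))" "length A = Suc (length (fst (bar_split A)))"
proof -
  obtain x A1 where A1: "A = x # A1" using A(2) by (cases A) auto
  have "bar_word (length A) (A @ Z) = fst (bar_split A) @ snd (bar_split A) # Z \<and>
    incr (fst (bar_split A)) \<and> length A = Suc (length (fst (bar_split A)))"
  proof (cases A1)
    case Nil
    then show ?thesis using A1 by (simp add: bar_split_def bar_word_def)
  next
    case (Cons a As)
    have s: "x < a" "incr (a # As)" "incr (x # As)" using A(1) A1 Cons by auto
    show ?thesis
    proof (cases "a = x + 1")
      case True
      have "d0 (A @ Z) = [] @ [x, x - 1] @ As @ Z" using A1 Cons True by simp
      then have "bar_word (length A) (A @ Z) = x # As @ (x - 1) # Z"
        using slide_right[OF s(3), of "x - 1" "[]" Z] A1 Cons by (simp add: bar_word_def)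
      then show ?thesis using A1 Cons True s by (simp add: bar_split_def)
    next
      case False
      have nx: "x + 1 \<notin> set A" using A1 Cons False s by auto
      have "d0 (A @ Z) = [] @ [a, x] @ As @ Z" using A1 Cons False s(1) by simp
      then have "bar_word (length A) (A @ Z) = a # As @ x # Z"
        using slide_right[OF s(2,1), of "[]" Z] A1 Cons by (simp add: bar_word_def)
      then show ?thesis using A1 Cons nx s by (simp add: bar_split_def)
    qed
  qed
  then show "bar_word (length A) (A @ Z) = fst (bar_split A) @ snd (bar_split A) # Z"
    "incr (fst (bar_split A))" "length A = Suc (length (fst (bar_split A)))" by blast+
qed

lemma Min_sorted_Cons:
  fixes x :: int
  assumes "incr (x # A)" shows "Min (set (x # A)) = x"
  using assms by (intro Min_eqI) auto

lemma fbar_pair_bar_split: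
  assumes A: "incr A" and B: "incr B"
  shows "fbar_pair A B = (if A = [] \<or> B \<noteq> [] \<and> hd B \<le> hd A then None else Some (fst (bar_split A), snd (bar_split A) # B))"
proof (cases A)
  case Nil
  then show ?thesis by (simp add: fbar_pair_def)
next
  case (Cons x A1)
  have m: "Min (set A) = x" using Min_sorted_Cons A Cons by metis
  have mB: "Min (set B) = hd B" if "B \<noteq> []" using that Min_sorted_Cons B by (cases B) auto
  have "remove1 (x + 1) A = x # tl A1" if "x + 1 \<in> set A"
  proof (cases A1)
    case Nil
    then show ?thesis using that Cons by simp
  next
    case (Cons a As)
    have "a = x + 1"
    proof (rule ccontr)
      assume "a \<noteq> x + 1"
      then have "x + 1 < a" using A \<open>A = x # A1\<close> Cons by simp
      then show False using that A \<open>A = x # A1\<close> Cons by auto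
    qed
    then show ?thesis using \<open>A = x # A1\<close> Cons by simp
  qed
  then show ?thesis using m mB Cons by (auto simp: fbar_pair_def bar_split_def Let_def simp del: Min_insert)
qed

text \<open>The second \<open>x\<close> commutes to the left until it meets the first
  \<open>x\<close> or the pair \<open>x, x + 1\<close>. The former is a square; in the latter a
  braid move brings \<open>x + 1\<close> to the front, but \<open>x\<close> is even.\<close>

lemma no_equal_minima:
  assumes A: "incr (x # A)" and red: "fpf_reduced (x # A @ x # Z)"
  shows False
proof -
  have far: "perm_word (x # C) = perm_word (C @ [x])" if "\<forall>c\<in>set C. x + 1 < c" for C
    using that by (intro perm_word_commute_list) auto
  show False
  proof (cases "x + 1 \<in> set A")
    case False
    have "\<forall>c\<in>set A. x + 1 < c" using A False by (metis add_le_same_cancel2 linorder_not_less order_le_less sorted_wrt.simps(2) zless_imp_add1_zle)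
    then have "conj_word ([x] @ (A @ [x]) @ Z) = conj_word ([x] @ (x # A) @ Z)" using far[of A] by (intro conj_word_block) simp
    then have "fpf_reduced ([x] @ (x # A) @ Z)" using fpf_reduced_cong[OF red, of "[x] @ (x # A) @ Z"] by simp
    then show False using not_fpf_reduced_square[of "[]" x "A @ Z"] by simp
  next
    case True
    then obtain a C where C: "A = a # C" by (cases A) auto
    have a: "a = x + 1" using A True C by auto
    have "\<forall>c\<in>set C. x + 1 < c" using A C a by auto
    then have "conj_word ([x, x + 1] @ (C @ [x]) @ Z) = conj_word ([x, x + 1] @ (x # C) @ Z)" using far[of C] by (intro conj_word_block) simp
    then have "conj_word (x # A @ x # Z) = conj_word ([] @ [x, x + 1, x] @ (C @ Z))" using C a by simp
    also have "\<dots> = conj_word ([] @ [x + 1, x, x + 1] @ (C @ Z))" by (rule conj_word_block) (rule perm_word_braid)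
    finally have "fpf_reduced ((x + 1) # x # (x + 1) # C @ Z)"
      using fpf_reduced_cong[OF red, of "(x + 1) # x # (x + 1) # C @ Z"] C by simp
    then have "even (x + 1)" by (rule fpf_reduced_hd_even)
    moreover have "even x" using red by (rule fpf_reduced_hd_even)
    ultimately show False by simp
  qed
qed

lemma bar_split_less: "snd (bar_split A) \<le> hd A" "hd A - 1 \<le> snd (bar_split A)"
  by (auto simp: bar_split_def Let_def)

lemma equivariant_fbar_pair: "equivariant True fbar_pair"
  unfolding equivariant_def
proof (intro allI impI)
  fix \<Psi> X A B Y X' A' B' Y' A2 B2
  assume \<Psi>: "word_map \<Psi>" and X: "True \<longrightarrow> X = []" and s: "incr A" "incr B" and red0: "fpf_reduced (X @ A @ B @ Y)"
    and img0: "\<Psi> (X @ A @ B @ Y) = X' @ A' @ B' @ Y'" "length X' = length X" and len: "length A' = length A" "length B' = length B"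
    and s': "incr A'" "incr B'" and op: "fbar_pair A B = Some (A2, B2)"
  interpret word_map \<Psi> by fact
  have XX: "X = []" "X' = []" using X img0(2) by auto
  have red: "fpf_reduced (A @ (B @ Y))" and img: "\<Psi> (A @ (B @ Y)) = A' @ (B' @ Y')" using red0 img0 XX by auto
  have ne: "A \<noteq> []" "\<not> (B \<noteq> [] \<and> hd B \<le> hd A)" and res: "A2 = fst (bar_split A)" "B2 = snd (bar_split A) # B"
    using op unfolding fbar_pair_bar_split[OF s] by (auto split: if_splits)
  have ne': "A' \<noteq> []" using ne len by auto
  have red': "fpf_reduced (A' @ (B' @ Y'))" using reduced[OF red] img by simp
  note b = bar_word_bar_split[OF s(1) ne(1) red] and b' = bar_word_bar_split[OF s'(1) ne' red']
  have redw: "fpf_reduced (A2 @ B2 @ Y)" using fpf_reduced_bar_word[OF red, of "length A"] b(1) res by simp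
  have "\<Psi> (bar_word (length A) (A @ (B @ Y))) = bar_word (length A') (A' @ (B' @ Y'))"
    unfolding bar_word[OF red] img len ..
  then have img2: "\<Psi> (A2 @ B2 @ Y) = fst (bar_split A') @ (snd (bar_split A') # B') @ Y'"
    using b(1) b'(1) res by simp
  \<comment> \<open>The comparison of the two minima is no descent of the original word, but after
    the move it nearly is: the letter handed over and the head of \<open>B\<close> form an ascent.
    In the image only equality of the heads remains to be excluded.\<close>
  have "\<not> (B' \<noteq> [] \<and> hd B' \<le> hd A')"
  proof
    assume asm: "B' \<noteq> [] \<and> hd B' \<le> hd A'"
    then obtain d D d' D' where B: "B = d # D" "B' = d' # D'" using len(2) by (cases B; cases B') auto
    let ?k = "length (fst (bar_split A))"
    have k: "length (fst (bar_split A')) = ?k" using b(3) b'(3) len by simp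
    have "snd (bar_split A) < d" using ne B bar_split_less(1)[of A] by simp
    then have "(A2 @ B2 @ Y) ! ?k < (A2 @ B2 @ Y) ! Suc ?k" using res B by (simp add: nth_append)
    moreover have "Suc ?k < length (A2 @ B2 @ Y)" using res B by simp
    ultimately have "\<Psi> (A2 @ B2 @ Y) ! ?k < \<Psi> (A2 @ B2 @ Y) ! Suc ?k" using desc[OF redw] unfolding same_desc_def by blast
    then have "snd (bar_split A') < d'" unfolding img2 using k B by (simp add: nth_append)
    then have "hd A' \<le> d'" using bar_split_less(2)[of A'] by simp
    then have "hd A' = d'" using asm B by simp
    moreover obtain x' C' where "A' = x' # C'" using ne' by (cases A') auto
    ultimately show False using no_equal_minima[of d' C' "D' @ Y'"] s'(1) red' B by simp
  qed
  then have "fbar_pair A' B' = Some (fst (bar_split A'), snd (bar_split A') # B')"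
    unfolding fbar_pair_bar_split[OF s'] using ne' by simp
  moreover have "incr B2"
  proof (cases B)
    case (Cons d D)
    then have "snd (bar_split A) < d" using ne bar_split_less(1)[of A] by simp
    then show ?thesis using res s(2) Cons by auto
  qed (use res in simp)
  ultimately show "\<exists>A2' B2'. fbar_pair A' B' = Some (A2', B2') \<and> \<Psi> (X @ A2 @ B2 @ Y) = X' @ A2' @ B2' @ Y' \<and>
       length A2' = length A2 \<and> length B2' = length B2 \<and> incr A2 \<and> incr B2 \<and>
       fpf_reduced (X @ A2 @ B2 @ Y)"
    using img2 redw XX b(2,3) b'(3) len res by (intro exI[of _ "fst (bar_split A')"] exI[of _ "snd (bar_split A') # B'"]) simp
qed

text \<open>The first letter \<open>x\<close> is even, so the letter handed over is even or odd
  according to the case, and \<open>ebar_pair\<close> can tell which case to undo.\<close>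

lemma fbar_imp_ebar:
  assumes s: "incr A" "incr B" and red: "fpf_reduced (A @ B @ Y)" and op: "fbar_pair A B = Some (A2, B2)"
  shows "ebar_pair A2 B2 = Some (A, B)"
proof -
  have ne: "A \<noteq> []" "\<not> (B \<noteq> [] \<and> hd B \<le> hd A)" and res: "A2 = fst (bar_split A)" "B2 = snd (bar_split A) # B"
    using op unfolding fbar_pair_bar_split[OF s] by (auto split: if_splits)
  obtain x A1 where A1: "A = x # A1" using ne(1) by (cases A) auto
  have x: "even x" using red A1 fpf_reduced_hd_even by simp
  have sB: "incr (z # B)" if "z \<le> x" for z using that ne A1 s(2) by (cases B) auto
  show ?thesis
  proof (cases "x + 1 \<in> set A")
    case False
    then have r: "A2 = A1" "B2 = x # B" using res A1 by (auto simp: bar_split_def)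
    have "Min (set B2) = x" unfolding r by (rule Min_sorted_Cons) (use sB[of x] in simp)
    moreover have "\<not> (A2 \<noteq> [] \<and> Min (set A2) \<le> x)"
    proof
      assume asm: "A2 \<noteq> [] \<and> Min (set A2) \<le> x"
      then have "Min (set A2) \<in> set A2" by (intro Min_in) auto
      then have "x < Min (set A2)" using s(1) A1 r by (metis sorted_wrt.simps(2))
      then show False using asm by linarith
    qed
    moreover have "insort x A1 = x # A1" using s(1) A1 by (cases A1) auto
    ultimately show ?thesis using r x A1 by (simp add: ebar_pair_def del: Min_insert)
  next
    case True
    then obtain C where C: "A1 = (x + 1) # C"
    proof (cases A1)
      case (Cons a C)
      have "a = x + 1"
      proof (rule ccontr)
        assume "a \<noteq> x + 1"
        then have "x + 1 < a" using s(1) A1 Cons by simp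
        then show False using True s(1) A1 Cons by auto
      qed
      then show ?thesis using that Cons by simp
    qed (use A1 in simp)
    have r: "A2 = x # C" "B2 = (x - 1) # B" using res A1 C by (auto simp: bar_split_def)
    have "Min (set B2) = x - 1" unfolding r by (rule Min_sorted_Cons) (use sB[of "x - 1"] in simp)
    moreover have "Min (set A2) = x" unfolding r by (rule Min_sorted_Cons) (use s(1) A1 C in auto)
    moreover have "insort (x + 1) (x # C) = x # (x + 1) # C" using s(1) A1 C by (cases C) auto
    ultimately show ?thesis using r x A1 C by (simp add: ebar_pair_def add.commute del: Min_insert)
  qed
qed

text \<open>\<open>x\<close> can be moved next to the first letter \<open>a\<close> of
  \<open>A\<close>. If these are not adjacent integers, \<open>x\<close> could come first and is
  even. So an odd \<open>x\<close> has \<open>a = x + 1\<close>, and the initial move replaces it by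
  \<open>x + 2\<close>.\<close>

lemma ebar_imp_fbar:
  assumes s: "incr A" "incr B" and red: "fpf_reduced (A @ B @ Y)" and op: "ebar_pair A B = Some (A2, B2)"
  shows "incr A2" "incr B2" "fpf_reduced (A2 @ B2 @ Y)" "fbar_pair A2 B2 = Some (A, B)"
proof -
  have ne: "B \<noteq> []" "\<not> (A \<noteq> [] \<and> Min (set A) \<le> Min (set B))"
    using op unfolding ebar_pair_def by (auto split: if_splits)
  obtain x B1 where B1: "B = x # B1" using ne(1) by (cases B) auto
  have mB: "Min (set B) = x" using Min_sorted_Cons s(2) B1 by metis
  have B2: "B2 = B1" and A2: "A2 = (if even x then insort x A else insort (x + 2) A)"
    using op ne mB B1 unfolding ebar_pair_def by (auto simp: Let_def split: if_splits simp del: Min_insert)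
  have sB1: "incr B1" "\<forall>d\<in>set B1. x < d" using s(2) B1 by auto
  have goal: "incr A2 \<and> fpf_reduced (A2 @ B1 @ Y) \<and> fbar_pair A2 B1 = Some (A, B)"
  proof (cases A)
    case Nil
    then have "even x" using red B1 fpf_reduced_hd_even by simp
    then have "A2 = [x]" using A2 Nil by simp
    moreover have "fbar_pair [x] B1 = Some ([], x # B1)"
      unfolding fbar_pair_bar_split[of "[x]" B1, simplified, OF sB1(1)] using sB1(2) by (cases B1) (auto simp: bar_split_def)
    ultimately show ?thesis using red Nil B1 by simp
  next
    case (Cons a C)
    have "Min (set A) = a" using Min_sorted_Cons s(1) Cons by metis
    then have xa: "x < a" using ne(2) mB Cons by simp
    have aC: "\<forall>c\<in>set C. a < c" and sC: "incr C" using s(1) Cons by auto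
    have ae: "even a" using red Cons fpf_reduced_hd_even by simp
    let ?Z = "C @ B1 @ Y"
    have "perm_word (x # C) = perm_word (C @ [x])" using aC xa by (intro perm_word_commute_list) auto
    then have "conj_word ([a] @ (x # C) @ (B1 @ Y)) = conj_word ([a] @ (C @ [x]) @ (B1 @ Y))" by (rule conj_word_block)
    then have "conj_word (a # x # ?Z) = conj_word (A @ B @ Y)" using Cons B1 by simp
    then have red1: "fpf_reduced (a # x # ?Z)" using fpf_reduced_cong[OF red, of "a # x # ?Z"] Cons B1 by simp
    have swap: "fpf_reduced (x # a # ?Z)" if "a \<noteq> x + 1"
    proof -
      have "perm_word [x, a] = perm_word [a, x]" using that xa by (intro perm_word_commute) auto
      then have "conj_word ([] @ [x, a] @ ?Z) = conj_word ([] @ [a, x] @ ?Z)" by (rule conj_word_block)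
      then show ?thesis using fpf_reduced_cong[OF red1, of "x # a # ?Z"] by simp
    qed
    show ?thesis
    proof (cases "even x")
      case True
      have ax: "a \<noteq> x + 1" using True ae by auto
      have A2': "A2 = x # A" using A2 True Cons xa by simp
      have sA2: "incr A2" using s(1) Cons xa aC A2' by auto
      have "x + 1 \<notin> set A2" using A2' Cons ax aC xa by auto
      then have "fbar_pair A2 B1 = Some (A, B)"
        unfolding fbar_pair_bar_split[OF sA2 sB1(1)] using A2' B1 sB1(2) by (cases B1) (auto simp: bar_split_def)
      then show ?thesis using sA2 swap[OF ax] A2' Cons by simp
    next
      case False
      have ax: "a = x + 1"
      proof (rule ccontr)
        assume "a \<noteq> x + 1"
        then show False using swap fpf_reduced_hd_even False by blast
      qed
      have "conj_word [a, x + 2] = conj_word [a, x]" using conj_word_initial_step[OF ae] ax by (simp add: add.commute)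
      then have "conj_word ([a, x + 2] @ ?Z) = conj_word ([a, x] @ ?Z)" by (simp only: conj_word_append)
      then have red2: "fpf_reduced (a # (x + 2) # ?Z)" using fpf_reduced_cong[OF red1, of "a # (x + 2) # ?Z"] by simp
      have C2: "\<forall>c\<in>set C. x + 2 < c"
      proof
        fix c assume c: "c \<in> set C"
        then obtain d D where D: "C = d # D" by (cases C) auto
        have "d \<noteq> x + 2" using red2 D not_fpf_reduced_square[of "[a]" "x + 2" "D @ B1 @ Y"] by auto
        then have "x + 2 < d" using aC D ax by auto
        then show "x + 2 < c" using c D sC by auto
      qed
      have A2': "A2 = a # (x + 2) # C" using A2 False Cons ax C2 by (cases C) auto
      have sA2: "incr A2" using A2' ax C2 sC by auto
      have "\<not> (B1 \<noteq> [] \<and> hd B1 \<le> a)"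
      proof
        assume asm: "B1 \<noteq> [] \<and> hd B1 \<le> a"
        then obtain d D where D: "B1 = d # D" by (cases B1) auto
        then have "d = a" using asm sB1(2) ax by auto
        then show False using no_equal_minima[of a "(x + 2) # C" "D @ Y"] sA2 A2' red2 D by simp
      qed
      then have "fbar_pair A2 B1 = Some (A, B)"
        unfolding fbar_pair_bar_split[OF sA2 sB1(1)] using A2' B1 Cons ax by (auto simp: bar_split_def)
      then show ?thesis using sA2 red2 A2' by simp
    qed
  qed
  then show "incr A2" "incr B2" "fpf_reduced (A2 @ B2 @ Y)" "fbar_pair A2 B2 = Some (A, B)"
    using B2 sB1(1) by auto
qed

lemma same_desc_append:
  assumes "same_desc (a @ b) (c @ d)" "length a = length c" shows "same_desc a c" "same_desc b d"
proof -
  have len: "length d = length b" using assms by (simp add: same_desc_def)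
  have d: "(a @ b) ! k < (a @ b) ! Suc k \<longleftrightarrow> (c @ d) ! k < (c @ d) ! Suc k" if "Suc k < length (a @ b)" for k
    using assms(1) that unfolding same_desc_def by blast
  have "a ! k < a ! Suc k \<longleftrightarrow> c ! k < c ! Suc k" if "Suc k < length a" for k
    using d[of k] that assms(2) by (simp add: nth_append)
  then show "same_desc a c" using assms(2) by (simp add: same_desc_def)
  have "b ! k < b ! Suc k \<longleftrightarrow> d ! k < d ! Suc k" if "Suc k < length b" for k
    using d[of "length a + k"] that assms(2) by (simp add: nth_append)
  then show "same_desc b d" using len by (simp add: same_desc_def)
qed

lemma same_desc_sorted: "same_desc a c \<Longrightarrow> incr a \<Longrightarrow> incr c"
  by (simp add: sorted_wrt_iff_nth_Suc_transp same_desc_def)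

text \<open>Equivariance of \<open>fbar_pair\<close> is applied to the result
  \<open>(A2, B2)\<close>. By lengths its value in the image is \<open>(A', B')\<close>, from which
  \<open>ebar_pair\<close> leads back.\<close>

lemma equivariant_ebar_pair: "equivariant True ebar_pair"
  unfolding equivariant_def
proof (intro allI impI)
  fix \<Psi> X A B Y X' A' B' Y' A2 B2
  assume \<Psi>: "word_map \<Psi>" and X: "True \<longrightarrow> X = []" and s: "incr A" "incr B" and red: "fpf_reduced (X @ A @ B @ Y)"
    and img: "\<Psi> (X @ A @ B @ Y) = X' @ A' @ B' @ Y'" "length X' = length X" and len: "length A' = length A" "length B' = length B"
    and s': "incr A'" "incr B'" and op: "ebar_pair A B = Some (A2, B2)"
  interpret word_map \<Psi> by fact
  have XX: "X = []" "X' = []" using X img(2) by auto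
  have red0: "fpf_reduced (A @ B @ Y)" using red XX by simp
  note e = ebar_imp_fbar[OF s red0 op]
  define v where "v = \<Psi> (A2 @ B2 @ Y)"
  define A2' where "A2' = take (length A2) v"
  define B2' where "B2' = take (length B2) (drop (length A2) v)"
  define Y2 where "Y2 = drop (length B2) (drop (length A2) v)"
  have lv: "length v = length A2 + (length B2 + length Y)" using length[OF e(3)] by (simp add: v_def)
  have v: "v = A2' @ B2' @ Y2" unfolding A2'_def B2'_def Y2_def append_take_drop_id ..
  have l: "length A2' = length A2" "length B2' = length B2" using lv by (auto simp: A2'_def B2'_def)
  have sd: "same_desc (A2 @ (B2 @ Y)) (A2' @ (B2' @ Y2))" using desc[OF e(3)] v v_def by metis
  have s2: "incr A2'" using same_desc_append(1)[OF sd] same_desc_sorted e(1) l by metis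
  have sd': "same_desc (B2 @ Y) (B2' @ Y2)" using same_desc_append(2)[OF sd] l by metis
  have s2': "incr B2'" using same_desc_append(1)[OF sd'] same_desc_sorted e(2) l by metis
  have v0: "\<Psi> ([] @ A2 @ B2 @ Y) = [] @ A2' @ B2' @ Y2" using v v_def by simp
  have e3: "fpf_reduced ([] @ A2 @ B2 @ Y)" using e(3) by simp
  obtain A'' B'' where f: "fbar_pair A2' B2' = Some (A'', B'')" "\<Psi> ([] @ A @ B @ Y) = [] @ A'' @ B'' @ Y2"
    "length A'' = length A" "length B'' = length B"
    using equivariant_fbar_pair[unfolded equivariant_def, rule_format, OF \<Psi> _ e(1,2) e3 v0 _ l s2 s2' e(4)] by auto
  have "A' @ B' @ Y' = A'' @ B'' @ Y2" using f(2) img(1) XX by simp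
  then have eqs: "A' = A''" "B' = B''" "Y' = Y2" using f(3,4) len by simp_all
  have "fpf_reduced (A2' @ B2' @ Y2)" using reduced[OF e(3)] v v_def by metis
  then have "ebar_pair A' B' = Some (A2', B2')" using fbar_imp_ebar[OF s2 s2' _ f(1)] eqs by simp
  then show "\<exists>A2' B2'. ebar_pair A' B' = Some (A2', B2') \<and> \<Psi> (X @ A2 @ B2 @ Y) = X' @ A2' @ B2' @ Y' \<and>
       length A2' = length A2 \<and> length B2' = length B2 \<and> incr A2 \<and> incr B2 \<and>
       fpf_reduced (X @ A2 @ B2 @ Y)"
    using v0 XX l e eqs by (intro exI[of _ A2'] exI[of _ B2']) simp
qed

section \<open>Factorizations\<close>

text \<open>Every word represents an element of \<open>IfpfZ\<close>, so the union over all of them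
  leaves only reducedness as a condition.\<close>

lemma RSp_union_iff:
  "ws \<in> RSp_union n \<longleftrightarrow> length ws = n \<and> (\<forall>w\<in>set ws. incr w) \<and> fpf_reduced (concat ws)"
  unfolding RSp_union_def RSp_n_def by (auto simp: RSp_iff conj_word_in_IfpfZ)

lemma split_lens_concat: "split_lens (map length ws) (concat ws) = ws"
  by (induction ws) auto

lemma concat_split_lens: "length v = sum_list ls \<Longrightarrow> concat (split_lens ls v) = v \<and> map length (split_lens ls v) = ls"
  by (induction ls arbitrary: v) auto

lemma same_desc_factors:
  "same_desc (concat ws) (concat vs) \<Longrightarrow> map length ws = map length vs \<Longrightarrow> \<forall>w\<in>set ws. incr w \<Longrightarrow>
    \<forall>v\<in>set vs. incr v"
proof (induction ws arbitrary: vs)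
  case (Cons w ws)
  then obtain v vs' where vs: "vs = v # vs'" "length w = length v" "map length ws = map length vs'" by (cases vs) auto
  have sd: "same_desc (w @ concat ws) (v @ concat vs')" using Cons.prems(1) vs by simp
  show ?case using same_desc_append[OF sd vs(2)] Cons.IH[of vs'] Cons.prems(3) vs same_desc_sorted[of w v] by auto
qed simp

definition fact_map :: "(int list \<Rightarrow> int list) \<Rightarrow> int list list \<Rightarrow> int list list" where
  "fact_map \<Psi> ws = split_lens (map length ws) (\<Psi> (concat ws))"

lemma concat_two:
  assumes "Suc k < length ws"
  shows "concat ws = concat (take k ws) @ ws ! k @ ws ! Suc k @ concat (drop (Suc (Suc k)) ws)"
    "concat (ws[k := A, Suc k := B]) = concat (take k ws) @ A @ B @ concat (drop (Suc (Suc k)) ws)"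
proof -
  have "ws = take k ws @ [ws ! k, ws ! Suc k] @ drop (Suc (Suc k)) ws"
    using assms by (metis Cons_nth_drop_Suc Suc_lessD append_Cons append_Nil id_take_nth_drop)
  from arg_cong[OF this, of concat]
  show "concat ws = concat (take k ws) @ ws ! k @ ws ! Suc k @ concat (drop (Suc (Suc k)) ws)" by simp
  have "ws[k := A, Suc k := B] = take k ws @ [A, B] @ drop (Suc (Suc k)) ws"
    using assms by (simp add: upd_conv_take_nth_drop take_Suc_conv_app_nth nth_append)
  from arg_cong[OF this, of concat]
  show "concat (ws[k := A, Suc k := B]) = concat (take k ws) @ A @ B @ concat (drop (Suc (Suc k)) ws)" by simp
qed

definition lift_op :: "nat \<Rightarrow> pair_op \<Rightarrow> int list list \<Rightarrow> int list list option" where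
  "lift_op k op ws = map_option (\<lambda>(A, B). ws[k := A, Suc k := B]) (op (ws ! k) (ws ! Suc k))"

context word_map
begin

lemma fact_map:
  assumes "ws \<in> RSp_union n"
  shows "fact_map \<Psi> ws \<in> RSp_union n" "concat (fact_map \<Psi> ws) = \<Psi> (concat ws)"
    "map length (fact_map \<Psi> ws) = map length ws"
proof -
  have red: "fpf_reduced (concat ws)" using assms by (simp add: RSp_union_iff)
  have "length (\<Psi> (concat ws)) = sum_list (map length ws)" using length[OF red] by (simp add: length_concat)
  then show c: "concat (fact_map \<Psi> ws) = \<Psi> (concat ws)" and l: "map length (fact_map \<Psi> ws) = map length ws"
    unfolding fact_map_def using concat_split_lens by blast+
  have "same_desc (concat ws) (concat (fact_map \<Psi> ws))" using desc[OF red] c by simp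
  then have "\<forall>v\<in>set (fact_map \<Psi> ws). incr v"
    using same_desc_factors l assms by (metis RSp_union_iff)
  moreover have "length (fact_map \<Psi> ws) = n" using l assms by (metis RSp_union_iff length_map)
  ultimately show "fact_map \<Psi> ws \<in> RSp_union n" using c reduced[OF red] by (simp add: RSp_union_iff)
qed

lemma lift_op_Some:
  assumes eq: "equivariant first op" and ws: "ws \<in> RSp_union n" and k: "Suc k < n" "first \<Longrightarrow> k = 0"
    and op: "lift_op k op ws = Some us"
  shows "lift_op k op (fact_map \<Psi> ws) = Some (fact_map \<Psi> us)"
proof -
  let ?vs = "fact_map \<Psi> ws"
  have W: "length ws = n" "\<forall>w\<in>set ws. incr w" "fpf_reduced (concat ws)" using ws by (auto simp: RSp_union_iff)
  note V = fact_map[OF ws]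
  have V': "length ?vs = n" "\<forall>w\<in>set ?vs. incr w" using V(1) by (auto simp: RSp_union_iff)
  have kw: "Suc k < length ws" and kv: "Suc k < length ?vs" using k W V' by auto
  have lens: "length (?vs ! i) = length (ws ! i)" if "i < n" for i
    using V(3) that W V' by (metis nth_map)
  obtain A2 B2 where AB: "op (ws ! k) (ws ! Suc k) = Some (A2, B2)" "us = ws[k := A2, Suc k := B2]"
    using op unfolding lift_op_def by auto
  let ?X = "concat (take k ws)" and ?Y = "concat (drop (Suc (Suc k)) ws)"
    and ?X' = "concat (take k ?vs)" and ?Y' = "concat (drop (Suc (Suc k)) ?vs)"
  have red: "fpf_reduced (?X @ ws ! k @ ws ! Suc k @ ?Y)" using concat_two(1)[OF kw] W(3) by simp
  have img: "\<Psi> (?X @ ws ! k @ ws ! Suc k @ ?Y) = ?X' @ ?vs ! k @ ?vs ! Suc k @ ?Y'"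
    using concat_two(1)[OF kw] concat_two(1)[OF kv] V(2) by simp
  have lX: "length ?X' = length ?X" using V(3) by (simp add: length_concat take_map[symmetric])
  have fX: "first \<longrightarrow> ?X = []" using k(2) by auto
  obtain A2' B2' where A2: "op (?vs ! k) (?vs ! Suc k) = Some (A2', B2')" "\<Psi> (?X @ A2 @ B2 @ ?Y) = ?X' @ A2' @ B2' @ ?Y'"
    "length A2' = length A2" "length B2' = length B2"
    using eq[unfolded equivariant_def, rule_format, OF word_map_axioms _ _ _ red img lX _ _ _ _ AB(1)]
      fX W(2) V'(2) kw kv lens k(1) by auto
  have "map length (?vs[k := A2', Suc k := B2']) = map length us"
    unfolding AB(2) map_update V(3) A2(3,4) ..
  moreover have "concat (?vs[k := A2', Suc k := B2']) = \<Psi> (concat us)"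
    unfolding AB(2) concat_two(2)[OF kw] concat_two(2)[OF kv] A2(2) ..
  ultimately have "?vs[k := A2', Suc k := B2'] = fact_map \<Psi> us"
    unfolding fact_map_def using split_lens_concat by metis
  then show ?thesis unfolding lift_op_def A2(1) by simp
qed

end

lemma fact_map_inv:
  assumes "word_map \<Psi>" "ws \<in> RSp_union n"
  shows "fact_map (inv_into {w. fpf_reduced w} \<Psi>) (fact_map \<Psi> ws) = ws"
    "fact_map \<Psi> (fact_map (inv_into {w. fpf_reduced w} \<Psi>) ws) = ws"
proof -
  interpret word_map \<Psi> by fact
  interpret inv: word_map "inv_into {w. fpf_reduced w} \<Psi>" using assms(1) by (rule word_map_inv)
  have red: "fpf_reduced (concat ws)" using assms(2) by (simp add: RSp_union_iff)
  have "inv_into {w. fpf_reduced w} \<Psi> (\<Psi> (concat ws)) = concat ws"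
    using bij red by (intro inv_into_f_f) (simp_all add: bij_betw_def)
  then show "fact_map (inv_into {w. fpf_reduced w} \<Psi>) (fact_map \<Psi> ws) = ws"
    unfolding fact_map_def[of "inv_into {w. fpf_reduced w} \<Psi>"] fact_map(2,3)[OF assms(2)] using split_lens_concat by metis
  have "\<Psi> (inv_into {w. fpf_reduced w} \<Psi> (concat ws)) = concat ws"
    using bij red by (intro f_inv_into_f) (simp add: bij_betw_def)
  then show "fact_map \<Psi> (fact_map (inv_into {w. fpf_reduced w} \<Psi>) ws) = ws"
    unfolding fact_map_def[of \<Psi>] inv.fact_map(2,3)[OF assms(2)] using split_lens_concat by metis
qed

text \<open>If the operator were defined at the image only, the inverse of \<open>\<Psi>\<close>,
  again a \<open>word_map\<close>, would carry that value back to \<open>ws\<close>.\<close>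

lemma lift_op_fact_map:
  assumes \<Psi>: "word_map \<Psi>" and eq: "equivariant first op" and ws: "ws \<in> RSp_union n"
    and k: "Suc k < n" "first \<Longrightarrow> k = 0"
  shows "lift_op k op (fact_map \<Psi> ws) = map_option (fact_map \<Psi>) (lift_op k op ws)"
proof (cases "lift_op k op ws")
  case (Some us)
  then show ?thesis using word_map.lift_op_Some[OF \<Psi> eq ws k] by simp
next
  case None
  let ?\<Phi> = "inv_into {w. fpf_reduced w} \<Psi>"
  have "lift_op k op (fact_map \<Psi> ws) = None"
  proof (rule ccontr)
    assume "lift_op k op (fact_map \<Psi> ws) \<noteq> None"
    then obtain us where "lift_op k op (fact_map \<Psi> ws) = Some us" by blast
    then have "lift_op k op (fact_map ?\<Phi> (fact_map \<Psi> ws)) = Some (fact_map ?\<Phi> us)"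
      using word_map.lift_op_Some[OF word_map_inv[OF \<Psi>] eq word_map.fact_map(1)[OF \<Psi> ws] k] by blast
    then show False using None fact_map_inv(1)[OF \<Psi> ws] by simp
  qed
  then show ?thesis using None by simp
qed

lemma f_op_lift: "f_op (Suc k) ws = lift_op k f_pair ws"
  by (simp add: f_op_def lift_op_def f_pair_def Let_def)

lemma e_op_lift: "e_op (Suc k) ws = lift_op k e_pair ws"
  by (simp add: e_op_def lift_op_def e_pair_def Let_def)

lemma fbar_op_lift: "fbar_op ws = lift_op 0 fbar_pair ws"
  unfolding fbar_op_def lift_op_def fbar_pair_def Let_def One_nat_def
  by (simp only: if_distrib[of "map_option (\<lambda>(A, B). ws[0 := A, Suc 0 := B])"] option.map prod.case)

lemma ebar_op_lift: "ebar_op ws = lift_op 0 ebar_pair ws"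
  unfolding ebar_op_def lift_op_def ebar_pair_def Let_def One_nat_def
  by (simp only: if_distrib[of "map_option (\<lambda>(A, B). ws[0 := A, Suc 0 := B])"] option.map prod.case)

theorem theorem4p24:
  fixes n :: nat and \<pi> :: "int \<Rightarrow> int"
  assumes "0 < n" and "\<pi> \<in> IfpfZ"
  shows "qn_crystal_iso n (RSp_union n) (fb_fact \<pi>)"
proof -
  have fb: "fb_fact \<pi> = fact_map (fb \<pi>)" by (auto simp: fb_fact_def fact_map_def)
  let ?\<Phi> = "inv_into {w. fpf_reduced w} (fb \<pi>)"
  note wm = word_map_fb[of \<pi>]
  note wi = word_map_inv[OF wm]
  have "bij_betw (fact_map (fb \<pi>)) (RSp_union n) (RSp_union n)"
    by (rule bij_betw_byWitness[where f' = "fact_map ?\<Phi>"])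
      (auto simp: fact_map_inv[OF wm] word_map.fact_map(1)[OF wm] word_map.fact_map(1)[OF wi])
  moreover have "wt (fact_map (fb \<pi>) b) = wt b" if "b \<in> RSp_union n" for b
    using word_map.fact_map(3)[OF wm that] by (simp add: wt_def)
  moreover have "f_op i (fact_map (fb \<pi>) b) = map_option (fact_map (fb \<pi>)) (f_op i b)
      \<and> e_op i (fact_map (fb \<pi>) b) = map_option (fact_map (fb \<pi>)) (e_op i b)"
    if b: "b \<in> RSp_union n" and i: "i \<in> {1..<n}" for b i
  proof -
    obtain k where k: "i = Suc k" "Suc k < n" using i by (cases i) auto
    show ?thesis unfolding k(1) f_op_lift e_op_lift
      using lift_op_fact_map[OF wm equivariant_letter_transfer[OF letter_transfer_f_pair] b k(2)] lift_op_fact_map[OF wm equivariant_letter_transfer[OF letter_transfer_e_pair] b k(2)] by simp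
  qed
  moreover have "fbar_op (fact_map (fb \<pi>) b) = map_option (fact_map (fb \<pi>)) (fbar_op b)
      \<and> ebar_op (fact_map (fb \<pi>) b) = map_option (fact_map (fb \<pi>)) (ebar_op b)"
    if "b \<in> RSp_union n" "2 \<le> n" for b
    unfolding fbar_op_lift ebar_op_lift
    using lift_op_fact_map[OF wm equivariant_fbar_pair that(1), of 0] lift_op_fact_map[OF wm equivariant_ebar_pair that(1), of 0] that(2) by simp
  ultimately show ?thesis unfolding qn_crystal_iso_def fb by blast
qed

end
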